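(* Let $n\ge2$, $s\in(0,1)$, and for $x=(x_1,x')\in\mathbb R\times\mathbb R^{n-1}$ set $$H=\{x\in\mathbb R^n: x_1>0\},\qquad \widetilde x=(-x_1,x').$$ Let $B_r(x_0)\subset H$ be a ball with center $x_0$ and radius $r>0$, and let $c\in L^\infty(B_r(x_0))$. Assume $u\in\mathcal L^{2s}(\mathbb R^n)$ is antisymmetric with respect to $\partial H$, namely $u(\widetilde x)=-u(x)$ for a.e. $x\in H$, and $u\ge0$ a.e. in $H$. Suppose $$\mathscr{L}_su+cu\ge0\qquad\text{in }\mathcal D'(B_r(x_0)\setminus\{x_0\}),$$ and, for some constant $m$, $$u\ge m>0\qquad\text{a.e. in }B_r(x_0)\setminus B_{r/2}(x_0).$$ Then $$u\ge\alpha m\qquad\text{a.e. in }B_r(x_0)\setminus\{x_0\},$$ where $\alpha=\alpha\left(n,s,r^{2s}\|c^+\|_{L^\infty(B_r(x_0))}\right)>0$ is a constant depending only on $n$, $s$ and $r^{2s}\|c^+\|_{L^\infty(B_r(x_0))}$, with $c^+=\max\{c,0\}$. Moreover, for $0<r\le1$ the constant $\alpha$ may be chosen uniformly in $r$ (depending only on $n$, $s$ and $\|c^+\|_{L^\infty(B_r(x_0))}$), while for $c\le0$ it depends only on $n$ and $s$.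
   Context: $\mathscr{L}_s=-\Delta+(-\Delta)^s$, where the fractional Laplacian is normalized by $(-\Delta)^s\phi(x)=C_{n,s}\,\mathrm{PV}\int_{\mathbb R^n}\frac{\phi(x)-\phi(y)}{|x-y|^{n+2s}}\,dy$ with $C_{n,s}=\frac{2^{2s}\Gamma(s+n/2)}{\pi^{n/2}|\Gamma(-s)|}$. Define $$\mathcal L^{2s}(\mathbb R^n)=\left\{u\in L^1_{\mathrm{loc}}(\mathbb R^n)\ \middle|\ \int_{\mathbb R^n}\frac{|u(x)|}{1+|x|^{n+2s}}\,dx<\infty\right\}$$ (real-valued functions). For $\Omega\subset\mathbb R^n$ open and $u\in\mathcal L^{2s}(\mathbb R^n)$, the distribution $\mathscr{L}_su$ in $\Omega$ is defined by $\langle\mathscr{L}_su,\phi\rangle=\int_{\mathbb R^n}u(x)\,\mathscr{L}_s\phi(x)\,dx$ for $\phi\in C_c^\infty(\Omega)$. An inequality $T\ge0$ in $\mathcal D'(\Omega)$ means $\langle T,\phi\rangle\ge0$ for all $0\le\phi\in C_c^\infty(\Omega)$. *)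

theory Defs
  imports "HOL-Analysis.Analysis" "HOL-Probability.Essential_Supremum"
begin

text \<open>All notions are set up on an arbitrary Euclidean space \<open>'a\<close>, whose dimension
  \<open>DIM('a)\<close> plays the role of \<open>n\<close>. ``Measurable'' means Lebesgue measurable.\<close>

definition partial_deriv :: "'a::euclidean_space \<Rightarrow> ('a \<Rightarrow> real) \<Rightarrow> 'a \<Rightarrow> real"
  where "partial_deriv i f x = frechet_derivative f (at x) i"

fun C_k :: "nat \<Rightarrow> ('a::euclidean_space \<Rightarrow> real) \<Rightarrow> bool"
  where
    "C_k 0 f \<longleftrightarrow> continuous_on UNIV f"
  | "C_k (Suc k) f \<longleftrightarrow> (\<forall>x. f differentiable (at x)) \<and> (\<forall>i\<in>Basis. C_k k (partial_deriv i f))"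

text \<open>\<open>C\<^sub>c\<^sup>\<infinity>(\<Omega>)\<close>, each element being extended by zero to the whole space.\<close>

definition test_functions :: "'a::euclidean_space set \<Rightarrow> ('a \<Rightarrow> real) set"
  where "test_functions \<Omega> =
    {\<phi>. (\<forall>k. C_k k \<phi>) \<and> compact (closure {x. \<phi> x \<noteq> 0}) \<and> closure {x. \<phi> x \<noteq> 0} \<subseteq> \<Omega>}"

definition laplacian :: "('a::euclidean_space \<Rightarrow> real) \<Rightarrow> 'a \<Rightarrow> real"
  where "laplacian f x = (\<Sum>i\<in>Basis. partial_deriv i (partial_deriv i f) x)"

definition frac_const :: "nat \<Rightarrow> real \<Rightarrow> real"
  where "frac_const n s =
    2 powr (2 * s) * Gamma (s + real n / 2) / (pi powr (real n / 2) * \<bar>Gamma (- s)\<bar>)"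

text \<open>The principal value removes a ball around the singularity \<open>y = x\<close>.\<close>

definition frac_laplacian :: "real \<Rightarrow> ('a::euclidean_space \<Rightarrow> real) \<Rightarrow> 'a \<Rightarrow> real"
  where "frac_laplacian s \<phi> x = frac_const DIM('a) s *
    Lim (at_right 0) (\<lambda>\<epsilon>. LINT y:- ball x \<epsilon>|lebesgue.
      (\<phi> x - \<phi> y) / norm (x - y) powr (real DIM('a) + 2 * s))"

definition mixed_op :: "real \<Rightarrow> ('a::euclidean_space \<Rightarrow> real) \<Rightarrow> 'a \<Rightarrow> real"
  where "mixed_op s \<phi> x = - laplacian \<phi> x + frac_laplacian s \<phi> x"

text \<open>\<open>\<L>\<^sup>2\<^sup>s\<close>: the first conjunct is membership in \<open>L\<^sup>1\<^sub>l\<^sub>o\<^sub>c\<close>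
  and includes measurability.\<close>

definition L2s_space :: "real \<Rightarrow> ('a::euclidean_space \<Rightarrow> real) set"
  where "L2s_space s =
    {u. (\<forall>K. compact K \<longrightarrow> u absolutely_integrable_on K) \<and>
        integrable lebesgue (\<lambda>x. \<bar>u x\<bar> / (1 + norm x powr (real DIM('a) + 2 * s)))}"

definition mixed_op_distr :: "real \<Rightarrow> ('a::euclidean_space \<Rightarrow> real) \<Rightarrow> ('a \<Rightarrow> real) \<Rightarrow> real"
  where "mixed_op_distr s u \<phi> = (LINT x|lebesgue. u x * mixed_op s \<phi> x)"

definition regular_distr :: "'a::euclidean_space set \<Rightarrow> ('a \<Rightarrow> real) \<Rightarrow> ('a \<Rightarrow> real) \<Rightarrow> real"
  where "regular_distr \<Omega> f \<phi> = (LINT x:\<Omega>|lebesgue. f x * \<phi> x)"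

definition distr_nonneg :: "'a::euclidean_space set \<Rightarrow> (('a \<Rightarrow> real) \<Rightarrow> real) \<Rightarrow> bool"
  where "distr_nonneg \<Omega> T \<longleftrightarrow> (\<forall>\<phi>\<in>test_functions \<Omega>. (\<forall>x. 0 \<le> \<phi> x) \<longrightarrow> 0 \<le> T \<phi>)"

text \<open>Functions in \<open>L\<^sup>\<infinity>(S)\<close> are represented by total functions; values outside
  \<open>S\<close> are irrelevant.\<close>

definition Linf_space :: "'a::euclidean_space set \<Rightarrow> ('a \<Rightarrow> real) set"
  where "Linf_space S =
    {f. f \<in> borel_measurable (lebesgue_on S) \<and>
        esssup (lebesgue_on S) (\<lambda>x. ereal \<bar>f x\<bar>) < \<infinity>}"

definition Linf_norm :: "'a::euclidean_space set \<Rightarrow> ('a \<Rightarrow> real) \<Rightarrow> real"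
  where "Linf_norm S f = real_of_ereal (esssup (lebesgue_on S) (\<lambda>x. ereal \<bar>f x\<bar>))"

text \<open>\<open>\<real>\<^sup>n\<close> with \<open>n \<ge> 2\<close> appears as \<open>\<real> \<times> \<real>\<^sup>n\<^sup>-\<^sup>1\<close>, i.e. as \<^typ>\<open>real \<times> (real ^ 'm)\<close> with
  \<open>n = CARD('m) + 1\<close>; the product norm is the Euclidean one.\<close>

definition half_space :: "(real \<times> (real ^ 'm)) set"
  where "half_space = {x. 0 < fst x}"

definition reflect :: "real \<times> (real ^ 'm) \<Rightarrow> real \<times> (real ^ 'm)"
  where "reflect x = (- fst x, snd x)"

end

theory Submission
  imports Defs
begin

text \<open>The theorem is a minimum principle read off at one point. Write \<open>k z = |z| powr - (n + 2 * s)\<close> and let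
\<open>K\<close> bound \<open>c\<close> from above on the ball. Suppose for a moment that \<open>u\<close> is smooth and that its minimum over
the ball of radius \<open>3 r / 4\<close> around \<open>x0\<close> is attained at a point \<open>x\<close> where the value is smaller than \<open>m\<close>; such an \<open>x\<close> lies in the inner half
of the ball. There \<open>- \<Delta> u x \<le> 0\<close>. For the nonlocal part, antisymmetry folds the integral onto the
half space, where the kernel becomes \<open>k (x - y) - k (x - reflect y) \<ge> 0\<close>. Since \<open>u \<ge> 0\<close> there, the
region outside the smaller ball can only lower \<open>(- \<Delta>)^s u x\<close> apart from a contribution of order \<open>u x * r powr - (2 * s)\<close>, and the part
of the annulus on which \<open>u \<ge> m\<close> lowers it by a fixed multiple of \<open>m * r powr - (2 * s)\<close>. So
\<open>- \<Delta> u + (- \<Delta>)^s u + c u \<ge> 0\<close> at \<open>x\<close> forces \<open>u x \<ge> \<alpha> m\<close>, where \<open>1 / \<alpha>\<close> grows at most linearly in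
\<open>r powr (2 * s) * K\<close>. The local term has scaling \<open>r powr - 2\<close>, but as it enters only through its sign
the constant sees nothing but \<open>r powr (2 * s) * K\<close>; as \<open>\<alpha>\<close> decreases in this quantity, the same function
serves for \<open>r \<le> 1\<close>, and its value at \<open>0\<close> serves for \<open>c \<le> 0\<close>.

Two things stand in the way of this computation.

The function \<open>u\<close> is merely integrable and the inequality is distributional. Both are cured by
convolving \<open>u\<close> with a radially decreasing bump of radius \<open>\<epsilon>\<close>, because antisymmetry, the sign in the half
space and the lower bound on a slightly thinner annulus survive (lemmas \<open>mollify_reflect\<close>,
\<open>mollify_nonneg_half_space\<close>, \<open>mollify_ge\<close>). Testing the inequality with the bump centred at \<open>x\<close>
is an inequality between second differences and truncated singular integrals of the convolution at \<open>x\<close>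
(theorem \<open>mixed_op_distr_limit\<close>).

The inequality says nothing at \<open>x0\<close>. A multiple \<open>\<theta> \<Psi>\<close> of a barrier
\<open>\<Psi> = const - ln q - q powr p\<close> with \<open>q = |x - x0|^2 + \<epsilon>^2\<close> is added before minimising. It is huge on the
ball of radius \<open>\<epsilon>\<close> around \<open>x0\<close>, so the minimum is attained where the test function avoids \<open>x0\<close>.
For \<open>n \<ge> 2\<close> the term \<open>- ln q\<close> is superharmonic, and the correction \<open>- q powr p\<close> makes this strict:
\<open>\<Delta> \<Psi> \<le> - 4 p^2 q powr (p - 1)\<close> (lemma \<open>barrier_laplacian_le\<close>). The price paid in the fractional
Laplacian is only of order \<open>q powr - s\<close> (lemma \<open>barrier_integral_le\<close>). With \<open>p = (1 - s) / 2\<close> one has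
\<open>1 - p > s\<close>, so the gain absorbs the price up to a constant \<open>M\<close>, and \<open>\<theta> M\<close> is harmless for small \<open>\<theta>\<close>.

Lemma \<open>antisymmetric_trunc_le\<close> is the estimate of the nonlocal term, \<open>mollify_lower_bound\<close> combines it
with the barrier, and \<open>AE_ge_of_mollify\<close> lets \<open>\<epsilon>\<close> and then \<open>\<theta>\<close> tend to \<open>0\<close>.\<close>

section \<open>Smooth functions and a bump profile\<close>

lemma partial_deriv_eqI: "(f has_derivative f') (at x) \<Longrightarrow> partial_deriv i f x = f' i"
  unfolding partial_deriv_def by (metis frechet_derivative_at)

lemma C_k_mono: "C_k (Suc k) f \<Longrightarrow> C_k k f"
proof (induction k arbitrary: f)
  case 0
  then show ?case
    by (auto intro!: differentiable_imp_continuous_on simp: differentiable_on_def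
          intro: differentiable_at_withinI)
next
  case (Suc k)
  then show ?case by (metis C_k.simps(2))
qed

lemma C_k_const: "C_k k (\<lambda>x. c)"
proof (induction k arbitrary: c)
  case (Suc k)
  have "partial_deriv i (\<lambda>x::'a. c) = (\<lambda>x. 0)" for i
    by (rule ext, rule partial_deriv_eqI) (auto intro!: derivative_eq_intros)
  with Suc show ?case by simp
qed simp

lemma C_k_add: "C_k k f \<Longrightarrow> C_k k g \<Longrightarrow> C_k k (\<lambda>x. f x + g x)"
proof (induction k arbitrary: f g)
  case 0
  then show ?case by (auto intro: continuous_intros)
next
  case (Suc k)
  have "partial_deriv i (\<lambda>x. f x + g x) = (\<lambda>x. partial_deriv i f x + partial_deriv i g x)" for i
  proof
    fix x
    show "partial_deriv i (\<lambda>x. f x + g x) x = partial_deriv i f x + partial_deriv i g x"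
      using Suc.prems unfolding partial_deriv_def[of i f] partial_deriv_def[of i g]
      by (intro partial_deriv_eqI has_derivative_add) (auto simp: frechet_derivative_works)
  qed
  with Suc show ?case by (auto intro: derivative_intros)
qed

lemma C_k_mult: "C_k k f \<Longrightarrow> C_k k g \<Longrightarrow> C_k k (\<lambda>x. f x * g x)"
proof (induction k arbitrary: f g)
  case 0
  then show ?case by (auto intro: continuous_intros)
next
  case (Suc k)
  have "partial_deriv i (\<lambda>x. f x * g x)
      = (\<lambda>x. f x * partial_deriv i g x + partial_deriv i f x * g x)" for i
  proof
    fix x
    show "partial_deriv i (\<lambda>x. f x * g x) x = f x * partial_deriv i g x + partial_deriv i f x * g x"
      using Suc.prems unfolding partial_deriv_def[of i f] partial_deriv_def[of i g]
      by (intro partial_deriv_eqI has_derivative_mult) (auto simp: frechet_derivative_works)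
  qed
  with Suc show ?case
    by (auto intro!: C_k_add Suc.IH C_k_mono[OF Suc.prems(1)] C_k_mono[OF Suc.prems(2)]
        intro: derivative_intros)
qed

lemma C_k_inner: "C_k k (\<lambda>x. (x - a) \<bullet> i)"
proof (cases k)
  case (Suc l)
  have "partial_deriv j (\<lambda>x. (x - a) \<bullet> i) = (\<lambda>x. j \<bullet> i)" for j
    by (rule ext, rule partial_deriv_eqI) (auto intro!: derivative_eq_intros)
  with Suc show ?thesis by (auto simp: C_k_const intro!: derivative_intros)
qed (auto intro!: continuous_intros)

text \<open>The functions \<open>P (1 / t) * exp (- 1 / t)\<close>, continued by zero to \<open>t \<le> 0\<close>. Allowing a polynomial factor
makes this class closed under differentiation, so that smoothness of all orders follows by one induction.\<close>

definition flat_exp :: "real poly \<Rightarrow> real \<Rightarrow> real"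
  where "flat_exp P t = (if 0 < t then poly P (inverse t) * exp (- inverse t) else 0)"

lemma tendsto_poly_exp_minus: "((\<lambda>y::real. poly P y * exp (- y)) \<longlongrightarrow> 0) at_top"
proof -
  have "((\<lambda>y. \<Sum>i\<le>degree P. coeff P i * (y ^ i / exp y)) \<longlongrightarrow> (\<Sum>i\<le>degree P. coeff P i * 0)) at_top"
    by (intro tendsto_intros tendsto_power_div_exp_0)
  then show ?thesis
    by (simp add: poly_altdef sum_distrib_right exp_minus divide_inverse mult.assoc)
qed

lemma flat_exp_has_derivative:
  "(flat_exp P has_real_derivative flat_exp ([:0, 0, 1:] * (P - pderiv P)) t) (at t)"
proof (cases "t = 0")
  case False
  show ?thesis
  proof (cases "0 < t")
    case True
    have "((\<lambda>t. poly P (inverse t) * exp (- inverse t)) has_real_derivative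
        flat_exp ([:0, 0, 1:] * (P - pderiv P)) t) (at t)"
      using True by (auto intro!: derivative_eq_intros DERIV_chain2[OF poly_DERIV]
          simp: flat_exp_def algebra_simps power2_eq_square)
    then show ?thesis
    proof (rule DERIV_cong_ev[THEN iffD1, rotated -1])
      have "\<forall>\<^sub>F x in nhds t. 0 < x"
        using True by (rule order_tendstoD(1)[OF filterlim_ident])
      then show "\<forall>\<^sub>F x in nhds t. poly P (inverse x) * exp (- inverse x) = flat_exp P x"
        by eventually_elim (simp add: flat_exp_def)
    qed simp_all
  next
    case neg: False
    have "((\<lambda>t. 0) has_real_derivative flat_exp ([:0, 0, 1:] * (P - pderiv P)) t) (at t)"
      using neg by (simp add: flat_exp_def)
    then show ?thesis
    proof (rule DERIV_cong_ev[THEN iffD1, rotated -1])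
      have "\<forall>\<^sub>F x in nhds t. x < 0"
        using neg False by (intro order_tendstoD(2)[OF filterlim_ident]) auto
      then show "\<forall>\<^sub>F x in nhds t. 0 = flat_exp P x"
        by eventually_elim (simp add: flat_exp_def)
    qed simp_all
  qed
next
  case True
  have "((\<lambda>h. flat_exp P h / h) \<longlongrightarrow> 0) (at_right 0)"
  proof (rule Lim_transform_eventually)
    show "((\<lambda>h. poly ([:0, 1:] * P) (inverse h) * exp (- inverse h)) \<longlongrightarrow> 0) (at_right (0::real))"
      by (rule filterlim_compose[OF tendsto_poly_exp_minus filterlim_inverse_at_top_right])
    show "\<forall>\<^sub>F h in at_right 0. poly ([:0, 1:] * P) (inverse h) * exp (- inverse h) = flat_exp P h / h"
      by (auto simp: eventually_at_filter flat_exp_def field_simps)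
  qed
  moreover have "((\<lambda>h. flat_exp P h / h) \<longlongrightarrow> 0) (at_left 0)"
    by (rule tendsto_eventually) (auto simp: eventually_at_filter flat_exp_def)
  ultimately have "((\<lambda>h. flat_exp P h / h) \<longlongrightarrow> 0) (at 0)"
    by (simp add: filterlim_split_at)
  then show ?thesis
    by (simp add: True DERIV_def flat_exp_def)
qed

text \<open>Each partial derivative is again a profile of the same class times an affine function, so the induction
runs over all \<open>P\<close> at once.\<close>

lemma C_k_flat_exp_sphere: "C_k k (\<lambda>x::'a::euclidean_space. flat_exp P (a - b * ((x - z) \<bullet> (x - z))))"
proof (induction k arbitrary: P)
  case 0
  have "continuous_on UNIV (flat_exp P)"
    using flat_exp_has_derivative DERIV_isCont continuous_at_imp_continuous_on by blast
  then show ?case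
    by (auto intro!: continuous_intros intro: continuous_on_compose2)
next
  case (Suc k)
  let ?Q = "[:0, 0, 1:] * (P - pderiv P)"
  let ?f = "\<lambda>x::'a. flat_exp P (a - b * ((x - z) \<bullet> (x - z)))"
  have d: "(?f has_derivative
     (\<lambda>h. (- b * 2 * ((x - z) \<bullet> h)) * flat_exp ?Q (a - b * ((x - z) \<bullet> (x - z))))) (at x)" for x
    by (rule DERIV_compose_FDERIV[OF flat_exp_has_derivative, THEN has_derivative_eq_rhs])
       (auto intro!: derivative_eq_intros simp: inner_commute algebra_simps)
  have "partial_deriv i ?f = (\<lambda>x. (- b * 2 * ((x - z) \<bullet> i)) * flat_exp ?Q (a - b * ((x - z) \<bullet> (x - z))))" for i
    by (rule ext) (rule partial_deriv_eqI[OF d])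
  moreover have "C_k k (\<lambda>x::'a. (- b * 2 * ((x - z) \<bullet> i)) * flat_exp ?Q (a - b * ((x - z) \<bullet> (x - z))))" for i
    by (intro C_k_mult C_k_const C_k_inner Suc)
  ultimately show ?case
    using d by (auto simp: differentiable_def)
qed

section \<open>Second differences\<close>

text \<open>The linear Taylor terms at \<open>h\<close> and \<open>- h\<close> cancel, which is why a symmetric difference is controlled by
the second derivative alone.\<close>

lemma second_difference_Taylor:
  fixes g :: "real \<Rightarrow> real"
  assumes g: "\<And>t. (g has_real_derivative g' t) (at t)"
    and g': "\<And>t. (g' has_real_derivative g'' t) (at t)"
  shows "\<exists>a b. \<bar>a\<bar> \<le> \<bar>h\<bar> \<and> \<bar>b\<bar> \<le> \<bar>h\<bar> \<and> g h + g (- h) - 2 * g 0 = h\<^sup>2 / 2 * (g'' a + g'' b)"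
proof (cases "h = 0")
  case False
  define diff where "diff k = (if k = 0 then g else if k = 1 then g' else g'')" for k :: nat
  have T: "\<exists>a. \<bar>a\<bar> \<le> \<bar>x\<bar> \<and> g x = g 0 + g' 0 * x + g'' a / 2 * x\<^sup>2" if "x \<noteq> 0" for x
  proof -
    have "\<exists>t. (if x < 0 then x < t \<and> t < 0 else 0 < t \<and> t < x) \<and>
        g x = (\<Sum>m<2. (diff m 0 / fact m) * (x - 0) ^ m) + (diff 2 t / fact 2) * (x - 0) ^ 2"
      by (rule Taylor[where a = "- \<bar>x\<bar>" and b = "\<bar>x\<bar>"]) (use that g g' in \<open>auto simp: diff_def less_2_cases_iff\<close>)
    then show ?thesis
      by (auto simp: diff_def numeral_2_eq_2 split: if_splits) (metis abs_of_nonneg abs_of_nonpos less_eq_real_def neg_le_iff_le)+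
  qed
  from T[of h] T[of "-h"] False obtain a b where "\<bar>a\<bar> \<le> \<bar>h\<bar>" "\<bar>b\<bar> \<le> \<bar>h\<bar>"
    "g h = g 0 + g' 0 * h + g'' a / 2 * h\<^sup>2" "g (- h) = g 0 + g' 0 * (-h) + g'' b / 2 * (-h)\<^sup>2"
    by auto
  then show ?thesis
    by (intro exI[of _ a] exI[of _ b]) (auto simp: algebra_simps)
qed (auto intro: exI[of _ 0])

lemma second_difference_tendsto:
  fixes g :: "real \<Rightarrow> real"
  assumes g: "\<And>t. (g has_real_derivative g' t) (at t)"
    and g': "\<And>t. (g' has_real_derivative g'' t) (at t)"
    and cont: "isCont g'' 0"
  shows "((\<lambda>h. (g h + g (- h) - 2 * g 0) / h\<^sup>2) \<longlongrightarrow> g'' 0) (at 0)"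
proof -
  from second_difference_Taylor[OF g g'] obtain a b where
    ab: "\<bar>a h\<bar> \<le> \<bar>h\<bar>" "\<bar>b h\<bar> \<le> \<bar>h\<bar>" "g h + g (- h) - 2 * g 0 = h\<^sup>2 / 2 * (g'' (a h) + g'' (b h))" for h
    by metis
  have id: "((\<lambda>h::real. \<bar>h\<bar>) \<longlongrightarrow> 0) (at 0)"
    by (auto intro!: tendsto_eq_intros)
  have a: "(a \<longlongrightarrow> 0) (at 0)" and b: "(b \<longlongrightarrow> 0) (at 0)"
    by (rule Lim_null_comparison[OF _ id]; simp add: ab)+
  have "((\<lambda>h. (g'' (a h) + g'' (b h)) / 2) \<longlongrightarrow> (g'' 0 + g'' 0) / 2) (at 0)"
    by (intro tendsto_intros isCont_tendsto_compose[OF cont] a b) simp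
  then have "((\<lambda>h. (g'' (a h) + g'' (b h)) / 2) \<longlongrightarrow> g'' 0) (at 0)"
    by simp
  then show ?thesis
    by (rule Lim_transform_eventually) (auto simp: eventually_at_filter ab(3))
qed

lemma partial_deriv_eq_0:
  assumes "x \<notin> closure {x. f x \<noteq> 0}"
  shows "partial_deriv i f x = 0"
proof -
  have "(f has_derivative (\<lambda>_. 0)) (at x)"
  proof (rule has_derivative_transform_within_open)
    show "((\<lambda>_. 0) has_derivative (\<lambda>_. 0)) (at x)" by simp
    show "open (- closure {x. f x \<noteq> 0})" by (rule open_Compl) simp
    show "0 = f y" if "y \<in> - closure {x. f x \<noteq> 0}" for y
      using that closure_subset[of "{x. f x \<noteq> 0}"] by auto
  qed (use assms in auto)
  then show ?thesis by (rule partial_deriv_eqI)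
qed

lemma support_partial_deriv: "closure {x. partial_deriv i f x \<noteq> 0} \<subseteq> closure {x. f x \<noteq> 0}"
  by (rule closure_minimal) (auto intro: ccontr partial_deriv_eq_0)

lemma bounded_of_compact_support:
  fixes f :: "'a::euclidean_space \<Rightarrow> real"
  assumes "continuous_on UNIV f" "compact K" "closure {x. f x \<noteq> 0} \<subseteq> K"
  shows "\<exists>B\<ge>0. \<forall>x. \<bar>f x\<bar> \<le> B"
proof -
  have "bounded (f ` K)"
    by (intro compact_imp_bounded compact_continuous_image assms(2) continuous_on_subset[OF assms(1)]) auto
  then obtain B where B: "0 < B" "\<And>x. x \<in> K \<Longrightarrow> \<bar>f x\<bar> \<le> B"
    by (auto simp: bounded_pos)
  moreover have "f x = 0" if "x \<notin> K" for x
    using that assms(3) closure_subset[of "{x. f x \<noteq> 0}"] by auto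
  ultimately show ?thesis
    by (intro exI[of _ B]) (force simp: less_eq_real_def)
qed

lemma has_real_derivative_along_line:
  fixes f :: "'a::euclidean_space \<Rightarrow> real"
  assumes "f differentiable (at (y + t *\<^sub>R z))"
  shows "((\<lambda>t. f (y + t *\<^sub>R z)) has_real_derivative
     (\<Sum>i\<in>Basis. (z \<bullet> i) * partial_deriv i f (y + t *\<^sub>R z))) (at t)"
proof -
  let ?D = "frechet_derivative f (at (y + t *\<^sub>R z))"
  have D: "(f has_derivative ?D) (at (y + t *\<^sub>R z))"
    using assms by (simp add: frechet_derivative_works)
  have "linear ?D"
    using D has_derivative_linear by blast
  have "((\<lambda>t. f (y + t *\<^sub>R z)) has_derivative (\<lambda>h. ?D (h *\<^sub>R z))) (at t)"
  proof -
    have "((\<lambda>t. y + t *\<^sub>R z) has_derivative (\<lambda>h. h *\<^sub>R z)) (at t)"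
      by (auto intro!: derivative_eq_intros)
    from has_derivative_compose[OF this, of f ?D] D show ?thesis by simp
  qed
  moreover have "?D (h *\<^sub>R z) = (\<Sum>i\<in>Basis. (z \<bullet> i) * partial_deriv i f (y + t *\<^sub>R z)) * h" for h
  proof -
    have "?D (h *\<^sub>R z) = h * ?D (\<Sum>i\<in>Basis. (z \<bullet> i) *\<^sub>R i)"
      using \<open>linear ?D\<close> by (simp add: linear_cmul euclidean_representation)
    also have "\<dots> = h * (\<Sum>i\<in>Basis. (z \<bullet> i) * ?D i)"
      using \<open>linear ?D\<close> by (simp only: linear_sum linear_cmul) (simp add: linear_cmul)
    finally show ?thesis by (simp add: partial_deriv_def)
  qed
  ultimately show ?thesis
    by (simp add: has_field_derivative_def mult_commute_abs)
qed

text \<open>Second differences are the only way in which the smoothness of test functions is used: the uniform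
bound makes the singular integral converge, and the limit along a coordinate axis produces the Laplacian.\<close>

lemma C_2_second_difference:
  assumes "C_k 2 f"
  shows second_difference_bound: "compact (closure {x. f x \<noteq> 0}) \<Longrightarrow>
      \<exists>M\<ge>0. \<forall>y z. \<bar>f (y + z) + f (y - z) - 2 * f y\<bar> \<le> M * (norm z)\<^sup>2"
    and second_difference_lim: "e \<in> Basis \<Longrightarrow>
      ((\<lambda>h. (f (y + h *\<^sub>R e) + f (y - h *\<^sub>R e) - 2 * f y) / h\<^sup>2)
        \<longlongrightarrow> partial_deriv e (partial_deriv e f) y) (at 0)"
proof -
  have d1: "f differentiable (at x)" for x
    using assms by (simp add: numeral_2_eq_2)
  have d2: "partial_deriv i f differentiable (at x)" if "i \<in> Basis" for i x
    using assms that by (simp add: numeral_2_eq_2)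
  have c: "continuous_on UNIV (partial_deriv j (partial_deriv i f))" if "i \<in> Basis" "j \<in> Basis" for i j
    using assms that by (simp add: numeral_2_eq_2)
  define g' where "g' y z t = (\<Sum>i\<in>Basis. (z \<bullet> i) * partial_deriv i f (y + t *\<^sub>R z))" for y z t
  define g'' where "g'' y z t = (\<Sum>i\<in>Basis. (z \<bullet> i) *
      (\<Sum>j\<in>Basis. (z \<bullet> j) * partial_deriv j (partial_deriv i f) (y + t *\<^sub>R z)))" for y z t
  have g: "((\<lambda>t. f (y + t *\<^sub>R z)) has_real_derivative g' y z t) (at t)" for y z t
    unfolding g'_def by (rule has_real_derivative_along_line[OF d1])
  have g': "(g' y z has_real_derivative g'' y z t) (at t)" for y z t
    unfolding g'_def g''_def
    by (intro DERIV_sum DERIV_cmult has_real_derivative_along_line d2)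
  show "\<exists>M\<ge>0. \<forall>y z. \<bar>f (y + z) + f (y - z) - 2 * f y\<bar> \<le> M * (norm z)\<^sup>2"
    if K: "compact (closure {x. f x \<noteq> 0})"
  proof -
    have "\<exists>B\<ge>0. \<forall>x. \<bar>partial_deriv j (partial_deriv i f) x\<bar> \<le> B" if "i \<in> Basis" "j \<in> Basis" for i j
      by (rule bounded_of_compact_support[OF c K])
         (use that support_partial_deriv[of i f] support_partial_deriv[of j "partial_deriv i f"] in auto)
    then obtain B where B: "\<And>i j. i \<in> Basis \<Longrightarrow> j \<in> Basis \<Longrightarrow> 0 \<le> B i j"
      "\<And>i j x. i \<in> Basis \<Longrightarrow> j \<in> Basis \<Longrightarrow> \<bar>partial_deriv j (partial_deriv i f) x\<bar> \<le> B i j"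
      by metis
    define M where "M = (\<Sum>i\<in>Basis. \<Sum>j\<in>Basis. B i j)"
    have M: "\<bar>g'' y z t\<bar> \<le> M * (norm z)\<^sup>2" for y z t
    proof -
      have "\<bar>g'' y z t\<bar> \<le> (\<Sum>i\<in>Basis. \<bar>z \<bullet> i\<bar> *
          (\<Sum>j\<in>Basis. \<bar>z \<bullet> j\<bar> * \<bar>partial_deriv j (partial_deriv i f) (y + t *\<^sub>R z)\<bar>))"
        unfolding g''_def
        by (intro order.trans[OF sum_abs] sum_mono) (auto simp: abs_mult intro!: mult_left_mono order.trans[OF sum_abs] sum_mono)
      also have "\<dots> \<le> (\<Sum>i\<in>Basis. norm z * (\<Sum>j\<in>Basis. norm z * B i j))"
        by (intro sum_mono mult_mono Basis_le_norm B sum_nonneg mult_nonneg_nonneg) auto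
      also have "\<dots> = (norm z)\<^sup>2 * M"
        unfolding M_def sum_distrib_left power2_eq_square by (simp only: mult.assoc)
      also have "\<dots> = M * (norm z)\<^sup>2"
        by (rule mult.commute)
      finally show ?thesis .
    qed
    have "\<bar>f (y + z) + f (y - z) - 2 * f y\<bar> \<le> M * (norm z)\<^sup>2" for y z
    proof -
      from second_difference_Taylor[of "\<lambda>t. f (y + t *\<^sub>R z)", OF g g', of 1] obtain a b where
        ab: "f (y + z) + f (y - z) - 2 * f y = 1 / 2 * (g'' y z a + g'' y z b)"
        by (simp only: scaleR_one scaleR_minus_left scaleR_zero_left add_0_right
            power_one diff_conv_add_uminus[of y z]) blast
      show ?thesis
        unfolding ab using M[of y z a] M[of y z b] by (simp add: abs_le_iff)
    qed
    moreover have "0 \<le> M"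
      unfolding M_def by (intro sum_nonneg B)
    ultimately show ?thesis by blast
  qed
  show "((\<lambda>h. (f (y + h *\<^sub>R e) + f (y - h *\<^sub>R e) - 2 * f y) / h\<^sup>2)
        \<longlongrightarrow> partial_deriv e (partial_deriv e f) y) (at 0)" if "e \<in> Basis"
  proof -
    have e: "(\<Sum>i\<in>Basis. (e \<bullet> i) * F i) = F e" for F :: "'a \<Rightarrow> real"
    proof -
      have "(e \<bullet> i) * F i = (if i = e then F e else 0)" if "i \<in> Basis" for i
        using that \<open>e \<in> Basis\<close> by (auto simp: inner_Basis)
      then show ?thesis
        using \<open>e \<in> Basis\<close> by simp
    qed
    have "g'' y e t = partial_deriv e (partial_deriv e f) (y + t *\<^sub>R e)" for t
      by (simp add: g''_def e)
    moreover have "isCont (\<lambda>t. partial_deriv e (partial_deriv e f) (y + t *\<^sub>R e)) 0"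
      using continuous_on_compose2[OF c[OF that that], of UNIV "\<lambda>t. y + t *\<^sub>R e"]
      by (auto intro!: continuous_intros simp: continuous_on_eq_continuous_at)
    ultimately have "isCont (g'' y e) 0"
      by presburger
    from second_difference_tendsto[OF g g' this]
    show ?thesis by (simp add: g''_def e)
  qed
qed

section \<open>Integrals of powers of the norm\<close>

text \<open>A substitute for polar coordinates. If \<open>f\<close> is dominated on a sequence of balls by constants whose product
with the volumes decays geometrically, then \<open>f\<close> is integrable; powers of the norm fit this pattern on
dyadic shells.\<close>

lemma nn_integral_dyadic_cover:
  fixes f :: "'a::euclidean_space \<Rightarrow> real"
  assumes cover: "\<And>z. f z = 0 \<or> (\<exists>j::nat. f z \<le> A j \<and> norm z \<le> R j)"
    and pos: "\<And>j. 0 \<le> A j" "\<And>j. 0 \<le> R j"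
    and geom: "\<And>j. A j * R j ^ DIM('a) \<le> c * q ^ j" and q: "0 \<le> q" "q < 1" and c: "0 \<le> c"
  shows "(\<integral>\<^sup>+z. f z \<partial>lborel) \<le> ennreal (unit_ball_vol (real DIM('a)) * c / (1 - q))"
proof -
  let ?\<omega> = "unit_ball_vol (real DIM('a))"
  have "ennreal (f z) \<le> (\<Sum>j. ennreal (A j) * indicator (cball (0::'a) (R j)) z)" for z
  proof (cases "f z = 0")
    case False
    then obtain j where "f z \<le> A j" "norm z \<le> R j" using cover[of z] by auto
    then have "ennreal (f z) \<le> (\<Sum>j\<in>{j}. ennreal (A j) * indicator (cball (0::'a) (R j)) z)"
      by (auto intro: ennreal_leI)
    also have "\<dots> \<le> (\<Sum>j. ennreal (A j) * indicator (cball (0::'a) (R j)) z)"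
      by (rule sum_le_suminf) auto
    finally show ?thesis .
  qed simp
  then have "(\<integral>\<^sup>+z. f z \<partial>lborel) \<le> (\<integral>\<^sup>+z. (\<Sum>j. ennreal (A j) * indicator (cball (0::'a) (R j)) z) \<partial>lborel)"
    by (auto intro!: nn_integral_mono)
  also have "\<dots> = (\<Sum>j. ennreal (A j) * emeasure lborel (cball (0::'a) (R j)))"
  proof (subst nn_integral_suminf)
    show "(\<lambda>z::'a. ennreal (A j) * indicator (cball 0 (R j)) z) \<in> borel_measurable lborel" for j
      by (intro borel_measurable_times_ennreal borel_measurable_indicator) auto
    show "(\<Sum>j. \<integral>\<^sup>+z. ennreal (A j) * indicator (cball (0::'a) (R j)) z \<partial>lborel)
        = (\<Sum>j. ennreal (A j) * emeasure lborel (cball (0::'a) (R j)))"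
      by (intro suminf_cong nn_integral_cmult_indicator) simp
  qed
  also have "\<dots> \<le> (\<Sum>j. ennreal (?\<omega> * c * q ^ j))"
  proof (intro suminf_le summableI)
    fix j
    have "A j * (?\<omega> * R j ^ DIM('a)) \<le> ?\<omega> * c * q ^ j"
      using mult_left_mono[OF geom[of j], of ?\<omega>] by (simp add: mult_ac)
    then show "ennreal (A j) * emeasure lborel (cball (0::'a) (R j)) \<le> ennreal (?\<omega> * c * q ^ j)"
      using pos by (simp add: emeasure_cball ennreal_mult'[symmetric] ennreal_leI)
  qed
  also have "\<dots> = ennreal (?\<omega> * c / (1 - q))"
  proof (subst suminf_ennreal2)
    show "summable (\<lambda>j. ?\<omega> * c * q ^ j)"
      using q by (intro summable_mult summable_geometric) auto
    have "(\<Sum>j. ?\<omega> * c * q ^ j) = ?\<omega> * c * (1 / (1 - q))"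
      using q by (subst suminf_mult) (auto intro: summable_geometric simp: suminf_geometric)
    then show "ennreal (\<Sum>j. ?\<omega> * c * q ^ j) = ennreal (?\<omega> * c / (1 - q))"
      by simp
  qed (use c q in auto)
  finally show ?thesis .
qed

lemma dyadic_scale:
  fixes x :: real
  assumes "1 \<le> x"
  obtains j :: nat where "2 powr real j \<le> x" "x \<le> 2 powr (real j + 1)"
proof
  have "0 \<le> log 2 x" using assms by simp
  then have j: "real (nat \<lfloor>log 2 x\<rfloor>) = \<lfloor>log 2 x\<rfloor>" by simp
  show "2 powr real (nat \<lfloor>log 2 x\<rfloor>) \<le> x" "x \<le> 2 powr (real (nat \<lfloor>log 2 x\<rfloor>) + 1)"
    using assms unfolding j
    by (auto simp: powr_le_iff less_powr_iff le_powr_iff intro: less_imp_le)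
qed

lemma set_integral_le_of_nn_integral:
  fixes f :: "'a::euclidean_space \<Rightarrow> real"
  assumes [measurable]: "f \<in> borel_measurable borel" "S \<in> sets borel" and f: "\<And>z. 0 \<le> f z"
    and le: "(\<integral>\<^sup>+z. indicator S z * f z \<partial>lborel) \<le> ennreal C" and C: "0 \<le> C"
  shows "set_integrable lborel S f" "(LINT z:S|lborel. f z) \<le> C"
proof -
  have "(\<integral>\<^sup>+z. indicator S z * f z \<partial>lborel) < \<infinity>"
    using le by (simp add: le_less_trans)
  then show i: "set_integrable lborel S f"
    unfolding set_integrable_def using f
    by (intro integrableI_nonneg) auto
  have "(\<integral>\<^sup>+z. indicator S z * f z \<partial>lborel) = ennreal (LINT z:S|lborel. f z)"
    using i f unfolding set_integrable_def set_lebesgue_integral_def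
    by (subst nn_integral_eq_integral) auto
  with le C show "(LINT z:S|lborel. f z) \<le> C"
    by simp
qed

text \<open>On the shell \<open>2^j \<rho> \<le> |z| \<le> 2^(j+1) \<rho>\<close> the integrand is at most \<open>(2^j \<rho>) powr - a\<close>, and the
ratio of consecutive contributions is \<open>2 powr (n - a) < 1\<close>.\<close>

lemma set_integral_norm_powr_outer:
  assumes a: "real DIM('a::euclidean_space) < a"
  obtains C where "0 < C" "\<And>\<rho>. 0 < \<rho> \<Longrightarrow>
    set_integrable lborel {z::'a. \<rho> \<le> norm z} (\<lambda>z. norm z powr - a) \<and>
    (LINT z:{z::'a. \<rho> \<le> norm z}|lborel. norm z powr - a) \<le> C * \<rho> powr (real DIM('a) - a)"
proof -
  let ?n = "real DIM('a)" and ?\<omega> = "unit_ball_vol (real DIM('a))"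
  define q where "q = 2 powr (?n - a)"
  define C where "C = ?\<omega> * 2 ^ DIM('a) / (1 - q)"
  have q: "0 \<le> q" "q < 1"
    using a by (auto simp: q_def powr_less_one)
  have "0 < C"
    using q unfolding C_def by simp
  moreover have "set_integrable lborel {z::'a. \<rho> \<le> norm z} (\<lambda>z. norm z powr - a) \<and>
    (LINT z:{z::'a. \<rho> \<le> norm z}|lborel. norm z powr - a) \<le> C * \<rho> powr (?n - a)" if \<rho>: "0 < \<rho>" for \<rho>
  proof -
    have "(\<integral>\<^sup>+z. indicator {z::'a. \<rho> \<le> norm z} z * norm z powr - a \<partial>lborel)
        \<le> ennreal (?\<omega> * (2 ^ DIM('a) * \<rho> powr (?n - a)) / (1 - q))"
    proof (rule nn_integral_dyadic_cover)
      fix z :: 'a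
      show "indicator {z. \<rho> \<le> norm z} z * norm z powr - a = 0 \<or>
        (\<exists>j. indicator {z. \<rho> \<le> norm z} z * norm z powr - a \<le> (2 powr real j * \<rho>) powr - a
             \<and> norm z \<le> 2 powr (real j + 1) * \<rho>)"
      proof (cases "\<rho> \<le> norm z")
        case True
        with \<rho> have "1 \<le> norm z / \<rho>" by simp
        then obtain j :: nat where "2 powr real j \<le> norm z / \<rho>" "norm z / \<rho> \<le> 2 powr (real j + 1)"
          by (rule dyadic_scale)
        with \<rho> a True show ?thesis
          by (intro disjI2 exI[of _ j]) (auto simp: field_simps intro!: powr_mono2')
      qed simp
      fix j :: nat
      have "(2 powr real j * \<rho>) powr - a * (2 powr (real j + 1) * \<rho>) ^ DIM('a)
          = 2 ^ DIM('a) * \<rho> powr (?n - a) * q ^ j"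
        using \<rho> by (simp add: q_def powr_mult powr_powr powr_realpow[symmetric] powr_add[symmetric] field_simps)
      then show "(2 powr real j * \<rho>) powr - a * (2 powr (real j + 1) * \<rho>) ^ DIM('a)
          \<le> 2 ^ DIM('a) * \<rho> powr (?n - a) * q ^ j" by simp
    qed (use \<rho> q in auto)
    also have "?\<omega> * (2 ^ DIM('a) * \<rho> powr (?n - a)) / (1 - q) = C * \<rho> powr (?n - a)"
      by (simp add: C_def)
    finally show ?thesis
      using \<open>0 < C\<close> by (intro conjI set_integral_le_of_nn_integral) auto
  qed
  ultimately show ?thesis by (rule that)
qed

text \<open>The same decomposition with the shells shrinking towards the origin. The origin itself causes no
trouble because \<open>0 powr b = 0\<close>.\<close>

lemma set_integral_norm_powr_inner:
  assumes a: "0 \<le> a" "a < real DIM('a::euclidean_space)"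
  obtains C where "0 < C" "\<And>\<tau>. 0 < \<tau> \<Longrightarrow>
    set_integrable lborel (ball (0::'a) \<tau>) (\<lambda>z. norm z powr - a) \<and>
    (LINT z:ball (0::'a) \<tau>|lborel. norm z powr - a) \<le> C * \<tau> powr (real DIM('a) - a)"
proof -
  let ?n = "real DIM('a)" and ?\<omega> = "unit_ball_vol (real DIM('a))"
  define q where "q = 2 powr (a - ?n)"
  define C where "C = ?\<omega> * 2 powr a / (1 - q)"
  have q: "0 \<le> q" "q < 1"
    using a by (auto simp: q_def powr_less_one)
  have "0 < C"
    using q unfolding C_def by simp
  moreover have "set_integrable lborel (ball (0::'a) \<tau>) (\<lambda>z. norm z powr - a) \<and>
    (LINT z:ball (0::'a) \<tau>|lborel. norm z powr - a) \<le> C * \<tau> powr (?n - a)" if \<tau>: "0 < \<tau>" for \<tau>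
  proof -
    have "(\<integral>\<^sup>+z. indicator (ball (0::'a) \<tau>) z * norm z powr - a \<partial>lborel)
        \<le> ennreal (?\<omega> * (2 powr a * \<tau> powr (?n - a)) / (1 - q))"
    proof (rule nn_integral_dyadic_cover)
      fix z :: 'a
      show "indicator (ball 0 \<tau>) z * norm z powr - a = 0 \<or>
        (\<exists>j. indicator (ball 0 \<tau>) z * norm z powr - a \<le> (2 powr (- real j - 1) * \<tau>) powr - a
             \<and> norm z \<le> 2 powr (- real j) * \<tau>)"
      proof (cases "norm z < \<tau> \<and> z \<noteq> 0")
        case True
        with \<tau> have "1 \<le> \<tau> / norm z" by simp
        then obtain j :: nat where "2 powr real j \<le> \<tau> / norm z" "\<tau> / norm z \<le> 2 powr (real j + 1)"
          by (rule dyadic_scale)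
        then have "2 powr (- real j - 1) * \<tau> \<le> norm z" "norm z \<le> 2 powr (- real j) * \<tau>"
          using \<tau> True by (auto simp: powr_minus powr_diff powr_add field_simps)
        with \<tau> a True show ?thesis
          by (intro disjI2 exI[of _ j]) (auto intro!: powr_mono2'[of "- a"])
      qed auto
      fix j :: nat
      have "(2 powr (- real j - 1) * \<tau>) powr - a * (2 powr (- real j) * \<tau>) ^ DIM('a)
          = (2 powr ((- real j - 1) * - a) * 2 powr (- real j * ?n)) * (\<tau> powr - a * \<tau> powr ?n)"
        using \<tau> by (simp add: powr_mult powr_powr powr_realpow[symmetric])
      also have "2 powr ((- real j - 1) * - a) * 2 powr (- real j * ?n) = 2 powr a * q ^ j"
        by (simp add: q_def powr_add[symmetric] powr_powr powr_realpow[symmetric] algebra_simps)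
      also have "\<tau> powr - a * \<tau> powr ?n = \<tau> powr (?n - a)"
        by (simp add: powr_add[symmetric])
      finally have "(2 powr (- real j - 1) * \<tau>) powr - a * (2 powr (- real j) * \<tau>) ^ DIM('a)
          = 2 powr a * \<tau> powr (?n - a) * q ^ j" by (simp add: mult_ac)
      then show "(2 powr (- real j - 1) * \<tau>) powr - a * (2 powr (- real j) * \<tau>) ^ DIM('a)
          \<le> 2 powr a * \<tau> powr (?n - a) * q ^ j" by simp
    qed (use \<tau> q in auto)
    also have "?\<omega> * (2 powr a * \<tau> powr (?n - a)) / (1 - q) = C * \<tau> powr (?n - a)"
      by (simp add: C_def)
    finally show ?thesis
      using \<open>0 < C\<close> by (intro conjI set_integral_le_of_nn_integral) auto
  qed
  ultimately show ?thesis by (rule that)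
qed

section \<open>The truncated fractional Laplacian\<close>

lemma
  fixes f :: "'a::euclidean_space \<Rightarrow> real"
  assumes [measurable]: "f \<in> borel_measurable borel"
  shows lborel_integrable_translation: "integrable lborel (\<lambda>x. f (c + x)) \<longleftrightarrow> integrable lborel f"
    and lborel_integral_translation: "(LINT x|lborel. f (c + x)) = (LINT x|lborel. f x)"
  by (subst (2) lborel_distr_plus[of c, symmetric], simp add: integrable_distr_eq integral_distr)+

lemma lborel_distr_minus: "distr lborel borel (\<lambda>x::'a::euclidean_space. - x) = lborel"
  by (subst lborel_affine[of "-1" 0]) (auto simp: density_1)

lemma
  fixes f :: "'a::euclidean_space \<Rightarrow> real"
  assumes [measurable]: "f \<in> borel_measurable borel"
  shows lborel_integrable_minus: "integrable lborel (\<lambda>x. f (- x)) \<longleftrightarrow> integrable lborel f"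
    and lborel_integral_minus: "(LINT x|lborel. f (- x)) = (LINT x|lborel. f x)"
  by (subst (2) lborel_distr_minus[symmetric], simp add: integrable_distr_eq integral_distr)+

definition kern :: "real \<Rightarrow> 'a::euclidean_space \<Rightarrow> real"
  where "kern s z = norm z powr - (real DIM('a) + 2 * s)"

text \<open>The cut-off is built into the kernel, so that every integral below runs over the whole space.\<close>

definition cut_kern :: "real \<Rightarrow> real \<Rightarrow> 'a::euclidean_space \<Rightarrow> real"
  where "cut_kern s \<delta> z = (if \<delta> \<le> norm z then kern s z else 0)"

lemma kern_eq_divide: "kern s (z::'a::euclidean_space) = 1 / norm z powr (real DIM('a) + 2 * s)"
  unfolding kern_def by (rule powr_minus_divide)

lemma kern_measurable [measurable]: "kern s \<in> borel_measurable borel"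
  unfolding kern_def[abs_def] by measurable

lemma cut_kern_measurable [measurable]: "cut_kern s \<delta> \<in> borel_measurable borel"
  unfolding cut_kern_def[abs_def] by measurable

lemma kern_nonneg [simp]: "0 \<le> kern s z" and kern_minus [simp]: "kern s (- z) = kern s z"
  by (auto simp: kern_def)

lemma cut_kern_nonneg [simp]: "0 \<le> cut_kern s \<delta> z" and cut_kern_minus [simp]: "cut_kern s \<delta> (- z) = cut_kern s \<delta> z"
  by (auto simp: cut_kern_def)

lemma cut_kern_integral_bound:
  assumes "0 < s"
  obtains C where "0 < C" "\<And>\<rho>. 0 < \<rho> \<Longrightarrow> integrable lborel (cut_kern s \<rho> :: 'a::euclidean_space \<Rightarrow> real) \<and>
    (LINT z::'a|lborel. cut_kern s \<rho> z) \<le> C * \<rho> powr - (2 * s)"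
proof -
  have "real DIM('a) < real DIM('a) + 2 * s" using assms by simp
  from set_integral_norm_powr_outer[OF this] obtain C where C: "0 < C" "\<And>\<rho>. 0 < \<rho> \<Longrightarrow>
    set_integrable lborel {z::'a. \<rho> \<le> norm z} (\<lambda>z. norm z powr - (real DIM('a) + 2 * s)) \<and>
    (LINT z:{z::'a. \<rho> \<le> norm z}|lborel. norm z powr - (real DIM('a) + 2 * s))
      \<le> C * \<rho> powr (real DIM('a) - (real DIM('a) + 2 * s))" by blast
  have "cut_kern s \<rho> = (\<lambda>z::'a. indicator {z. \<rho> \<le> norm z} z *\<^sub>R norm z powr - (real DIM('a) + 2 * s))" for \<rho>
    by (auto simp: cut_kern_def kern_def)
  with C show ?thesis
    by (intro that[of C]) (auto simp: set_integrable_def set_lebesgue_integral_def)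
qed

lemma cut_kern_integrable: "0 < s \<Longrightarrow> 0 < \<rho> \<Longrightarrow> integrable lborel (cut_kern s \<rho> :: 'a::euclidean_space \<Rightarrow> real)"
  using cut_kern_integral_bound[of s] by metis

lemma integrable_bounded_times:
  fixes f g :: "'a::euclidean_space \<Rightarrow> real"
  assumes "integrable lborel g" and [measurable]: "f \<in> borel_measurable borel" and B: "\<And>z. \<bar>f z\<bar> \<le> B"
  shows "integrable lborel (\<lambda>z. f z * g z)"
proof (rule Bochner_Integration.integrable_bound)
  show "integrable lborel (\<lambda>z. B * g z)" using assms(1) by simp
  show "(\<lambda>z. f z * g z) \<in> borel_measurable lborel" using assms(1) by measurable
  have "0 \<le> B" using B[of undefined] by linarith
  then show "AE z in lborel. norm (f z * g z) \<le> norm (B * g z)"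
    using B by (auto simp: abs_mult intro!: mult_right_mono)
qed

text \<open>The finite second moment near the origin is what pays for a second difference of order \<open>|z|^2\<close>; it needs
\<open>s < 1\<close>. The dimension bound keeps the exponent in the range of \<open>set_integral_norm_powr_inner\<close>.\<close>

lemma ball_second_moment:
  assumes "s < 1" "2 \<le> DIM('a::euclidean_space)" "0 < s"
  obtains C where "0 < C" "\<And>\<tau>. 0 < \<tau> \<Longrightarrow>
    integrable lborel (\<lambda>z::'a. indicator (ball 0 \<tau>) z * ((norm z)\<^sup>2 * kern s z)) \<and>
    (LINT z::'a|lborel. indicator (ball 0 \<tau>) z * ((norm z)\<^sup>2 * kern s z)) \<le> C * \<tau> powr (2 - 2 * s)"
proof -
  have "0 \<le> real DIM('a) + 2 * s - 2" "real DIM('a) + 2 * s - 2 < real DIM('a)"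
    using assms by (auto simp: of_nat_le_iff[of 2, symmetric] simp del: of_nat_le_iff)
  from set_integral_norm_powr_inner[OF this] obtain C where C: "0 < C" "\<And>\<tau>. 0 < \<tau> \<Longrightarrow>
    set_integrable lborel (ball (0::'a) \<tau>) (\<lambda>z. norm z powr - (real DIM('a) + 2 * s - 2)) \<and>
    (LINT z:ball (0::'a) \<tau>|lborel. norm z powr - (real DIM('a) + 2 * s - 2))
      \<le> C * \<tau> powr (real DIM('a) - (real DIM('a) + 2 * s - 2))" by blast
  have "(norm z)\<^sup>2 * kern s z = norm z powr - (real DIM('a) + 2 * s - 2)" for z :: 'a
    by (cases "z = 0") (auto simp: kern_def powr_realpow[symmetric] powr_add[symmetric] algebra_simps simp del: powr_numeral)
  with C show ?thesis
    by (intro that[of C]) (auto simp: set_integrable_def set_lebesgue_integral_def)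
qed

text \<open>Averaging over \<open>z\<close> and \<open>- z\<close>: against an even kernel a first difference may be replaced by half of a
second difference.\<close>

lemma integral_even_kernel:
  fixes f k :: "'a::euclidean_space \<Rightarrow> real"
  assumes i: "integrable lborel (\<lambda>z. f z * k z)" and [measurable]: "f \<in> borel_measurable borel" "k \<in> borel_measurable borel"
    and k: "\<And>z. k (- z) = k z"
  shows "integrable lborel (\<lambda>z. (f z + f (- z)) * k z)"
    "(LINT z|lborel. f z * k z) = (LINT z|lborel. (f z + f (- z)) * k z) / 2"
proof -
  have i': "integrable lborel (\<lambda>z. f (- z) * k z)"
    using lborel_integrable_minus[of "\<lambda>z. f z * k z"] i k by simp
  have e: "(LINT z|lborel. f (- z) * k z) = (LINT z|lborel. f z * k z)"
    using lborel_integral_minus[of "\<lambda>z. f z * k z"] k by simp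
  show "integrable lborel (\<lambda>z. (f z + f (- z)) * k z)"
    using i i' by (simp add: distrib_right)
  show "(LINT z|lborel. f z * k z) = (LINT z|lborel. (f z + f (- z)) * k z) / 2"
    using i i' e by (simp add: distrib_right)
qed

definition trunc_frac :: "real \<Rightarrow> real \<Rightarrow> ('a::euclidean_space \<Rightarrow> real) \<Rightarrow> 'a \<Rightarrow> real"
  where "trunc_frac s \<delta> f x = (LINT z|lborel. (f x - f (x + z)) * cut_kern s \<delta> z)"

lemma frac_laplacian_trunc:
  fixes f :: "'a::euclidean_space \<Rightarrow> real"
  assumes [measurable]: "f \<in> borel_measurable borel"
  shows "frac_laplacian s f x = frac_const DIM('a) s * Lim (at_right 0) (\<lambda>\<delta>. trunc_frac s \<delta> f x)"
proof -
  have "(LINT y:- ball x \<delta>|lebesgue. (f x - f y) / norm (x - y) powr (real DIM('a) + 2 * s))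
      = trunc_frac s \<delta> f x" for \<delta>
  proof -
    have "(LINT y:- ball x \<delta>|lebesgue. (f x - f y) / norm (x - y) powr (real DIM('a) + 2 * s))
        = (LINT y|lebesgue. (f x - f y) * cut_kern s \<delta> (y - x))"
      unfolding set_lebesgue_integral_def
      by (intro Bochner_Integration.integral_cong)
         (auto simp: cut_kern_def kern_eq_divide dist_norm norm_minus_commute indicator_def)
    also have "\<dots> = (LINT y|lborel. (f x - f y) * cut_kern s \<delta> (y - x))"
      by (rule integral_completion) measurable
    also have "\<dots> = trunc_frac s \<delta> f x"
      using lborel_integral_translation[of "\<lambda>y. (f x - f y) * cut_kern s \<delta> (y - x)" x]
      by (simp add: trunc_frac_def)
    finally show ?thesis .
  qed
  then show ?thesis by (simp add: frac_laplacian_def)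
qed

text \<open>Changing the truncation radius from \<open>\<delta>'\<close> to \<open>\<delta>\<close> adds the integral over the shell
\<open>\<delta> \<le> |z| < \<delta>'\<close>, which is symmetric and therefore sees only second differences.\<close>

lemma trunc_frac_diff:
  fixes f :: "'a::euclidean_space \<Rightarrow> real"
  assumes s: "0 < s" and [measurable]: "f \<in> borel_measurable borel" and B: "\<And>z. \<bar>f z\<bar> \<le> B"
    and \<delta>: "0 < \<delta>" "\<delta> \<le> \<delta>'"
  shows "integrable lborel (\<lambda>z. (2 * f x - f (x + z) - f (x - z)) * (cut_kern s \<delta> z - cut_kern s \<delta>' z))"
    "trunc_frac s \<delta> f x - trunc_frac s \<delta>' f x =
      (LINT z|lborel. (2 * f x - f (x + z) - f (x - z)) * (cut_kern s \<delta> z - cut_kern s \<delta>' z)) / 2"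
proof -
  have b: "\<bar>f x - f (x + z)\<bar> \<le> 2 * B" for z
    using B[of x] B[of "x + z"] by linarith
  have i: "integrable lborel (\<lambda>z. (f x - f (x + z)) * cut_kern s \<rho> z)" if "0 < \<rho>" for \<rho>
    by (rule integrable_bounded_times[OF cut_kern_integrable _ b]) (use s that in auto)
  have i2: "integrable lborel (\<lambda>z. (f x - f (x + z)) * (cut_kern s \<delta> z - cut_kern s \<delta>' z))"
    using i[of \<delta>] i[of \<delta>'] \<delta> by (simp add: right_diff_distrib)
  have e: "(f x - f (x + z)) + (f x - f (x + - z)) = 2 * f x - f (x + z) - f (x - z)" for z
    by simp
  have "integrable lborel (\<lambda>z. ((f x - f (x + z)) + (f x - f (x + - z))) * (cut_kern s \<delta> z - cut_kern s \<delta>' z))"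
    by (rule integral_even_kernel(1)[OF i2]) auto
  then show "integrable lborel (\<lambda>z. (2 * f x - f (x + z) - f (x - z)) * (cut_kern s \<delta> z - cut_kern s \<delta>' z))"
    unfolding e .
  have "(LINT z|lborel. (f x - f (x + z)) * (cut_kern s \<delta> z - cut_kern s \<delta>' z)) =
     (LINT z|lborel. ((f x - f (x + z)) + (f x - f (x + - z))) * (cut_kern s \<delta> z - cut_kern s \<delta>' z)) / 2"
    by (rule integral_even_kernel(2)[OF i2]) auto
  then show "trunc_frac s \<delta> f x - trunc_frac s \<delta>' f x =
      (LINT z|lborel. (2 * f x - f (x + z) - f (x - z)) * (cut_kern s \<delta> z - cut_kern s \<delta>' z)) / 2"
    unfolding e trunc_frac_def
    using i[of \<delta>] i[of \<delta>'] \<delta> by (simp add: right_diff_distrib)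
qed

text \<open>The bound on second differences is required only inside the larger truncation radius. Far from the
support of \<open>f\<close> it therefore holds with \<open>M = 0\<close>, and the truncations are eventually constant.\<close>

lemma trunc_frac_Cauchy:
  fixes f :: "'a::euclidean_space \<Rightarrow> real"
  assumes s: "0 < s" and [measurable]: "f \<in> borel_measurable borel" and B: "\<And>z. \<bar>f z\<bar> \<le> B"
    and M: "\<And>z. norm z < \<delta>' \<Longrightarrow> \<bar>f (x + z) + f (x - z) - 2 * f x\<bar> \<le> M * (norm z)\<^sup>2" and "0 \<le> M"
    and C: "integrable lborel (\<lambda>z::'a. indicator (ball 0 \<delta>') z * ((norm z)\<^sup>2 * kern s z))"
      "(LINT z::'a|lborel. indicator (ball 0 \<delta>') z * ((norm z)\<^sup>2 * kern s z)) \<le> C"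
    and \<delta>: "0 < \<delta>" "\<delta> \<le> \<delta>'"
  shows "\<bar>trunc_frac s \<delta> f x - trunc_frac s \<delta>' f x\<bar> \<le> M * C"
proof -
  let ?g = "\<lambda>z. (2 * f x - f (x + z) - f (x - z)) * (cut_kern s \<delta> z - cut_kern s \<delta>' z)"
  have g: "\<bar>?g z\<bar> \<le> M * (indicator (ball 0 \<delta>') z * ((norm z)\<^sup>2 * kern s z))" for z
  proof (cases "norm z < \<delta>'")
    case True
    have "\<bar>?g z\<bar> = \<bar>f (x + z) + f (x - z) - 2 * f x\<bar> * cut_kern s \<delta> z"
      using True by (simp add: abs_mult cut_kern_def abs_minus_commute[of "2 * f x - f (x + z)"] abs_minus_commute[of "2 * f x"] diff_diff_eq)
    also have "\<dots> \<le> (M * (norm z)\<^sup>2) * kern s z"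
      using True by (intro mult_mono M) (auto simp: cut_kern_def \<open>0 \<le> M\<close>)
    finally show ?thesis using True by (simp add: mult.assoc)
  qed (use \<delta> in \<open>auto simp: cut_kern_def\<close>)
  have "\<bar>LINT z|lborel. ?g z\<bar> \<le> (LINT z|lborel. \<bar>?g z\<bar>)"
    by (rule integral_abs_bound)
  also have "\<dots> \<le> (LINT z::'a|lborel. M * (indicator (ball 0 \<delta>') z * ((norm z)\<^sup>2 * kern s z)))"
    using trunc_frac_diff(1)[OF s assms(2) B \<delta>] C(1) g
    by (intro integral_mono) auto
  also have "\<dots> \<le> M * C"
    using C(2) \<open>0 \<le> M\<close> by (simp add: mult_left_mono)
  finally show ?thesis
    unfolding trunc_frac_diff(2)[OF s assms(2) B \<delta>] using \<open>0 \<le> M\<close> by simp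
qed

text \<open>A Cauchy criterion with rate: the modulus \<open>e\<close> survives in the limit and measures the distance to it.\<close>

lemma tendsto_at_right_0_of_Cauchy:
  fixes g e :: "real \<Rightarrow> real"
  assumes C: "\<And>\<delta> \<delta>'. 0 < \<delta> \<Longrightarrow> \<delta> \<le> \<delta>' \<Longrightarrow> \<bar>g \<delta> - g \<delta>'\<bar> \<le> e \<delta>'"
    and e: "(e \<longlongrightarrow> 0) (at_right 0)"
  shows "\<exists>L. (g \<longlongrightarrow> L) (at_right 0) \<and> (\<forall>\<delta>>0. \<bar>L - g \<delta>\<bar> \<le> e \<delta>)"
proof -
  have seq: "filterlim (\<lambda>n. inverse (real (Suc n))) (at_right 0) sequentially"
    by (intro tendsto_imp_filterlim_at_right LIMSEQ_inverse_real_of_nat) auto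
  have "Cauchy (\<lambda>n. g (inverse (real (Suc n))))"
  proof (rule CauchyI')
    fix \<epsilon> :: real assume "0 < \<epsilon>"
    then have "\<forall>\<^sub>F n in sequentially. e (inverse (real (Suc n))) < \<epsilon>"
      using filterlim_compose[OF e seq] by (rule order_tendstoD(2)[rotated])
    then obtain N where N: "\<And>n. N \<le> n \<Longrightarrow> e (inverse (real (Suc n))) < \<epsilon>"
      by (auto simp: eventually_sequentially)
    show "\<exists>M. \<forall>m\<ge>M. \<forall>n>m. dist (g (inverse (real (Suc m)))) (g (inverse (real (Suc n)))) < \<epsilon>"
    proof (intro exI allI impI)
      fix m n assume "N \<le> m" "m < n"
      then have "\<bar>g (inverse (real (Suc n))) - g (inverse (real (Suc m)))\<bar> \<le> e (inverse (real (Suc m)))"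
        by (intro C) (auto simp: field_simps)
      with N[OF \<open>N \<le> m\<close>] show "dist (g (inverse (real (Suc m)))) (g (inverse (real (Suc n)))) < \<epsilon>"
        by (simp add: dist_real_def abs_minus_commute)
    qed
  qed
  then obtain L where L: "(\<lambda>n. g (inverse (real (Suc n)))) \<longlonglongrightarrow> L"
    using Cauchy_convergent_iff convergent_def by blast
  have bound: "\<bar>L - g \<delta>\<bar> \<le> e \<delta>" if "0 < \<delta>" for \<delta>
  proof (rule tendsto_upperbound)
    show "(\<lambda>n. \<bar>g (inverse (real (Suc n))) - g \<delta>\<bar>) \<longlonglongrightarrow> \<bar>L - g \<delta>\<bar>"
      by (intro tendsto_intros L)
    have "\<forall>\<^sub>F n in sequentially. inverse (real (Suc n)) < \<delta>"
      using LIMSEQ_inverse_real_of_nat that by (rule order_tendstoD(2))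
    then show "\<forall>\<^sub>F n in sequentially. \<bar>g (inverse (real (Suc n))) - g \<delta>\<bar> \<le> e \<delta>"
      by eventually_elim (auto intro!: C)
  qed simp
  moreover have "(g \<longlongrightarrow> L) (at_right 0)"
  proof (rule Lim_transform)
    show "((\<lambda>\<delta>. L) \<longlongrightarrow> L) (at_right 0)" by simp
    show "((\<lambda>\<delta>. g \<delta> - L) \<longlongrightarrow> 0) (at_right 0)"
    proof (rule Lim_null_comparison[OF _ e])
      show "\<forall>\<^sub>F \<delta> in at_right 0. norm (g \<delta> - L) \<le> e \<delta>"
        using bound by (auto simp: eventually_at_filter abs_minus_commute)
    qed
  qed
  ultimately show ?thesis by blast
qed

lemma powr_at_right_0: "0 < a \<Longrightarrow> ((\<lambda>x::real. c * x powr a) \<longlongrightarrow> 0) (at_right 0)"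
proof -
  assume "0 < a"
  have "((\<lambda>x::real. c * x powr a) \<longlongrightarrow> c * 0 powr a) (at_right 0)"
    by (intro tendsto_intros tendsto_powr') (use \<open>0 < a\<close> in \<open>auto simp: eventually_at_filter\<close>)
  then show ?thesis by simp
qed

text \<open>The rate is uniform in \<open>y\<close> and the error vanishes outside a fixed ball. This makes it possible to pass
to the limit under an integral against any locally integrable \<open>u\<close>.\<close>

lemma trunc_frac_limit:
  fixes \<phi> :: "'a::euclidean_space \<Rightarrow> real"
  assumes s: "0 < s" "s < 1" "2 \<le> DIM('a)" and [measurable]: "\<phi> \<in> borel_measurable borel"
    and B: "\<And>z. \<bar>\<phi> z\<bar> \<le> B"
    and M: "\<And>y z. \<bar>\<phi> (y + z) + \<phi> (y - z) - 2 * \<phi> y\<bar> \<le> M * (norm z)\<^sup>2" "0 \<le> M"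
    and R: "\<And>y. R \<le> norm y \<Longrightarrow> \<phi> y = 0"
  obtains C F where "0 \<le> C" "\<And>y. ((\<lambda>\<delta>. trunc_frac s \<delta> \<phi> y) \<longlongrightarrow> F y) (at_right 0)"
    "\<And>\<delta> y. 0 < \<delta> \<Longrightarrow> \<delta> \<le> 1 \<Longrightarrow> \<bar>F y - trunc_frac s \<delta> \<phi> y\<bar> \<le> C * \<delta> powr (2 - 2 * s) * indicator (ball 0 (R + 1)) y"
proof -
  obtain C where C: "0 < C" "\<And>\<tau>. 0 < \<tau> \<Longrightarrow>
    integrable lborel (\<lambda>z::'a. indicator (ball 0 \<tau>) z * ((norm z)\<^sup>2 * kern s z)) \<and>
    (LINT z::'a|lborel. indicator (ball 0 \<tau>) z * ((norm z)\<^sup>2 * kern s z)) \<le> C * \<tau> powr (2 - 2 * s)"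
    using ball_second_moment[OF s(2,3,1)] by blast
  have main: "\<bar>trunc_frac s \<delta> \<phi> y - trunc_frac s \<delta>' \<phi> y\<bar> \<le> M * (C * \<delta>' powr (2 - 2 * s))"
    if "0 < \<delta>" "\<delta> \<le> \<delta>'" for \<delta> \<delta>' y
    by (rule trunc_frac_Cauchy[OF s(1) _ B M(1,2)]) (use C that in auto)
  \<comment> \<open>Outside the ball of radius \<open>R + 1\<close> all second differences with \<open>|z| < 1\<close> vanish.\<close>
  have far: "\<bar>trunc_frac s \<delta> \<phi> y - trunc_frac s \<delta>' \<phi> y\<bar> \<le> 0 * (C * \<delta>' powr (2 - 2 * s))"
    if "0 < \<delta>" "\<delta> \<le> \<delta>'" "\<delta>' \<le> 1" "R + 1 \<le> norm y" for \<delta> \<delta>' y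
  proof (rule trunc_frac_Cauchy[OF s(1) _ B])
    fix z :: 'a assume "norm z < \<delta>'"
    then have "R \<le> norm y" "R \<le> norm (y + z)" "R \<le> norm (y - z)"
      using that norm_triangle_ineq2[of y "-z"] norm_triangle_ineq2[of y z] by auto
    then show "\<bar>\<phi> (y + z) + \<phi> (y - z) - 2 * \<phi> y\<bar> \<le> 0 * (norm z)\<^sup>2"
      by (simp add: R)
  qed (use C that in auto)
  have "\<exists>L. ((\<lambda>\<delta>. trunc_frac s \<delta> \<phi> y) \<longlongrightarrow> L) (at_right 0) \<and>
      (\<forall>\<delta>>0. \<bar>L - trunc_frac s \<delta> \<phi> y\<bar> \<le> M * C * \<delta> powr (2 - 2 * s))" for y
  proof -
    have "((\<lambda>\<delta>. M * C * \<delta> powr (2 - 2 * s)) \<longlongrightarrow> 0) (at_right 0)"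
      using s by (intro powr_at_right_0) auto
    then show ?thesis
      by (intro tendsto_at_right_0_of_Cauchy) (use main in \<open>simp_all add: mult.assoc\<close>)
  qed
  then obtain F where F: "\<And>y. ((\<lambda>\<delta>. trunc_frac s \<delta> \<phi> y) \<longlongrightarrow> F y) (at_right 0)"
    "\<And>y \<delta>. 0 < \<delta> \<Longrightarrow> \<bar>F y - trunc_frac s \<delta> \<phi> y\<bar> \<le> M * C * \<delta> powr (2 - 2 * s)" by metis
  have "\<bar>F y - trunc_frac s \<delta> \<phi> y\<bar> \<le> M * C * \<delta> powr (2 - 2 * s) * indicator (ball 0 (R + 1)) y"
    if "0 < \<delta>" "\<delta> \<le> 1" for \<delta> y
  proof (cases "norm y < R + 1")
    case False
    have "((\<lambda>\<delta>'. trunc_frac s \<delta>' \<phi> y) \<longlongrightarrow> trunc_frac s \<delta> \<phi> y) (at_right 0)"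
    proof (rule tendsto_eventually)
      have "trunc_frac s \<delta>' \<phi> y = trunc_frac s \<delta> \<phi> y" if "0 < \<delta>'" "\<delta>' < \<delta>" for \<delta>'
        using far[of \<delta>' \<delta> y] that \<open>\<delta> \<le> 1\<close> False by simp
      then show "\<forall>\<^sub>F \<delta>' in at_right 0. trunc_frac s \<delta>' \<phi> y = trunc_frac s \<delta> \<phi> y"
        using \<open>0 < \<delta>\<close> unfolding eventually_at_right_field by blast
    qed
    with F(1)[of y] have "F y = trunc_frac s \<delta> \<phi> y"
      by (intro tendsto_unique[of "at_right 0"]) auto
    then show ?thesis using False by simp
  qed (use F(2) that in simp)
  with F(1) C(1) M(2) show ?thesis by (intro that[of "M * C" F]) auto
qed

section \<open>Pairing with functions of controlled growth\<close>

text \<open>The weight that defines the space of admissible functions.\<close>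

definition tail_weight :: "real \<Rightarrow> 'a::euclidean_space \<Rightarrow> real"
  where "tail_weight s y = 1 / (1 + norm y powr (real DIM('a) + 2 * s))"

lemma tail_weight_measurable [measurable]: "tail_weight s \<in> borel_measurable borel"
  unfolding tail_weight_def[abs_def] by measurable

lemma tail_weight_pos: "0 < tail_weight s y"
  by (auto simp: tail_weight_def intro!: add_pos_nonneg)

lemma integrable_locally:
  fixes u f :: "'a::euclidean_space \<Rightarrow> real"
  assumes s: "0 < s" and [measurable]: "u \<in> borel_measurable borel" "f \<in> borel_measurable borel"
    and u: "integrable lborel (\<lambda>y. u y * tail_weight s y)"
    and B: "\<And>y. \<bar>f y\<bar> \<le> B" and R: "\<And>y. R \<le> norm y \<Longrightarrow> f y = 0"
  shows "integrable lborel (\<lambda>y. u y * f y)"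
proof (rule Bochner_Integration.integrable_bound)
  define C where "C = B * (1 + \<bar>R\<bar> powr (real DIM('a) + 2 * s))"
  show "integrable lborel (\<lambda>y. C * (u y * tail_weight s y))" using u by simp
  have "\<bar>u y * f y\<bar> \<le> \<bar>C * (u y * tail_weight s y)\<bar>" for y
  proof (cases "norm y < R")
    case True
    have "0 \<le> B" using B[of y] by linarith
    have "norm y powr (real DIM('a) + 2 * s) \<le> \<bar>R\<bar> powr (real DIM('a) + 2 * s)"
      using True s by (intro powr_mono2) auto
    then have "1 \<le> (1 + \<bar>R\<bar> powr (real DIM('a) + 2 * s)) * tail_weight s y"
      by (auto simp: tail_weight_def field_simps add_pos_nonneg)
    then have "B \<le> C * tail_weight s y"
      unfolding C_def using mult_left_mono[OF _ \<open>0 \<le> B\<close>] by (fastforce simp: mult.assoc)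
    with B[of y] have "\<bar>f y\<bar> \<le> \<bar>C * tail_weight s y\<bar>" by linarith
    then have "\<bar>u y\<bar> * \<bar>f y\<bar> \<le> \<bar>u y\<bar> * \<bar>C * tail_weight s y\<bar>" by (intro mult_left_mono) auto
    then show ?thesis by (simp add: abs_mult mult_ac)
  qed (simp add: R)
  then show "AE y in lborel. norm (u y * f y) \<le> norm (C * (u y * tail_weight s y))" by simp
qed simp

text \<open>If \<open>y + z\<close> stays in a bounded set and \<open>|z| \<ge> \<delta>\<close>, then \<open>|y|\<close> is at most a multiple of \<open>|z|\<close>, so the kernel
decays in \<open>y\<close> like the weight.\<close>

lemma cut_kern_le_tail_weight:
  assumes s: "0 < s" and \<delta>: "0 < \<delta>" and R: "0 < R"
  obtains C where "0 < C"
    "\<And>y z :: 'a::euclidean_space. norm (y + z) < R \<Longrightarrow> cut_kern s \<delta> z \<le> C * tail_weight s y"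
proof -
  let ?N = "real DIM('a) + 2 * s"
  \<comment> \<open>\<open>|y| \<le> R + |z|\<close> and \<open>\<delta> \<le> |z|\<close> give \<open>|y| \<le> c * |z|\<close>.\<close>
  define c where "c = R / \<delta> + 1"
  have c: "0 < c" using R \<delta> by (auto simp: c_def intro: add_pos_pos)
  define C where "C = \<delta> powr - ?N + c powr ?N"
  have "0 < C" using c \<delta> by (auto simp: C_def intro: add_pos_pos)
  moreover have "cut_kern s \<delta> z \<le> C * tail_weight s y" if "norm (y + z) < R" for y z :: 'a
  proof (cases "\<delta> \<le> norm z")
    case True
    with \<delta> have z: "0 < norm z" by linarith
    have "norm y \<le> norm (y + z) + norm z" using norm_triangle_ineq4[of "y + z" z] by simp
    also have "\<dots> \<le> R / \<delta> * norm z + norm z"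
      using that True R \<delta> mult_left_mono[of \<delta> "norm z" "R / \<delta>"] by simp
    finally have "norm y \<le> c * norm z" by (simp add: c_def algebra_simps)
    then have "norm y powr ?N \<le> c powr ?N * norm z powr ?N"
      using s c by (subst powr_mult[symmetric]) (auto intro!: powr_mono2)
    moreover have "1 \<le> \<delta> powr - ?N * norm z powr ?N"
    proof -
      have "\<delta> powr ?N \<le> norm z powr ?N" using True \<delta> s by (intro powr_mono2) auto
      then show ?thesis using \<delta> by (simp only: powr_minus) (simp add: field_simps)
    qed
    ultimately have "1 + norm y powr ?N \<le> C * norm z powr ?N"
      by (simp add: C_def distrib_right)
    moreover have "0 < 1 + norm y powr ?N" by (intro add_pos_nonneg) auto
    ultimately show ?thesis
      using True z by (simp add: cut_kern_def kern_eq_divide tail_weight_def field_simps)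
  qed (use \<open>0 < C\<close> tail_weight_pos[of s y] in \<open>simp add: cut_kern_def\<close>)
  ultimately show ?thesis by (rule that)
qed

text \<open>By \<open>cut_kern_le_tail_weight\<close> the double integrand is dominated by a product of an integrable function
of \<open>y\<close> and a translate of \<open>\<phi>\<close>, which justifies exchanging the two integrations.\<close>

lemma correlation_Fubini:
  fixes u \<phi> :: "'a::euclidean_space \<Rightarrow> real"
  assumes s: "0 < s" and [measurable]: "u \<in> borel_measurable borel" "\<phi> \<in> borel_measurable borel"
    and u: "integrable lborel (\<lambda>y. u y * tail_weight s y)"
    and B: "\<And>y. \<bar>\<phi> y\<bar> \<le> B" and R: "\<And>y. R \<le> norm y \<Longrightarrow> \<phi> y = 0" "0 < R" and \<delta>: "0 < \<delta>"
  defines "V \<equiv> \<lambda>z. LINT y|lborel. u y * \<phi> (y + z)"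
  shows "integrable lborel (\<lambda>z. cut_kern s \<delta> z * V z)"
    "integrable lborel (\<lambda>y. u y * (LINT z|lborel. cut_kern s \<delta> z * \<phi> (y + z)))"
    "(LINT y|lborel. u y * (LINT z|lborel. cut_kern s \<delta> z * \<phi> (y + z))) = (LINT z|lborel. cut_kern s \<delta> z * V z)"
proof -
  obtain C where C: "0 < C" "\<And>y z :: 'a. norm (y + z) < R \<Longrightarrow> cut_kern s \<delta> z \<le> C * tail_weight s y"
    using cut_kern_le_tail_weight[OF s \<delta> R(2), where 'a='a] by blast
  have i\<phi>: "integrable lborel (\<lambda>y. \<bar>\<phi> y\<bar>)"
  proof (rule Bochner_Integration.integrable_bound)
    show "integrable lborel (\<lambda>y. B * indicator (ball (0::'a) R) y)"
      using emeasure_lborel_ball_finite[of "0::'a" R]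
      by (intro integrable_mult_right integrable_real_indicator) auto
    show "AE y in lborel. norm \<bar>\<phi> y\<bar> \<le> norm (B * indicator (ball 0 R) y)"
      using B R by (auto simp: indicator_def intro: order.trans[OF _ abs_ge_self])
  qed simp
  have i: "integrable lborel (\<lambda>z. \<bar>\<phi> (y + z)\<bar>)" and e: "(LINT z|lborel. \<bar>\<phi> (y + z)\<bar>) = (LINT z|lborel. \<bar>\<phi> z\<bar>)" for y
    using i\<phi> lborel_integrable_translation[of "\<lambda>z. \<bar>\<phi> z\<bar>" y] lborel_integral_translation[of "\<lambda>z. \<bar>\<phi> z\<bar>" y]
    by simp_all
  have "integrable (lborel \<Otimes>\<^sub>M lborel) (\<lambda>(y, z). C * (\<bar>u y\<bar> * tail_weight s y) * \<bar>\<phi> (y + z)\<bar>)"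
  proof (rule lborel_pair.Fubini_integrable)
    have "integrable lborel (\<lambda>y. \<bar>u y * tail_weight s y\<bar> * (C * (LINT z|lborel. \<bar>\<phi> z\<bar>)))"
      using u by (intro integrable_mult_left integrable_abs)
    then show "integrable lborel (\<lambda>y. LINT z|lborel. norm (case (y, z) of (y, z) \<Rightarrow> C * (\<bar>u y\<bar> * tail_weight s y) * \<bar>\<phi> (y + z)\<bar>))"
      using C tail_weight_pos[of s] by (simp add: abs_mult e less_imp_le mult_ac)
    show "AE y in lborel. integrable lborel (\<lambda>z. case (y, z) of (y, z) \<Rightarrow> C * (\<bar>u y\<bar> * tail_weight s y) * \<bar>\<phi> (y + z)\<bar>)"
      using i by simp
  qed measurable
  then have P: "integrable (lborel \<Otimes>\<^sub>M lborel) (\<lambda>(y, z). cut_kern s \<delta> z * (u y * \<phi> (y + z)))"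
  proof (rule Bochner_Integration.integrable_bound)
    have "\<bar>cut_kern s \<delta> z * (u y * \<phi> (y + z))\<bar> \<le> \<bar>C * (\<bar>u y\<bar> * tail_weight s y) * \<bar>\<phi> (y + z)\<bar>\<bar>" for y z
    proof (cases "norm (y + z) < R")
      case True
      have "cut_kern s \<delta> z * \<bar>u y * \<phi> (y + z)\<bar> \<le> (C * tail_weight s y) * \<bar>u y * \<phi> (y + z)\<bar>"
        by (intro mult_right_mono C(2) True) auto
      then show ?thesis
        using C(1) tail_weight_pos[of s y] by (simp add: abs_mult mult_ac)
    qed (simp add: R)
    then show "AE p in lborel \<Otimes>\<^sub>M lborel. norm (case p of (y, z) \<Rightarrow> cut_kern s \<delta> z * (u y * \<phi> (y + z)))
        \<le> norm (case p of (y, z) \<Rightarrow> C * (\<bar>u y\<bar> * tail_weight s y) * \<bar>\<phi> (y + z)\<bar>)"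
      by (auto intro!: AE_I2)
  qed measurable
  have 1: "(LINT z|lborel. cut_kern s \<delta> z * (u y * \<phi> (y + z))) = u y * (LINT z|lborel. cut_kern s \<delta> z * \<phi> (y + z))" for y
    by (simp add: mult.left_commute[of _ "u y"])
  have 2: "(LINT y|lborel. cut_kern s \<delta> z * (u y * \<phi> (y + z))) = cut_kern s \<delta> z * V z" for z
    by (simp add: V_def)
  show "integrable lborel (\<lambda>z. cut_kern s \<delta> z * V z)"
    using lborel_pair.integrable_snd[OF P] by (simp only: 2)
  show "integrable lborel (\<lambda>y. u y * (LINT z|lborel. cut_kern s \<delta> z * \<phi> (y + z)))"
    using lborel_pair.integrable_fst[OF P] by (simp only: 1)
  show "(LINT y|lborel. u y * (LINT z|lborel. cut_kern s \<delta> z * \<phi> (y + z))) = (LINT z|lborel. cut_kern s \<delta> z * V z)"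
    using lborel_pair.Fubini_integral[OF P] by (simp only: 1 2)
qed

lemma
  fixes u \<phi> :: "'a::euclidean_space \<Rightarrow> real"
  assumes s: "0 < s" and [measurable]: "u \<in> borel_measurable borel" "\<phi> \<in> borel_measurable borel"
    and u: "integrable lborel (\<lambda>y. u y * tail_weight s y)"
    and B: "\<And>y. \<bar>\<phi> y\<bar> \<le> B" and R: "\<And>y. R \<le> norm y \<Longrightarrow> \<phi> y = 0" "0 < R" and \<delta>: "0 < \<delta>"
  defines "V \<equiv> \<lambda>z. LINT y|lborel. u y * \<phi> (y + z)"
  shows integrable_times_trunc_frac: "integrable lborel (\<lambda>y. u y * trunc_frac s \<delta> \<phi> y)"
    and integral_times_trunc_frac: "(LINT y|lborel. u y * trunc_frac s \<delta> \<phi> y) =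
      (LINT z::'a|lborel. cut_kern s \<delta> z) * V 0 - (LINT z|lborel. cut_kern s \<delta> z * V z)"
proof -
  note F = correlation_Fubini[OF assms(1-8), folded V_def]
  have k: "integrable lborel (cut_kern s \<delta> :: 'a \<Rightarrow> real)"
    using s \<delta> by (rule cut_kern_integrable)
  have i: "integrable lborel (\<lambda>z. cut_kern s \<delta> z * \<phi> (y + z))" for y
    using integrable_bounded_times[OF k, of "\<lambda>z. \<phi> (y + z)" B] B by (simp add: mult.commute)
  have t: "trunc_frac s \<delta> \<phi> y = (LINT z::'a|lborel. cut_kern s \<delta> z) * \<phi> y - (LINT z|lborel. cut_kern s \<delta> z * \<phi> (y + z))" for y
  proof -
    have "(\<phi> y - \<phi> (y + z)) * cut_kern s \<delta> z = cut_kern s \<delta> z * \<phi> y - cut_kern s \<delta> z * \<phi> (y + z)" for z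
      by (simp add: algebra_simps)
    then show ?thesis
      unfolding trunc_frac_def using i[of y] k by simp
  qed
  have u\<phi>: "integrable lborel (\<lambda>y. u y * \<phi> y)"
    by (rule integrable_locally[OF s _ _ u B R(1)]) auto
  have e: "u y * trunc_frac s \<delta> \<phi> y = (LINT z::'a|lborel. cut_kern s \<delta> z) * (u y * \<phi> y)
      - u y * (LINT z|lborel. cut_kern s \<delta> z * \<phi> (y + z))" for y
    by (simp add: t algebra_simps)
  show "integrable lborel (\<lambda>y. u y * trunc_frac s \<delta> \<phi> y)"
    unfolding e using u\<phi> F(2) by (intro Bochner_Integration.integrable_diff integrable_mult_right)
  show "(LINT y|lborel. u y * trunc_frac s \<delta> \<phi> y) =
      (LINT z::'a|lborel. cut_kern s \<delta> z) * V 0 - (LINT z|lborel. cut_kern s \<delta> z * V z)"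
    unfolding e using u\<phi> F(2,3) by (simp add: V_def)
qed

lemma test_functionsD:
  fixes \<phi> :: "'a::euclidean_space \<Rightarrow> real"
  assumes "\<phi> \<in> test_functions \<Omega>"
  shows test_functions_C_k: "C_k k \<phi>"
    and test_functions_continuous: "continuous_on UNIV \<phi>"
    and test_functions_compact: "compact (closure {x. \<phi> x \<noteq> 0})"
  using assms C_k.simps(1)[of \<phi>] unfolding test_functions_def by blast+

lemma continuous_partial_deriv2:
  assumes "C_k 2 f" "i \<in> Basis" "j \<in> Basis"
  shows "continuous_on UNIV (partial_deriv j (partial_deriv i f))"
  using assms by (simp add: numeral_2_eq_2)

lemma inverse_Suc_at_right_0: "filterlim (\<lambda>n. inverse (real (Suc n))) (at_right 0) sequentially"
  by (intro tendsto_imp_filterlim_at_right LIMSEQ_inverse_real_of_nat) auto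

text \<open>The distribution is expressed through the correlation \<open>V\<close> alone: the local part is a limit of second
differences of \<open>V\<close> at the origin, the nonlocal part a limit of truncated singular integrals. For
\<open>\<phi>\<close> a translated mollifier, \<open>V\<close> is a translate of a mollification of \<open>u\<close>, and the statement replaces the
differential equation for that mollification.\<close>

theorem mixed_op_distr_limit:
  fixes u \<phi> :: "'a::euclidean_space \<Rightarrow> real"
  assumes s: "0 < s" "s < 1" "2 \<le> DIM('a)" and [measurable]: "u \<in> borel_measurable borel"
    and u: "integrable lborel (\<lambda>y. u y * tail_weight s y)"
    and \<phi>: "\<phi> \<in> test_functions \<Omega>"
  defines "V \<equiv> \<lambda>z. LINT y|lborel. u y * \<phi> (y + z)"
  obtains L F where "mixed_op s \<phi> \<in> borel_measurable borel" "mixed_op_distr s u \<phi> = - (\<Sum>e\<in>Basis. L e) + frac_const DIM('a) s * F"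
    "\<And>e. e \<in> Basis \<Longrightarrow> (\<lambda>n. (V (inverse (real (Suc n)) *\<^sub>R e) + V (- (inverse (real (Suc n)) *\<^sub>R e)) - 2 * V 0)
       / (inverse (real (Suc n)))\<^sup>2) \<longlonglongrightarrow> L e"
    "((\<lambda>\<delta>. (LINT z::'a|lborel. cut_kern s \<delta> z) * V 0 - (LINT z|lborel. cut_kern s \<delta> z * V z)) \<longlongrightarrow> F) (at_right 0)"
proof -
  note c\<phi> = test_functions_continuous[OF \<phi>] and k\<phi> = test_functions_compact[OF \<phi>]
    and C2 = test_functions_C_k[OF \<phi>, of 2]
  have [measurable]: "\<phi> \<in> borel_measurable borel"
    using c\<phi> by (rule borel_measurable_continuous_onI)
  obtain B where B: "\<And>z. \<bar>\<phi> z\<bar> \<le> B"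
    using bounded_of_compact_support[OF c\<phi> k\<phi>] by auto
  obtain M where M: "0 \<le> M" "\<And>y z. \<bar>\<phi> (y + z) + \<phi> (y - z) - 2 * \<phi> y\<bar> \<le> M * (norm z)\<^sup>2"
    using second_difference_bound[OF C2 k\<phi>] by blast
  obtain R where R: "0 < R" "\<And>y. R \<le> norm y \<Longrightarrow> y \<notin> closure {x. \<phi> x \<noteq> 0}"
  proof -
    obtain b where "\<And>y. y \<in> closure {x. \<phi> x \<noteq> 0} \<Longrightarrow> norm y \<le> b"
      using compact_imp_bounded[OF k\<phi>] by (auto simp: bounded_iff)
    then show ?thesis by (intro that[of "\<bar>b\<bar> + 1"]) force+
  qed
  have R\<phi>: "\<phi> y = 0" if "R \<le> norm y" for y
    using R(2)[OF that] closure_subset[of "{x. \<phi> x \<noteq> 0}"] by auto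
  have loc: "integrable lborel (\<lambda>y. \<bar>u y\<bar> * indicator (ball 0 (R + 1)) y)"
  proof -
    have "integrable lborel (\<lambda>y. u y * indicator (ball 0 (R + 1)) y)"
      by (rule integrable_locally[OF s(1) _ _ u, of _ 1 "R + 1"]) (auto intro: borel_measurable_indicator)
    from integrable_abs[OF this] show ?thesis by (simp add: abs_mult)
  qed

  define D where "D e = partial_deriv e (partial_deriv e \<phi>)" for e
  have D_cont: "continuous_on UNIV (D e)" if "e \<in> Basis" for e
    unfolding D_def by (rule continuous_partial_deriv2[OF C2 that that])
  have D_meas [measurable]: "D e \<in> borel_measurable borel" if "e \<in> Basis" for e
    using D_cont[OF that] by (rule borel_measurable_continuous_onI)
  have D_supp: "closure {x. D e x \<noteq> 0} \<subseteq> closure {x. \<phi> x \<noteq> 0}" for e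
    unfolding D_def using support_partial_deriv[of e \<phi>] support_partial_deriv[of e "partial_deriv e \<phi>"] by blast
  have D_int: "integrable lborel (\<lambda>y. u y * D e y)" if e: "e \<in> Basis" for e
  proof -
    obtain b where "\<And>x. \<bar>D e x\<bar> \<le> b"
      using bounded_of_compact_support[OF D_cont[OF e] k\<phi> D_supp] by auto
    moreover have "D e y = 0" if "R \<le> norm y" for y
      using R(2)[OF that] D_supp[of e] closure_subset[of "{x. D e x \<noteq> 0}"] by auto
    ultimately show ?thesis
      using e by (intro integrable_locally[OF s(1) _ _ u]) auto
  qed
  have V_int: "integrable lborel (\<lambda>y. u y * \<phi> (y + z))" for z
  proof (rule integrable_locally[OF s(1) _ _ u])
    show "\<phi> (y + z) = 0" if "R + norm z \<le> norm y" for y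
      using that norm_triangle_ineq2[of y "-z"] by (intro R\<phi>) auto
  qed (use B in auto)
  have L: "(\<lambda>n. (V (inverse (real (Suc n)) *\<^sub>R e) + V (- (inverse (real (Suc n)) *\<^sub>R e)) - 2 * V 0)
       / (inverse (real (Suc n)))\<^sup>2) \<longlonglongrightarrow> (LINT y|lborel. u y * D e y)" if e: "e \<in> Basis" for e
  proof -
    define h where "h n = inverse (real (Suc n))" for n
    define Q where "Q n y = (\<phi> (y + h n *\<^sub>R e) + \<phi> (y - h n *\<^sub>R e) - 2 * \<phi> y) / (h n)\<^sup>2" for n y
    have h: "0 < h n" "h n \<le> 1" for n by (auto simp: h_def field_simps)
    have "(\<lambda>n. LINT y|lborel. u y * Q n y) \<longlonglongrightarrow> (LINT y|lborel. u y * D e y)"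
    proof (rule integral_dominated_convergence)
      show "integrable lborel (\<lambda>y. M * (\<bar>u y\<bar> * indicator (ball 0 (R + 1)) y))"
        using loc by simp
      show "AE y in lborel. (\<lambda>n. u y * Q n y) \<longlonglongrightarrow> u y * D e y"
      proof (rule AE_I2)
        fix y
        have "filterlim h (at 0) sequentially"
          using inverse_Suc_at_right_0 unfolding h_def by (rule filterlim_mono) (auto simp: at_within_le_at)
        from filterlim_compose[OF second_difference_lim[OF C2 e, of y] this]
        show "(\<lambda>n. u y * Q n y) \<longlonglongrightarrow> u y * D e y"
          unfolding Q_def D_def by (intro tendsto_intros)
      qed
      fix n
      have "\<bar>Q n y\<bar> \<le> M * indicator (ball 0 (R + 1)) y" for y
      proof (cases "norm y < R + 1")
        case True
        have "\<bar>\<phi> (y + h n *\<^sub>R e) + \<phi> (y - h n *\<^sub>R e) - 2 * \<phi> y\<bar> \<le> M * (h n)\<^sup>2"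
          using M(2)[of y "h n *\<^sub>R e"] e by simp
        then show ?thesis
          using True h[of n] by (simp add: Q_def field_simps)
      next
        case False
        have "norm (h n *\<^sub>R e) \<le> 1" using h[of n] e by simp
        then have "R \<le> norm y" "R \<le> norm (y + h n *\<^sub>R e)" "R \<le> norm (y - h n *\<^sub>R e)"
          using False norm_triangle_ineq2[of y "- (h n *\<^sub>R e)"] norm_triangle_ineq2[of y "h n *\<^sub>R e"] by auto
        then show ?thesis using M(1) by (simp add: Q_def R\<phi>)
      qed
      then have "\<bar>u y\<bar> * \<bar>Q n y\<bar> \<le> \<bar>u y\<bar> * (M * indicator (ball 0 (R + 1)) y)" for y
        by (intro mult_left_mono) auto
      then show "AE y in lborel. norm (u y * Q n y) \<le> M * (\<bar>u y\<bar> * indicator (ball 0 (R + 1)) y)"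
        by (auto simp: abs_mult mult_ac)
    qed (use e in \<open>auto simp: Q_def\<close>)
    moreover have "(LINT y|lborel. u y * Q n y) = (V (h n *\<^sub>R e) + V (- (h n *\<^sub>R e)) - 2 * V 0) / (h n)\<^sup>2" for n
    proof -
      have "u y * Q n y = (u y * \<phi> (y + h n *\<^sub>R e) + u y * \<phi> (y + - (h n *\<^sub>R e)) - 2 * (u y * \<phi> (y + 0))) / (h n)\<^sup>2" for y
        by (simp add: Q_def field_simps)
      then show ?thesis
        using V_int[of "h n *\<^sub>R e"] V_int[of "- (h n *\<^sub>R e)"] V_int[of 0]
        unfolding V_def by simp
    qed
    ultimately show ?thesis by (simp add: h_def)
  qed

  obtain C F where F: "0 \<le> C" "\<And>y. ((\<lambda>\<delta>. trunc_frac s \<delta> \<phi> y) \<longlongrightarrow> F y) (at_right 0)"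
    "\<And>\<delta> y. 0 < \<delta> \<Longrightarrow> \<delta> \<le> 1 \<Longrightarrow> \<bar>F y - trunc_frac s \<delta> \<phi> y\<bar> \<le> C * \<delta> powr (2 - 2 * s) * indicator (ball 0 (R + 1)) y"
    using trunc_frac_limit[OF s _ B M(2,1) R\<phi>] by auto
  have tr_meas [measurable]: "trunc_frac s \<delta> \<phi> \<in> borel_measurable borel" for \<delta>
    unfolding trunc_frac_def by measurable
  have F_meas [measurable]: "F \<in> borel_measurable borel"
  proof (rule borel_measurable_LIMSEQ_real)
    show "(\<lambda>n. trunc_frac s (inverse (real (Suc n))) \<phi> y) \<longlonglongrightarrow> F y" for y
      by (rule filterlim_compose[OF F(2) inverse_Suc_at_right_0])
  qed measurable
  have dF: "integrable lborel (\<lambda>y. u y * (F y - trunc_frac s \<delta> \<phi> y))" if "0 < \<delta>" "\<delta> \<le> 1" for \<delta>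
  proof (rule integrable_locally[OF s(1) _ _ u])
    show "\<bar>F y - trunc_frac s \<delta> \<phi> y\<bar> \<le> C * \<delta> powr (2 - 2 * s)" for y
      using F(3)[OF that, of y] F(1) by (cases "norm y < R + 1") auto
    show "F y - trunc_frac s \<delta> \<phi> y = 0" if "R + 1 \<le> norm y" for y
      using F(3)[OF \<open>0 < \<delta>\<close> \<open>\<delta> \<le> 1\<close>, of y] that by simp
  qed auto
  have tr_int: "integrable lborel (\<lambda>y. u y * trunc_frac s \<delta> \<phi> y)" if "0 < \<delta>" for \<delta>
    by (rule integrable_times_trunc_frac[OF s(1) _ _ u B R\<phi> R(1) that]) auto
  have F_int: "integrable lborel (\<lambda>y. u y * F y)"
    using Bochner_Integration.integrable_add[OF dF[of 1] tr_int[of 1]] by (simp add: algebra_simps)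
  define A where "A = (LINT y|lborel. \<bar>u y\<bar> * indicator (ball 0 (R + 1)) y)"
  have conv: "((\<lambda>\<delta>. LINT y|lborel. u y * trunc_frac s \<delta> \<phi> y) \<longlongrightarrow> (LINT y|lborel. u y * F y)) (at_right 0)"
  proof (rule Lim_transform[OF tendsto_const], rule Lim_null_comparison)
    show "((\<lambda>\<delta>. C * A * \<delta> powr (2 - 2 * s)) \<longlongrightarrow> 0) (at_right 0)"
      using s by (intro powr_at_right_0) auto
    have "\<bar>(LINT y|lborel. u y * trunc_frac s \<delta> \<phi> y) - (LINT y|lborel. u y * F y)\<bar> \<le> C * A * \<delta> powr (2 - 2 * s)"
      if \<delta>: "0 < \<delta>" "\<delta> \<le> 1" for \<delta>
    proof -
      have "(LINT y|lborel. u y * trunc_frac s \<delta> \<phi> y) - (LINT y|lborel. u y * F y) = - (LINT y|lborel. u y * (F y - trunc_frac s \<delta> \<phi> y))"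
        using F_int tr_int[OF \<delta>(1)] by (simp add: right_diff_distrib)
      then have "\<bar>(LINT y|lborel. u y * trunc_frac s \<delta> \<phi> y) - (LINT y|lborel. u y * F y)\<bar> \<le> (LINT y|lborel. \<bar>u y * (F y - trunc_frac s \<delta> \<phi> y)\<bar>)"
        by simp
      also have "\<dots> \<le> (LINT y|lborel. C * \<delta> powr (2 - 2 * s) * (\<bar>u y\<bar> * indicator (ball 0 (R + 1)) y))"
      proof (rule integral_mono)
        fix y
        show "\<bar>u y * (F y - trunc_frac s \<delta> \<phi> y)\<bar> \<le> C * \<delta> powr (2 - 2 * s) * (\<bar>u y\<bar> * indicator (ball 0 (R + 1)) y)"
          using mult_left_mono[OF F(3)[OF \<delta>, of y], of "\<bar>u y\<bar>"] by (simp add: abs_mult mult_ac)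
      qed (use dF[OF \<delta>] loc in auto)
      also have "\<dots> = C * A * \<delta> powr (2 - 2 * s)"
        by (subst integral_mult_right_zero) (simp add: A_def)
      finally show ?thesis .
    qed
    then have "\<forall>\<delta>>0. \<delta> < 1 \<longrightarrow> norm ((LINT y|lborel. u y * trunc_frac s \<delta> \<phi> y) - (LINT y|lborel. u y * F y)) \<le> C * A * \<delta> powr (2 - 2 * s)"
      by simp
    then show "\<forall>\<^sub>F \<delta> in at_right 0. norm ((LINT y|lborel. u y * trunc_frac s \<delta> \<phi> y) - (LINT y|lborel. u y * F y)) \<le> C * A * \<delta> powr (2 - 2 * s)"
      unfolding eventually_at_right_field by (intro exI[of _ 1]) auto
  qed
  have "((\<lambda>\<delta>. (LINT z::'a|lborel. cut_kern s \<delta> z) * V 0 - (LINT z|lborel. cut_kern s \<delta> z * V z)) \<longlongrightarrow> (LINT y|lborel. u y * F y)) (at_right 0)"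
  proof (rule Lim_transform_eventually[OF conv])
    show "\<forall>\<^sub>F \<delta> in at_right 0. (LINT y|lborel. u y * trunc_frac s \<delta> \<phi> y) =
        (LINT z::'a|lborel. cut_kern s \<delta> z) * V 0 - (LINT z|lborel. cut_kern s \<delta> z * V z)"
      using eventually_at_right_less[of "0::real"]
      by eventually_elim (unfold V_def, rule integral_times_trunc_frac[OF s(1) _ _ u B R\<phi> R(1)], auto)
  qed
  moreover have mixed: "mixed_op_distr s u \<phi> = - (\<Sum>e\<in>Basis. LINT y|lborel. u y * D e y) + frac_const DIM('a) s * (LINT y|lborel. u y * F y)"
    "mixed_op s \<phi> \<in> borel_measurable borel"
  proof -
    have m: "mixed_op s \<phi> y = - (\<Sum>e\<in>Basis. D e y) + frac_const DIM('a) s * F y" for y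
      unfolding mixed_op_def laplacian_def D_def
      using tendsto_Lim[OF _ F(2), of y] by (simp add: frac_laplacian_trunc)
    have D_sum [measurable]: "(\<lambda>y. \<Sum>e\<in>Basis. D e y) \<in> borel_measurable borel"
      by (intro borel_measurable_sum D_meas)
    have "(\<lambda>y. - (\<Sum>e\<in>Basis. D e y) + frac_const DIM('a) s * F y) \<in> borel_measurable borel"
      by measurable
    then show "mixed_op s \<phi> \<in> borel_measurable borel"
      unfolding m[abs_def] .
    have "mixed_op_distr s u \<phi> = (LINT y|lebesgue. u y * (- (\<Sum>e\<in>Basis. D e y) + frac_const DIM('a) s * F y))"
      by (simp add: mixed_op_distr_def m)
    also have "\<dots> = (LINT y|lborel. u y * (- (\<Sum>e\<in>Basis. D e y) + frac_const DIM('a) s * F y))"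
      by (rule integral_completion) measurable
    also have "\<dots> = (LINT y|lborel. - (\<Sum>e\<in>Basis. u y * D e y) + frac_const DIM('a) s * (u y * F y))"
      by (simp add: algebra_simps sum_distrib_left)
    also have "\<dots> = - (\<Sum>e\<in>Basis. LINT y|lborel. u y * D e y) + frac_const DIM('a) s * (LINT y|lborel. u y * F y)"
      using D_int F_int by (subst Bochner_Integration.integral_add) auto
    finally show "mixed_op_distr s u \<phi> = - (\<Sum>e\<in>Basis. LINT y|lborel. u y * D e y) + frac_const DIM('a) s * (LINT y|lborel. u y * F y)" .
  qed
  ultimately show ?thesis
    using L by (intro that[of "\<lambda>e. LINT y|lborel. u y * D e y" "LINT y|lborel. u y * F y"]) auto
qed

section \<open>Mollification\<close>

definition bump :: "real \<Rightarrow> 'a::euclidean_space \<Rightarrow> real"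
  where "bump \<epsilon> z = flat_exp 1 (1 - (1 / \<epsilon>\<^sup>2) * (z \<bullet> z))"

lemma bump_nonneg: "0 \<le> bump \<epsilon> z" and bump_le_1: "bump \<epsilon> z \<le> 1"
  by (auto simp: bump_def flat_exp_def)

lemma bump_support: "0 < \<epsilon> \<Longrightarrow> bump \<epsilon> z \<noteq> 0 \<longleftrightarrow> norm z < \<epsilon>"
proof -
  assume "0 < \<epsilon>"
  then have "0 < 1 - (1 / \<epsilon>\<^sup>2) * (z \<bullet> z) \<longleftrightarrow> (norm z)\<^sup>2 < \<epsilon>\<^sup>2"
    by (simp add: power2_norm_eq_inner field_simps)
  also have "\<dots> \<longleftrightarrow> norm z < \<epsilon>"
    using \<open>0 < \<epsilon>\<close> by (auto intro: power2_less_imp_less power_strict_mono)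
  finally show ?thesis by (auto simp: bump_def flat_exp_def)
qed

lemma bump_mono: "norm z \<le> norm w \<Longrightarrow> bump \<epsilon> w \<le> bump \<epsilon> z" for z w :: "'a::euclidean_space"
proof -
  assume "norm z \<le> norm w"
  then have "z \<bullet> z \<le> w \<bullet> w" by (simp add: norm_le)
  then have "1 - (1 / \<epsilon>\<^sup>2) * (w \<bullet> w) \<le> 1 - (1 / \<epsilon>\<^sup>2) * (z \<bullet> z)"
    by (simp add: divide_right_mono)
  then show ?thesis
    by (auto simp: bump_def flat_exp_def field_simps)
qed

lemma C_k_bump: "C_k k (\<lambda>y::'a::euclidean_space. bump \<epsilon> (y - x))"
  unfolding bump_def by (rule C_k_flat_exp_sphere)

lemma bump_continuous: "continuous_on UNIV (bump \<epsilon> :: 'a::euclidean_space \<Rightarrow> real)"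
  using C_k_bump[of 0 \<epsilon> 0] by simp

lemma bump_measurable [measurable]: "bump \<epsilon> \<in> borel_measurable borel"
  using bump_continuous by (rule borel_measurable_continuous_onI)

lemma bump_integrable: "0 < \<epsilon> \<Longrightarrow> integrable lborel (bump \<epsilon> :: 'a::euclidean_space \<Rightarrow> real)"
proof (rule Bochner_Integration.integrable_bound)
  assume "0 < \<epsilon>"
  show "integrable lborel (\<lambda>y. indicator (ball (0::'a) \<epsilon>) y :: real)"
    using emeasure_lborel_ball_finite[of "0::'a" \<epsilon>] by (intro integrable_real_indicator) auto
  show "AE y::'a in lborel. norm (bump \<epsilon> y) \<le> norm (indicator (ball (0::'a) \<epsilon>) y :: real)"
  proof (rule AE_I2)
    show "norm (bump \<epsilon> y) \<le> norm (indicator (ball (0::'a) \<epsilon>) y :: real)" for y :: 'a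
      using bump_support[OF \<open>0 < \<epsilon>\<close>, of y] bump_le_1[of \<epsilon> y] bump_nonneg[of \<epsilon> y]
      by (cases "norm y < \<epsilon>") auto
  qed
qed simp

lemma bump_integral_pos: "0 < \<epsilon> \<Longrightarrow> 0 < (LINT y::'a::euclidean_space|lborel. bump \<epsilon> y)"
proof -
  assume \<epsilon>: "0 < \<epsilon>"
  have "(LINT y::'a|lborel. bump \<epsilon> y) \<noteq> 0"
  proof
    assume "(LINT y::'a|lborel. bump \<epsilon> y) = 0"
    then have "AE y::'a in lborel. bump \<epsilon> y = 0"
      by (subst (asm) integral_nonneg_eq_0_iff_AE[OF bump_integrable[OF \<epsilon>]]) (auto simp: bump_nonneg)
    then have "AE y::'a in lborel. y \<notin> ball 0 \<epsilon>"
      by eventually_elim (use bump_support[OF \<epsilon>] in auto)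
    then have "emeasure lborel (ball (0::'a) \<epsilon>) = 0"
      by (subst (asm) AE_iff_measurable[of "ball 0 \<epsilon>"]) auto
    then show False using \<epsilon> unit_ball_vol_pos[of "real DIM('a)"] by (simp add: emeasure_ball)
  qed
  moreover have "0 \<le> (LINT y::'a|lborel. bump \<epsilon> y)"
    by (rule Bochner_Integration.integral_nonneg) (rule bump_nonneg)
  ultimately show ?thesis by (simp add: less_le)
qed

definition mollifier :: "real \<Rightarrow> 'a::euclidean_space \<Rightarrow> real"
  where "mollifier \<epsilon> z = bump \<epsilon> z / (LINT y::'a|lborel. bump \<epsilon> y)"

lemma mollifier_nonneg: "0 < \<epsilon> \<Longrightarrow> 0 \<le> mollifier \<epsilon> z" for z :: "'a::euclidean_space"
  using bump_integral_pos[of \<epsilon>, where 'a='a] by (simp add: mollifier_def bump_nonneg)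

lemma mollifier_eq_0: "0 < \<epsilon> \<Longrightarrow> \<epsilon> \<le> norm z \<Longrightarrow> mollifier \<epsilon> z = 0"
  using bump_support[of \<epsilon> z] by (auto simp: mollifier_def)

lemma mollifier_mono: "0 < \<epsilon> \<Longrightarrow> norm z \<le> norm w \<Longrightarrow> mollifier \<epsilon> w \<le> mollifier \<epsilon> z"
  for z w :: "'a::euclidean_space"
  using bump_integral_pos[of \<epsilon>, where 'a='a] by (simp add: mollifier_def bump_mono divide_right_mono)

lemma mollifier_cong: "0 < \<epsilon> \<Longrightarrow> norm z = norm w \<Longrightarrow> mollifier \<epsilon> w = mollifier \<epsilon> z"
  for z w :: "'a::euclidean_space"
  by (intro antisym mollifier_mono) auto

lemma mollifier_bounded: "0 < \<epsilon> \<Longrightarrow> \<bar>mollifier \<epsilon> z\<bar> \<le> 1 / (LINT y::'a|lborel. bump \<epsilon> y)" for z :: "'a::euclidean_space"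
  using bump_integral_pos[of \<epsilon>, where 'a='a] bump_le_1[of \<epsilon> z] bump_nonneg[of \<epsilon> z]
  by (simp add: mollifier_def divide_right_mono)

lemma mollifier_continuous: "0 < \<epsilon> \<Longrightarrow> continuous_on UNIV (mollifier \<epsilon> :: 'a::euclidean_space \<Rightarrow> real)"
  using bump_integral_pos[of \<epsilon>, where 'a='a]
  unfolding mollifier_def by (intro continuous_intros bump_continuous) auto

lemma mollifier_measurable [measurable]: "mollifier \<epsilon> \<in> borel_measurable borel"
  unfolding mollifier_def[abs_def] by measurable

lemma mollifier_integrable: "0 < \<epsilon> \<Longrightarrow> integrable lborel (mollifier \<epsilon> :: 'a::euclidean_space \<Rightarrow> real)"
  and mollifier_integral: "0 < \<epsilon> \<Longrightarrow> (LINT y::'a::euclidean_space|lborel. mollifier \<epsilon> y) = 1"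
  using bump_integrable[of \<epsilon>, where 'a='a] bump_integral_pos[of \<epsilon>, where 'a='a]
  by (auto simp: mollifier_def[abs_def])

lemma mollifier_shift_integrable: "0 < \<epsilon> \<Longrightarrow> integrable lborel (\<lambda>y::'a::euclidean_space. mollifier \<epsilon> (y - x))"
  and mollifier_shift_integral: "0 < \<epsilon> \<Longrightarrow> (LINT y::'a::euclidean_space|lborel. mollifier \<epsilon> (y - x)) = 1"
  using lborel_integrable_translation[of "mollifier \<epsilon> :: 'a \<Rightarrow> real" "-x"] mollifier_integrable[of \<epsilon>, where 'a='a]
    lborel_integral_translation[of "mollifier \<epsilon> :: 'a \<Rightarrow> real" "-x"] mollifier_integral[of \<epsilon>, where 'a='a]
  by simp_all

lemma mollifier_test_function:
  fixes x :: "'a::euclidean_space"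
  assumes \<epsilon>: "0 < \<epsilon>" and sub: "cball x \<epsilon> \<subseteq> \<Omega>"
  shows "(\<lambda>y. mollifier \<epsilon> (y - x)) \<in> test_functions \<Omega>"
proof -
  have C: "C_k k (\<lambda>y. mollifier \<epsilon> (y - x))" for k
    using C_k_mult[OF C_k_bump[of k \<epsilon> x] C_k_const[of k "1 / (LINT y::'a|lborel. bump \<epsilon> y)"]]
    by (simp add: mollifier_def)
  have "closure {y. mollifier \<epsilon> (y - x) \<noteq> 0} \<subseteq> cball x \<epsilon>"
    using mollifier_eq_0[OF \<epsilon>] by (intro closure_minimal) (force simp: dist_norm norm_minus_commute not_less[symmetric])+
  moreover from this have "compact (closure {y. mollifier \<epsilon> (y - x) \<noteq> 0})"
    by (meson bounded_cball bounded_subset compact_closure closure_closed closed_closure compact_eq_bounded_closed)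
  ultimately show ?thesis
    using C sub by (auto simp: test_functions_def)
qed

text \<open>Convolution with the mollifier; as the latter is even, the order of the difference does not matter.\<close>

definition mollify :: "('a::euclidean_space \<Rightarrow> real) \<Rightarrow> real \<Rightarrow> 'a \<Rightarrow> real"
  where "mollify u \<epsilon> x = (LINT y|lborel. u y * mollifier \<epsilon> (y - x))"

context
  fixes u :: "'a::euclidean_space \<Rightarrow> real" and s :: real
  assumes s: "0 < s" and u_meas [measurable]: "u \<in> borel_measurable borel"
    and u: "integrable lborel (\<lambda>y. u y * tail_weight s y)"
begin

lemma mollify_integrable: "0 < \<epsilon> \<Longrightarrow> integrable lborel (\<lambda>y. u y * mollifier \<epsilon> (y - x))"
proof (rule integrable_locally[OF s _ _ u])
  assume \<epsilon>: "0 < \<epsilon>"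
  show "\<bar>mollifier \<epsilon> (y - x)\<bar> \<le> 1 / (LINT y::'a|lborel. bump \<epsilon> y)" for y
    by (rule mollifier_bounded[OF \<epsilon>])
  show "mollifier \<epsilon> (y - x) = 0" if "norm x + \<epsilon> \<le> norm y" for y
    using that norm_triangle_ineq2[of y x] by (intro mollifier_eq_0[OF \<epsilon>]) auto
qed auto

lemma mollify_measurable: "mollify u \<epsilon> \<in> borel_measurable borel"
  unfolding mollify_def[abs_def] by measurable

lemma mollify_continuous:
  assumes \<epsilon>: "0 < \<epsilon>"
  shows "continuous_on UNIV (mollify u \<epsilon>)"
proof (rule continuous_at_imp_continuous_on, rule ballI)
  fix x :: 'a
  show "isCont (mollify u \<epsilon>) x"
  proof (rule continuous_at_sequentiallyI)
    fix X :: "nat \<Rightarrow> 'a" assume X: "X \<longlonglongrightarrow> x"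
    then obtain b where b: "\<And>n. norm (X n) \<le> b"
      using convergent_imp_Bseq by (metis Bseq_def convergent_def)
    define N where "N = 1 / (LINT y::'a|lborel. bump \<epsilon> y)"
    show "(\<lambda>n. mollify u \<epsilon> (X n)) \<longlonglongrightarrow> mollify u \<epsilon> x"
      unfolding mollify_def
    proof (rule integral_dominated_convergence)
      have "integrable lborel (\<lambda>y. u y * (N * indicator (ball 0 (b + \<epsilon>)) y))"
        by (rule integrable_locally[OF s _ _ u, of _ "\<bar>N\<bar>" "b + \<epsilon>"])
           (auto simp: indicator_def intro: borel_measurable_indicator)
      then show "integrable lborel (\<lambda>y. \<bar>u y * (N * indicator (ball 0 (b + \<epsilon>)) y)\<bar>)"
        by (rule integrable_abs)
      show "AE y in lborel. (\<lambda>n. u y * mollifier \<epsilon> (y - X n)) \<longlonglongrightarrow> u y * mollifier \<epsilon> (y - x)"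
        by (intro AE_I2 tendsto_intros X continuous_on_tendsto_compose[OF mollifier_continuous[OF \<epsilon>]]) auto
      fix n
      have "\<bar>mollifier \<epsilon> (y - X n)\<bar> \<le> \<bar>N * indicator (ball 0 (b + \<epsilon>)) y\<bar>" for y
      proof (cases "norm y < b + \<epsilon>")
        case True
        then show ?thesis using mollifier_bounded[OF \<epsilon>, of "y - X n"] bump_integral_pos[OF \<epsilon>, where 'a='a] by (simp add: N_def)
      next
        case False
        then have "\<epsilon> \<le> norm (y - X n)" using b[of n] norm_triangle_ineq2[of y "X n"] by linarith
        then show ?thesis using \<epsilon> by (simp add: mollifier_eq_0)
      qed
      then show "AE y in lborel. norm (u y * mollifier \<epsilon> (y - X n)) \<le> \<bar>u y * (N * indicator (ball 0 (b + \<epsilon>)) y)\<bar>"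
        by (auto simp: abs_mult intro!: mult_left_mono)
    qed auto
  qed
qed

lemma mollify_ge:
  assumes \<epsilon>: "0 < \<epsilon>" and ge: "AE y in lborel. y \<in> ball x \<epsilon> \<longrightarrow> a \<le> u y"
  shows "a \<le> mollify u \<epsilon> x"
proof -
  have "a = (LINT y|lborel. a * mollifier \<epsilon> (y - x))"
    using mollifier_shift_integral[OF \<epsilon>, of x] by simp
  also have "\<dots> \<le> (LINT y|lborel. u y * mollifier \<epsilon> (y - x))"
  proof (rule integral_mono_AE)
    show "AE y in lborel. a * mollifier \<epsilon> (y - x) \<le> u y * mollifier \<epsilon> (y - x)"
      using ge
    proof eventually_elim
      case (elim y)
      then show ?case
        using mollifier_nonneg[OF \<epsilon>, of "y - x"] mollifier_eq_0[OF \<epsilon>, of "y - x"]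
        by (cases "norm (y - x) < \<epsilon>") (auto simp: dist_norm norm_minus_commute intro!: mult_right_mono)
    qed
  qed (use mollify_integrable[OF \<epsilon>] mollifier_shift_integrable[OF \<epsilon>] in auto)
  finally show ?thesis by (simp add: mollify_def)
qed

lemma mollify_correlation: "mollify u \<epsilon> (x - z) = (LINT y|lborel. u y * mollifier \<epsilon> (y + z - x))"
  by (simp add: mollify_def algebra_simps)

end

lemma ball_disjoint_compact:
  fixes K :: "'a::euclidean_space set"
  assumes "compact K" "x \<notin> K"
  shows "\<exists>e>0. ball x e \<inter> K = {}"
  using assms by (meson compact_imp_closed open_Compl open_contains_ball ComplI disjoint_eq_subset_Compl)

text \<open>If \<open>u \<le> a - 2 * \<kappa>\<close> on a set of positive measure, choose a compact subset \<open>K\<close> of positive measure and integrate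
the mollification over \<open>K\<close>. By Fubini this tests \<open>u\<close> against the mollified indicator \<open>g\<close> of \<open>K\<close>. Now \<open>g\<close>
takes values between \<open>0\<close> and \<open>1\<close>, has total mass equal to the measure of \<open>K\<close>, and tends to zero off \<open>K\<close>.
Its mass therefore concentrates on \<open>K\<close>, where \<open>u\<close> is too small.\<close>

lemma AE_ge_of_mollify:
  fixes u :: "'a::euclidean_space \<Rightarrow> real"
  assumes s: "0 < s" and u_meas [measurable]: "u \<in> borel_measurable borel"
    and u: "integrable lborel (\<lambda>y. u y * tail_weight s y)"
    and A [measurable]: "A \<in> sets borel"
    and lim: "\<And>\<kappa>. 0 < \<kappa> \<Longrightarrow> \<exists>\<epsilon>0>0. \<forall>\<epsilon>. 0 < \<epsilon> \<and> \<epsilon> < \<epsilon>0 \<longrightarrow> (\<forall>x\<in>A. a - \<kappa> \<le> mollify u \<epsilon> x)"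
  shows "AE x in lborel. x \<in> A \<longrightarrow> a \<le> u x"
proof -
  have *: "emeasure lborel ({x\<in>A. u x \<le> a - 2 * \<kappa>} \<inter> cball 0 N) = 0" (is "emeasure lborel ?E = 0") if \<kappa>: "0 < \<kappa>" for \<kappa> N
  proof (rule ccontr)
    assume nz: "emeasure lborel ?E \<noteq> 0"
    have E [measurable]: "?E \<in> sets borel" by measurable
    have E': "?E \<in> lmeasurable"
      by (rule bounded_set_imp_lmeasurable[OF bounded_subset[OF bounded_cball[of 0 N]]]) (use E in auto)
    have pos: "0 < measure lebesgue ?E"
    proof -
      have "ennreal (measure lebesgue ?E) \<noteq> 0"
        using nz E emeasure_eq_measure2[OF E'] by simp
      then show ?thesis using measure_nonneg[of lebesgue ?E] by (simp add: less_le)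
    qed
    from sets_lebesgue_inner_closed[OF fmeasurableD[OF E'] pos]
    obtain K where K: "closed K" "K \<subseteq> ?E" "?E - K \<in> lmeasurable" "emeasure lebesgue (?E - K) < ennreal (measure lebesgue ?E)" .
    have "bounded K"
      by (rule bounded_subset[OF bounded_cball[of 0 N]]) (use K(2) in auto)
    with K(1) have "compact K" by (simp add: compact_eq_bounded_closed)
    have [measurable]: "K \<in> sets borel" using K(1) by (rule borel_closed)
    define k where "k = measure lborel K"
    have "0 < k"
    proof (rule ccontr)
      assume "\<not> 0 < k"
      then have "measure lebesgue K = 0" using measure_nonneg[of lborel K] by (simp add: k_def)
      moreover have "K \<in> lmeasurable" using \<open>compact K\<close> by (rule lmeasurable_compact)
      ultimately have "measure lebesgue (?E - K) = measure lebesgue ?E"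
        using E' K(2) by (subst measurable_measure_Diff) (auto simp: fmeasurableD)
      with K(4) emeasure_eq_measure2[OF K(3)] show False by simp
    qed
    from lim[OF \<kappa>] obtain \<epsilon>0 where \<epsilon>0: "0 < \<epsilon>0"
      "\<And>\<epsilon> x. 0 < \<epsilon> \<Longrightarrow> \<epsilon> < \<epsilon>0 \<Longrightarrow> x \<in> A \<Longrightarrow> a - \<kappa> \<le> mollify u \<epsilon> x" by blast
    define R where "R = \<bar>N\<bar> + 1"
    have KN: "norm x \<le> \<bar>N\<bar>" if "x \<in> K" for x using K(2) that by auto
    define bx where "bx = (indicator (ball 0 R) :: 'a \<Rightarrow> real)"
    have [measurable]: "bx \<in> borel_measurable borel" unfolding bx_def by (intro borel_measurable_indicator) simp
    have bx_int: "integrable lborel bx"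
      unfolding bx_def using emeasure_lborel_ball_finite[of "0::'a" R] by (intro integrable_real_indicator) auto
    define f where "f y = (u y - (a - \<kappa>)) * bx y" for y
    have [measurable]: "f \<in> borel_measurable borel" by (simp add: f_def[abs_def])
    have ubx_int: "integrable lborel (\<lambda>y. u y * bx y)"
      by (rule integrable_locally[OF s _ _ u, of _ 1 R]) (auto simp: bx_def intro: borel_measurable_indicator)
    have f_int: "integrable lborel f"
      using ubx_int bx_int by (simp add: f_def[abs_def] left_diff_distrib)
    define g where "g \<epsilon> y = (LINT x|lborel. indicator K x * mollifier \<epsilon> (y - x))" for \<epsilon> y
    have g_meas [measurable]: "g \<epsilon> \<in> borel_measurable borel" for \<epsilon>
      unfolding g_def[abs_def] by measurable
    have K_int: "integrable lborel (indicator K :: 'a \<Rightarrow> real)"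
      using emeasure_lborel_cball_finite[of "0::'a" N] K(2)
      by (intro integrable_real_indicator) (auto intro: le_less_trans[OF emeasure_mono[of K "cball 0 N" lborel]])
    have even: "mollifier \<epsilon> (y - x) = mollifier \<epsilon> (x - y)" if "0 < \<epsilon>" for \<epsilon> and x y :: 'a
      by (rule mollifier_cong[OF that]) (rule norm_minus_commute)
    have gK_int: "integrable lborel (\<lambda>x. indicator K x * mollifier \<epsilon> (y - x))" if "0 < \<epsilon>" for \<epsilon> and y :: 'a
      using integrable_bounded_times[OF mollifier_shift_integrable[OF that, of y], of "indicator K" 1]
      by (simp add: even[OF that, of y] indicator_def)
    have g_nonneg: "0 \<le> g \<epsilon> y" if "0 < \<epsilon>" for \<epsilon> y
      unfolding g_def by (intro Bochner_Integration.integral_nonneg mult_nonneg_nonneg mollifier_nonneg that) auto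
    have g_le_1: "g \<epsilon> y \<le> 1" if "0 < \<epsilon>" for \<epsilon> y
    proof -
      have "g \<epsilon> y \<le> (LINT x|lborel. mollifier \<epsilon> (x - y))"
        unfolding g_def
      proof (rule integral_mono[OF gK_int[OF that] mollifier_shift_integrable[OF that]])
        show "indicator K x * mollifier \<epsilon> (y - x) \<le> mollifier \<epsilon> (x - y)" for x
          using mollifier_nonneg[OF that, of "x - y"] even[OF that, of y x] by (cases "x \<in> K") auto
      qed
      then show ?thesis using mollifier_shift_integral[OF that, of y] by simp
    qed
    have g_0: "g \<epsilon> y = 0" if "0 < \<epsilon>" "ball y \<epsilon> \<inter> K = {}" for \<epsilon> y
    proof -
      have "indicator K x * mollifier \<epsilon> (y - x) = 0" for x
      proof (cases "x \<in> K")
        case True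
        then have "\<epsilon> \<le> norm (y - x)" using that(2) by (auto simp: dist_norm not_less[symmetric])
        then show ?thesis using mollifier_eq_0[OF that(1), of "y - x"] by simp
      qed simp
      then have "g \<epsilon> y = (LINT x::'a|lborel. 0)"
        unfolding g_def by (intro Bochner_Integration.integral_cong refl)
      then show ?thesis by simp
    qed
    have Fub: "(LINT x|lborel. indicator K x * (LINT y|lborel. w y * mollifier \<epsilon> (y - x))) = (LINT y|lborel. w y * g \<epsilon> y)"
      and wg_int: "integrable lborel (\<lambda>y. w y * g \<epsilon> y)"
      if \<epsilon>: "0 < \<epsilon>" and w: "integrable lborel w" and [measurable]: "w \<in> borel_measurable borel" for \<epsilon> w
    proof -
      define B where "B = 1 / (LINT y::'a|lborel. bump \<epsilon> y)"
      have "integrable (lborel \<Otimes>\<^sub>M lborel) (\<lambda>(x, y). indicator K x * (B * \<bar>w y\<bar>))"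
        using K_int w by (intro lborel_pair.Fubini_integrable) (auto simp: abs_mult)
      then have P: "integrable (lborel \<Otimes>\<^sub>M lborel) (\<lambda>(x, y). indicator K x * (w y * mollifier \<epsilon> (y - x)))"
      proof (rule Bochner_Integration.integrable_bound)
        have "\<bar>indicator K x * (w y * mollifier \<epsilon> (y - x))\<bar> \<le> \<bar>indicator K x * (B * \<bar>w y\<bar>)\<bar>" for x y
          using mult_left_mono[OF mollifier_bounded[OF \<epsilon>, of "y - x"], of "\<bar>w y\<bar>"] bump_integral_pos[OF \<epsilon>, where 'a='a]
          by (auto simp: B_def abs_mult indicator_def mult_ac)
        then show "AE p in lborel \<Otimes>\<^sub>M lborel. norm (case p of (x, y) \<Rightarrow> indicator K x * (w y * mollifier \<epsilon> (y - x)))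
           \<le> norm (case p of (x, y) \<Rightarrow> indicator K x * (B * \<bar>w y\<bar>))"
          by (auto intro!: AE_I2)
      qed measurable
      have 1: "(LINT y|lborel. indicator K x * (w y * mollifier \<epsilon> (y - x))) = indicator K x * (LINT y|lborel. w y * mollifier \<epsilon> (y - x))" for x
        by simp
      have 2: "(LINT x|lborel. indicator K x * (w y * mollifier \<epsilon> (y - x))) = w y * g \<epsilon> y" for y
        unfolding g_def by (simp add: mult.left_commute[of _ "w y"])
      show "(LINT x|lborel. indicator K x * (LINT y|lborel. w y * mollifier \<epsilon> (y - x))) = (LINT y|lborel. w y * g \<epsilon> y)"
        using lborel_pair.Fubini_integral[OF P] by (simp only: 1 2)
      show "integrable lborel (\<lambda>y. w y * g \<epsilon> y)"
        using lborel_pair.integrable_snd[OF P] by (simp only: 2)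
    qed
    \<comment> \<open>\<open>h\<close> dominates the part of the tested integral that lies off \<open>K\<close>.\<close>
    define h where "h \<epsilon> y = (\<bar>f y\<bar> + \<kappa> * bx y) * (indicator (- K) y * g \<epsilon> y)" for \<epsilon> y
    have h_int: "integrable lborel (h \<epsilon>)" if \<epsilon>: "0 < \<epsilon>" for \<epsilon>
    proof -
      have "integrable lborel (\<lambda>y. ((\<bar>f y\<bar> + \<kappa> * bx y) * indicator (- K) y) * g \<epsilon> y)"
      proof (rule wg_int[OF \<epsilon>])
        have "integrable lborel (\<lambda>y. \<bar>f y\<bar> + \<kappa> * bx y)" using f_int bx_int by simp
        from integrable_bounded_times[OF this, of "indicator (- K)" 1]
        show "integrable lborel (\<lambda>y. (\<bar>f y\<bar> + \<kappa> * bx y) * indicator (- K) y)"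
          by (simp add: mult.commute indicator_def)
      qed measurable
      then show ?thesis by (simp add: h_def[abs_def] mult.assoc)
    qed
    have key: "\<kappa> * k \<le> (LINT y|lborel. h \<epsilon> y)" if \<epsilon>: "0 < \<epsilon>" "\<epsilon> < \<epsilon>0" "\<epsilon> < 1" for \<epsilon>
    proof -
      have bx1: "bx y * mollifier \<epsilon> (y - x) = mollifier \<epsilon> (y - x)" if "x \<in> K" for x y
      proof (cases "norm y < R")
        case False
        then have "\<epsilon> \<le> norm (y - x)"
          using KN[OF that] norm_triangle_ineq2[of y x] \<epsilon>(3) by (simp add: R_def)
        then show ?thesis using mollifier_eq_0[OF \<epsilon>(1), of "y - x"] by simp
      qed (simp add: bx_def)
      have "0 \<le> (LINT x|lborel. indicator K x * (LINT y|lborel. f y * mollifier \<epsilon> (y - x)))"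
      proof (intro Bochner_Integration.integral_nonneg)
        fix x
        show "0 \<le> indicator K x * (LINT y|lborel. f y * mollifier \<epsilon> (y - x))"
        proof (cases "x \<in> K")
          case True
          have "f y * mollifier \<epsilon> (y - x) = u y * mollifier \<epsilon> (y - x) - (a - \<kappa>) * mollifier \<epsilon> (y - x)" for y
            using bx1[OF True, of y] by (cases "mollifier \<epsilon> (y - x) = 0") (simp_all add: f_def algebra_simps)
          then have "(LINT y|lborel. f y * mollifier \<epsilon> (y - x)) = mollify u \<epsilon> x - (a - \<kappa>)"
            using mollify_integrable[OF s u_meas u \<epsilon>(1), of x] mollifier_shift_integrable[OF \<epsilon>(1), of x]
              mollifier_shift_integral[OF \<epsilon>(1), of x]
            by (simp add: mollify_def)
          then show ?thesis using \<epsilon>0(2)[OF \<epsilon>(1,2), of x] True K(2) by auto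
        qed simp
      qed
      also have "\<dots> = (LINT y|lborel. f y * g \<epsilon> y)"
        by (rule Fub[OF \<epsilon>(1) f_int]) simp
      also have "\<dots> \<le> (LINT y|lborel. h \<epsilon> y - \<kappa> * (bx y * g \<epsilon> y))"
      proof (rule integral_mono)
        show "f y * g \<epsilon> y \<le> h \<epsilon> y - \<kappa> * (bx y * g \<epsilon> y)" for y
        proof (cases "y \<in> K")
          case True
          then have "bx y = 1" "u y \<le> a - 2 * \<kappa>"
            using K(2) KN[OF True] by (auto simp: bx_def R_def)
          then have "f y * g \<epsilon> y \<le> - \<kappa> * g \<epsilon> y"
            using g_nonneg[OF \<epsilon>(1)] by (intro mult_right_mono) (auto simp: f_def)
          then show ?thesis using True \<open>bx y = 1\<close> by (simp add: h_def)
        next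
          case False
          have "f y * g \<epsilon> y \<le> \<bar>f y\<bar> * g \<epsilon> y"
            using g_nonneg[OF \<epsilon>(1)] by (intro mult_right_mono) auto
          then show ?thesis using False by (simp add: h_def algebra_simps)
        qed
        show "integrable lborel (\<lambda>y. f y * g \<epsilon> y)" by (rule wg_int[OF \<epsilon>(1) f_int]) simp
        have "integrable lborel (\<lambda>y. bx y * g \<epsilon> y)" by (rule wg_int[OF \<epsilon>(1) bx_int]) simp
        then show "integrable lborel (\<lambda>y. h \<epsilon> y - \<kappa> * (bx y * g \<epsilon> y))"
          using h_int[OF \<epsilon>(1)] by simp
      qed
      also have "\<dots> = (LINT y|lborel. h \<epsilon> y) - \<kappa> * k"
      proof -
        have "(LINT y|lborel. bx y * g \<epsilon> y) = (LINT x|lborel. indicator K x * (LINT y|lborel. bx y * mollifier \<epsilon> (y - x)))"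
          by (rule Fub[OF \<epsilon>(1) bx_int, symmetric]) simp
        also have "\<dots> = (LINT x|lborel. indicator K x)"
        proof (rule Bochner_Integration.integral_cong[OF refl])
          show "indicator K x * (LINT y|lborel. bx y * mollifier \<epsilon> (y - x)) = (indicator K x :: real)" for x
            using mollifier_shift_integral[OF \<epsilon>(1), of x] by (cases "x \<in> K") (simp_all add: bx1)
        qed
        also have "\<dots> = k" by (simp add: k_def)
        finally show ?thesis
          using h_int[OF \<epsilon>(1)] wg_int[OF \<epsilon>(1) bx_int] by simp
      qed
      finally show ?thesis by simp
    qed
    define e where "e n = min (\<epsilon>0 / 2) (inverse (real (Suc (Suc n))))" for n
    have e: "0 < e n" "e n < \<epsilon>0" "e n < 1" for n
      using \<epsilon>0(1) by (auto simp: e_def min_less_iff_disj field_simps)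
    have inv: "(\<lambda>n. inverse (real (Suc (Suc n)))) \<longlonglongrightarrow> 0"
      using LIMSEQ_inverse_real_of_nat by (rule LIMSEQ_Suc)
    have e_lim: "e \<longlonglongrightarrow> 0"
    proof (rule tendsto_sandwich[OF _ _ tendsto_const inv])
      show "\<forall>\<^sub>F n in sequentially. 0 \<le> e n" using e(1) by (simp add: less_imp_le)
      show "\<forall>\<^sub>F n in sequentially. e n \<le> inverse (real (Suc (Suc n)))"
        unfolding e_def by (intro always_eventually allI min.cobounded2)
    qed
    have "(\<lambda>n. LINT y|lborel. h (e n) y) \<longlonglongrightarrow> (LINT y::'a|lborel. 0)"
    proof (rule integral_dominated_convergence)
      show "integrable lborel (\<lambda>y. \<bar>f y\<bar> + \<kappa> * bx y)" using f_int bx_int by simp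
      have bx0: "0 \<le> bx y" for y by (simp add: bx_def)
      show "AE y in lborel. norm (h (e n) y) \<le> \<bar>f y\<bar> + \<kappa> * bx y" for n
      proof (rule AE_I2)
        fix y
        have "indicator (- K) y * g (e n) y \<le> 1" "0 \<le> indicator (- K) y * g (e n) y"
          using g_le_1[OF e(1)] g_nonneg[OF e(1)] by (auto simp: indicator_def)
        then show "norm (h (e n) y) \<le> \<bar>f y\<bar> + \<kappa> * bx y"
          unfolding h_def using bx0[of y] \<kappa> by (simp add: abs_mult mult_left_le)
      qed
      show "AE y in lborel. (\<lambda>n. h (e n) y) \<longlonglongrightarrow> 0"
      proof (rule AE_I2)
        fix y
        show "(\<lambda>n. h (e n) y) \<longlonglongrightarrow> 0"
        proof (cases "y \<in> K")
          case False
          then obtain d where d: "0 < d" "ball y d \<inter> K = {}"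
            using ball_disjoint_compact[OF \<open>compact K\<close>] by blast
          have "\<forall>\<^sub>F n in sequentially. e n < d"
            using e_lim d(1) by (rule order_tendstoD(2))
          then have "\<forall>\<^sub>F n in sequentially. h (e n) y = 0"
          proof eventually_elim
            case (elim n)
            then have "ball y (e n) \<inter> K = {}" using d(2) subset_ball[of "e n" d y] by auto
            then show ?case using g_0[OF e(1)] by (simp add: h_def)
          qed
          then show ?thesis by (rule tendsto_eventually)
        qed (simp add: h_def)
      qed
    qed (auto simp: h_def)
    then have "(\<lambda>n. LINT y|lborel. h (e n) y) \<longlonglongrightarrow> 0" by simp
    then have "\<kappa> * k \<le> 0"
      by (rule LIMSEQ_le_const) (use key e in blast)
    then show False using \<kappa> \<open>0 < k\<close> by (simp add: mult_le_0_iff)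
  qed
  have "AE x in lborel. \<forall>j n. x \<notin> {x\<in>A. u x \<le> a - 2 * inverse (real (Suc j))} \<inter> cball 0 (real n)"
    unfolding AE_all_countable
  proof (intro allI)
    fix j n
    show "AE x in lborel. x \<notin> {x\<in>A. u x \<le> a - 2 * inverse (real (Suc j))} \<inter> cball 0 (real n)"
      using *[of "inverse (real (Suc j))" "real n"] by (intro AE_not_in) (auto simp: null_sets_def)
  qed
  then show ?thesis
  proof eventually_elim
    case (elim x)
    show ?case
    proof (rule impI, rule ccontr)
      assume x: "x \<in> A" and "\<not> a \<le> u x"
      then have "0 < (a - u x) / 2" by simp
      then obtain j where "inverse (real (Suc j)) < (a - u x) / 2" using reals_Archimedean by blast
      moreover obtain n where "norm x \<le> real n" using real_arch_simple by blast
      ultimately have "x \<in> {x\<in>A. u x \<le> a - 2 * inverse (real (Suc j))} \<inter> cball 0 (real n)"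
        using x by simp
      with elim show False by blast
    qed
  qed
qed

section \<open>The barrier at the puncture\<close>

definition regularised_sq :: "real \<Rightarrow> 'a::euclidean_space \<Rightarrow> real"
  where "regularised_sq \<eta> x = (norm x)\<^sup>2 + \<eta>\<^sup>2"

text \<open>Minus the logarithm is the fundamental superharmonic singularity in the plane and remains superharmonic
in every higher dimension; the small power makes its Laplacian strictly negative. Regularising the squared
norm keeps everything smooth at the origin.\<close>

definition barrier :: "real \<Rightarrow> real \<Rightarrow> 'a::euclidean_space \<Rightarrow> real"
  where "barrier p \<eta> x = - ln (regularised_sq \<eta> x) - regularised_sq \<eta> x powr p"

lemma regularised_sq_pos: "0 < \<eta> \<Longrightarrow> 0 < regularised_sq \<eta> x"
  by (simp add: regularised_sq_def add_nonneg_pos)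

lemma regularised_sq_add: "regularised_sq \<eta> (x + z) = regularised_sq \<eta> x + 2 * (x \<bullet> z) + (norm z)\<^sup>2"
  by (simp add: regularised_sq_def power2_norm_eq_inner inner_add_left inner_add_right inner_commute)

lemma barrier_continuous: "0 < \<eta> \<Longrightarrow> continuous_on A (barrier p \<eta>)"
  unfolding barrier_def regularised_sq_def
  by (intro continuous_intros ballI) (auto simp: add_nonneg_pos less_imp_neq[THEN not_sym])

lemma barrier_measurable [measurable]: "barrier p \<eta> \<in> borel_measurable borel"
  unfolding barrier_def[abs_def] regularised_sq_def[abs_def] by measurable

lemma barrier_second_difference_lim:
  fixes x e :: "'a::euclidean_space"
  assumes \<eta>: "0 < \<eta>" and e: "e \<in> Basis"
  defines "q \<equiv> regularised_sq \<eta> x"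
  shows "((\<lambda>h. (barrier p \<eta> (x + h *\<^sub>R e) + barrier p \<eta> (x - h *\<^sub>R e) - 2 * barrier p \<eta> x) / h\<^sup>2)
    \<longlongrightarrow> 4 * (x \<bullet> e)\<^sup>2 * (1 / q\<^sup>2 + p * (1 - p) * q powr (p - 2)) + 2 * (- 1 / q - p * q powr (p - 1))) (at 0)"
proof -
  define Q where "Q t = q + 2 * t * (x \<bullet> e) + t\<^sup>2" for t
  have Q: "regularised_sq \<eta> (x + t *\<^sub>R e) = Q t" for t
    using e by (simp add: Q_def q_def regularised_sq_add power2_eq_square[of t])
  have Qpos: "0 < Q t" for t
    using regularised_sq_pos[OF \<eta>] by (simp add: Q[symmetric])
  have dQ: "(Q has_real_derivative (2 * (x \<bullet> e) + 2 * t)) (at t)" for t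
    unfolding Q_def by (auto intro!: derivative_eq_intros)
  define g' where "g' t = (- 1 / Q t - p * Q t powr (p - 1)) * (2 * (x \<bullet> e) + 2 * t)" for t
  define g'' where "g'' t = (1 / (Q t)\<^sup>2 + p * (1 - p) * Q t powr (p - 2)) * (2 * (x \<bullet> e) + 2 * t)\<^sup>2
      + 2 * (- 1 / Q t - p * Q t powr (p - 1))" for t
  have g: "((\<lambda>t. - ln (Q t) - Q t powr p) has_real_derivative g' t) (at t)" for t
    unfolding g'_def using Qpos[of t]
    by (auto intro!: derivative_eq_intros dQ simp: field_simps)
  have g': "(g' has_real_derivative g'' t) (at t)" for t
    unfolding g'_def g''_def using Qpos[of t]
    by (auto intro!: derivative_eq_intros dQ simp: field_simps power2_eq_square)
  have "isCont g'' 0"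
    unfolding g''_def using Qpos[of 0] DERIV_isCont[OF dQ, of 0]
    by (intro continuous_intros) auto
  from second_difference_tendsto[OF g g' this]
  have "((\<lambda>h. (barrier p \<eta> (x + h *\<^sub>R e) + barrier p \<eta> (x + (- h) *\<^sub>R e) - 2 * barrier p \<eta> (x + 0 *\<^sub>R e)) / h\<^sup>2) \<longlongrightarrow> g'' 0) (at 0)"
    unfolding barrier_def Q .
  moreover have "g'' 0 = 4 * (x \<bullet> e)\<^sup>2 * (1 / q\<^sup>2 + p * (1 - p) * q powr (p - 2)) + 2 * (- 1 / q - p * q powr (p - 1))"
    by (simp add: g''_def Q_def power2_eq_square)
  ultimately show ?thesis by simp
qed

text \<open>The left-hand side is the sum over the axes of the limits in \<open>barrier_second_difference_lim\<close>, that is,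
the Laplacian. The logarithmic contributions cancel when the dimension is two and \<open>|x|^2\<close> is replaced by
the larger \<open>q\<close>; what is left is the contribution of the power.\<close>

lemma barrier_laplacian_le:
  fixes x :: "'a::euclidean_space"
  assumes \<eta>: "0 < \<eta>" and p: "0 < p" "p \<le> 1" and dim: "2 \<le> DIM('a)"
  defines "q \<equiv> regularised_sq \<eta> x"
  shows "(\<Sum>e\<in>Basis. 4 * (x \<bullet> e)\<^sup>2 * (1 / q\<^sup>2 + p * (1 - p) * q powr (p - 2)) + 2 * (- 1 / q - p * q powr (p - 1)))
    \<le> - 4 * p\<^sup>2 * q powr (p - 1)"
proof -
  have q: "0 < q" unfolding q_def by (rule regularised_sq_pos[OF \<eta>])
  have "(norm x)\<^sup>2 \<le> q" by (simp add: q_def regularised_sq_def)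
  have "(\<Sum>e\<in>Basis. 4 * (x \<bullet> e)\<^sup>2 * (1 / q\<^sup>2 + p * (1 - p) * q powr (p - 2)) + 2 * (- 1 / q - p * q powr (p - 1)))
     = 4 * (norm x)\<^sup>2 * (1 / q\<^sup>2 + p * (1 - p) * q powr (p - 2)) - real DIM('a) * (2 * (1 / q + p * q powr (p - 1)))"
    unfolding sum.distrib power2_norm_eq_inner euclidean_inner[of x x] sum_distrib_left sum_distrib_right
    by (simp add: power2_eq_square algebra_simps)
  also have "\<dots> \<le> 4 * q * (1 / q\<^sup>2 + p * (1 - p) * q powr (p - 2)) - 2 * (2 * (1 / q + p * q powr (p - 1)))"
    using \<open>(norm x)\<^sup>2 \<le> q\<close> p q dim
    by (intro diff_mono mult_right_mono mult_left_mono add_nonneg_nonneg mult_nonneg_nonneg) auto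
  also have "4 * q * (1 / q\<^sup>2 + p * (1 - p) * q powr (p - 2)) = 4 / q + 4 * p * (1 - p) * q powr (p - 1)"
    using q powr_mult_base[of q "p - 2"] by (simp add: field_simps power2_eq_square)
  also have "4 / q + 4 * p * (1 - p) * q powr (p - 1) - 2 * (2 * (1 / q + p * q powr (p - 1))) = - 4 * p\<^sup>2 * q powr (p - 1)"
    by (simp add: algebra_simps power2_eq_square)
  finally show ?thesis .
qed

text \<open>With \<open>a\<close>, \<open>b\<close> the regularised squared norms at \<open>x + z\<close> and \<open>x - z\<close> one has
\<open>a * b \<ge> (q - |z|^2)^2\<close>. The logarithms depend on the product only, and the arithmetic-geometric
mean inequality reduces the powers to the product as well.\<close>

lemma barrier_second_difference_le:
  fixes x z :: "'a::euclidean_space"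
  assumes \<eta>: "0 < \<eta>" and p: "0 < p" "p \<le> 1" and z: "(norm z)\<^sup>2 \<le> regularised_sq \<eta> x / 16"
  defines "q \<equiv> regularised_sq \<eta> x"
  shows "barrier p \<eta> (x + z) + barrier p \<eta> (x - z) - 2 * barrier p \<eta> x \<le> (4 + 2 * q powr p) / q * (norm z)\<^sup>2"
proof -
  define a b w t where "a = regularised_sq \<eta> (x + z)" and "b = regularised_sq \<eta> (x - z)"
    and "w = (norm z)\<^sup>2" and "t = w / q"
  have pos: "0 < q" "0 < a" "0 < b" unfolding q_def a_def b_def by (rule regularised_sq_pos[OF \<eta>])+
  have t: "0 \<le> t" "t \<le> 1 / 16" and qt: "q - w = q * (1 - t)"
    using z pos by (auto simp: t_def w_def q_def field_simps)
  have ab: "(q - w)\<^sup>2 \<le> a * b"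
  proof -
    have a: "a = q + w + 2 * (x \<bullet> z)" and b: "b = q + w - 2 * (x \<bullet> z)"
      using regularised_sq_add[of \<eta> x "z"] regularised_sq_add[of \<eta> x "- z"]
      by (simp_all add: a_def b_def q_def w_def)
    have "(x \<bullet> z)\<^sup>2 \<le> (norm x)\<^sup>2 * w"
      using Cauchy_Schwarz_ineq[of x z] by (simp add: w_def power2_norm_eq_inner)
    also have "\<dots> \<le> q * w"
      by (intro mult_right_mono) (auto simp: q_def regularised_sq_def w_def)
    finally show ?thesis
      unfolding a b by (simp add: power2_eq_square algebra_simps)
  qed
  have qw: "0 < q - w" using t pos by (simp add: qt)
  have "2 * ln (q - w) \<le> ln a + ln b"
  proof -
    have "2 * ln (q - w) = ln ((q - w)\<^sup>2)" using qw by (simp add: ln_realpow)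
    also have "\<dots> \<le> ln (a * b)" using ab qw pos by (intro ln_mono) auto
    finally show ?thesis using pos by (simp add: ln_mult)
  qed
  moreover have "ln q - 2 * t \<le> ln (q - w)"
  proof -
    have "ln (1 / (1 - t)) \<le> 1 / (1 - t) - 1"
      using t by (intro ln_le_minus_one) auto
    also have "\<dots> = t / (1 - t)" using t by (simp add: field_simps)
    also have "\<dots> \<le> t / (1 / 2)" using t by (intro divide_left_mono) auto
    finally have "- 2 * t \<le> ln (1 - t)" using t by (simp add: ln_div)
    then show ?thesis using pos t by (simp add: qt ln_mult)
  qed
  ultimately have L: "2 * ln q - ln a - ln b \<le> 4 * t" by linarith
  have "2 * (q powr p * (1 - t)) \<le> a powr p + b powr p"
  proof -
    have "1 - t \<le> (1 - t) powr p"
      using t p powr_mono'[of p 1 "1 - t"] by simp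
    then have "q powr p * (1 - t) \<le> (q - w) powr p"
      using t pos by (simp add: qt powr_mult)
    also have "(q - w) powr p = sqrt ((q - w) powr p * (q - w) powr p)" by simp
    also have "\<dots> = sqrt (((q - w)\<^sup>2) powr p)"
      using qw by (simp only: power2_eq_square powr_mult)
    also have "\<dots> \<le> sqrt ((a * b) powr p)"
      using ab p by (intro real_sqrt_le_mono powr_mono2) auto
    also have "\<dots> = sqrt (a powr p * b powr p)"
      using pos by (simp add: powr_mult)
    also have "\<dots> \<le> (a powr p + b powr p) / 2"
      by (rule arith_geo_mean_sqrt) auto
    finally show ?thesis by simp
  qed
  then have "2 * q powr p - a powr p - b powr p \<le> 2 * q powr p * t" by (simp add: algebra_simps)
  with L have "barrier p \<eta> (x + z) + barrier p \<eta> (x - z) - 2 * barrier p \<eta> x \<le> (4 + 2 * q powr p) * t"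
    by (simp add: barrier_def a_def[symmetric] b_def[symmetric] q_def[symmetric] algebra_simps)
  then show ?thesis by (simp add: t_def w_def)
qed

text \<open>The barrier decreases in the norm, so only points closer to the origin than the radius \<open>sqrt q\<close> count.
There the logarithm is traded for the integrable power \<open>norm y powr - (1/2)\<close>.\<close>

lemma barrier_diff_le:
  fixes x y :: "'a::euclidean_space"
  assumes \<eta>: "0 < \<eta>" and p: "0 < p" and y: "y \<noteq> 0"
  defines "q \<equiv> regularised_sq \<eta> x"
  shows "barrier p \<eta> y - barrier p \<eta> x
    \<le> indicator (ball 0 (sqrt q)) y * (4 * sqrt q powr (1/2) * norm y powr - (1/2) + q powr p)"
proof -
  have q: "0 < q" "0 < regularised_sq \<eta> y" unfolding q_def by (rule regularised_sq_pos[OF \<eta>])+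
  have yq: "(norm y)\<^sup>2 \<le> regularised_sq \<eta> y" by (simp add: regularised_sq_def)
  show ?thesis
  proof (cases "norm y < sqrt q")
    case True
    have ny: "0 < norm y" using y by simp
    have "ln (q / regularised_sq \<eta> y) \<le> ln (q / (norm y)\<^sup>2)"
      using q yq ny by (intro ln_mono) (auto intro!: divide_left_mono mult_pos_pos)
    also have "q / (norm y)\<^sup>2 = (sqrt q / norm y)\<^sup>2" using q by (simp add: power_divide)
    also have "ln \<dots> = 4 * ln ((sqrt q / norm y) powr (1/2))"
      using q ny by (simp add: ln_powr ln_realpow)
    also have "\<dots> \<le> 4 * (sqrt q / norm y) powr (1/2)"
      using q ny ln_le_minus_one[of "(sqrt q / norm y) powr (1/2)"] by simp
    also have "(sqrt q / norm y) powr (1/2) = sqrt q powr (1/2) * norm y powr - (1/2)"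
      using q ny by (simp add: powr_divide powr_minus_divide)
    finally have l: "ln q - ln (regularised_sq \<eta> y) \<le> 4 * sqrt q powr (1/2) * norm y powr - (1/2)"
      using q by (simp add: ln_div mult.assoc)
    have i: "indicator (ball 0 (sqrt q)) y = (1::real)" using True by simp
    have z: "0 \<le> regularised_sq \<eta> y powr p" by simp
    have "barrier p \<eta> y - barrier p \<eta> x = ln q - ln (regularised_sq \<eta> y) - regularised_sq \<eta> y powr p + q powr p"
      by (simp add: barrier_def q_def)
    with l z show ?thesis unfolding i mult_1_left by linarith
  next
    case False
    then have "q \<le> (norm y)\<^sup>2" using q real_le_lsqrt sqrt_le_D by (metis linorder_not_less)
    with yq have le: "q \<le> regularised_sq \<eta> y" by simp
    then have "ln q \<le> ln (regularised_sq \<eta> y)" "q powr p \<le> regularised_sq \<eta> y powr p"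
      using q p by (auto intro: powr_mono2)
    then show ?thesis using False by (simp add: barrier_def q_def[symmetric])
  qed
qed

text \<open>Below the radius where the two powers balance the stronger one wins; beyond it the weaker one is bounded.\<close>

lemma absorb_weaker_power:
  fixes A B a b :: real
  assumes "0 < A" "0 < B" "a < b" "0 \<le> a"
  obtains M where "\<And>q. 0 < q \<Longrightarrow> A * q powr - a \<le> B * q powr - b + M"
proof
  define q0 where "q0 = (B / A) powr (1 / (b - a))"
  have q0: "0 < q0" using assms by (simp add: q0_def)
  fix q :: real assume q: "0 < q"
  show "A * q powr - a \<le> B * q powr - b + A * q0 powr - a"
  proof (cases "q \<le> q0")
    case True
    have "q powr (b - a) \<le> q0 powr (b - a)" using True q assms by (intro powr_mono2) auto
    also have "\<dots> = B / A" using assms by (simp add: q0_def powr_powr)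
    finally have "A * q powr (b - a) \<le> B" using assms by (simp add: field_simps)
    then have "A * q powr (b - a) * q powr - b \<le> B * q powr - b" by (rule mult_right_mono) simp
    moreover have "q powr (b - a) * q powr - b = q powr - a" by (simp add: powr_add[symmetric])
    ultimately have "A * q powr - a \<le> B * q powr - b" by (simp add: mult.assoc)
    moreover have "0 \<le> A * q0 powr - a" using assms by simp
    ultimately show ?thesis by linarith
  next
    case False
    then have "q powr - a \<le> q0 powr - a" using q0 assms by (intro powr_mono2') auto
    then have "A * q powr - a \<le> A * q0 powr - a" using assms by simp
    moreover have "0 \<le> B * q powr - b" using assms by simp
    ultimately show ?thesis by linarith
  qed
qed

text \<open>The scale is \<open>\<tau> = sqrt q / 4\<close>, proportional to the regularised distance from the singularity. Within \<open>\<tau>\<close> the second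
difference \<open>|z|^2 / q\<close> is integrated against the kernel. Beyond \<open>\<tau>\<close> the kernel is at most
\<open>\<tau> powr - (n + 2 * s)\<close>, and the positive part of the increment is integrable over the ball of radius
\<open>sqrt q\<close>. Both contributions scale like \<open>q powr - s\<close>. The constant does not depend on \<open>\<eta>\<close> or on \<open>S\<close>.\<close>

lemma barrier_integral_le:
  assumes s: "0 < s" "s < 1" and dim: "2 \<le> DIM('a::euclidean_space)" and p: "0 < p" "p \<le> 1"
  obtains C where "0 < C" "\<And>(x::'a) \<eta> \<delta> S. 0 < \<eta> \<Longrightarrow> 0 < \<delta> \<Longrightarrow> \<delta> \<le> sqrt (regularised_sq \<eta> x) / 4 \<Longrightarrow>
      S \<in> sets borel \<Longrightarrow> bounded S \<Longrightarrow> ball x (sqrt (regularised_sq \<eta> x) / 4) \<subseteq> S \<Longrightarrow>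
      (LINT y|lborel. indicator S y * (barrier p \<eta> y - barrier p \<eta> x) * cut_kern s \<delta> (y - x))
        \<le> C * (1 + regularised_sq \<eta> x powr p) * regularised_sq \<eta> x powr - s"
proof -
  let ?n = "real DIM('a)" and ?N = "real DIM('a) + 2 * s" and ?\<omega> = "unit_ball_vol (real DIM('a))"
  obtain C2 where C2: "0 < C2" "\<And>\<tau>. 0 < \<tau> \<Longrightarrow>
    integrable lborel (\<lambda>z::'a. indicator (ball 0 \<tau>) z * ((norm z)\<^sup>2 * kern s z)) \<and>
    (LINT z::'a|lborel. indicator (ball 0 \<tau>) z * ((norm z)\<^sup>2 * kern s z)) \<le> C2 * \<tau> powr (2 - 2 * s)"
    using ball_second_moment[OF s(2) dim s(1)] by blast
  have "0 \<le> (1/2::real)" "1/2 < ?n" using dim by auto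
  from set_integral_norm_powr_inner[OF this] obtain C3 where C3: "0 < C3" "\<And>\<tau>. 0 < \<tau> \<Longrightarrow>
    set_integrable lborel (ball (0::'a) \<tau>) (\<lambda>z. norm z powr - (1/2)) \<and>
    (LINT z:ball (0::'a) \<tau>|lborel. norm z powr - (1/2)) \<le> C3 * \<tau> powr (?n - 1/2)" by blast
  define C where "C = 2 * C2 + 4 powr ?N * (4 * C3 + ?\<omega>)"
  have "0 < C" using C2 C3 by (auto simp: C_def intro!: add_pos_nonneg)
  moreover have "(LINT y|lborel. indicator S y * (barrier p \<eta> y - barrier p \<eta> x) * cut_kern s \<delta> (y - x))
      \<le> C * (1 + regularised_sq \<eta> x powr p) * regularised_sq \<eta> x powr - s"
    if \<eta>: "0 < \<eta>" and \<delta>: "0 < \<delta>" "\<delta> \<le> sqrt (regularised_sq \<eta> x) / 4"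
      and S [measurable]: "S \<in> sets borel" and bS: "bounded S"
      and sub: "ball x (sqrt (regularised_sq \<eta> x) / 4) \<subseteq> S" for x :: 'a and \<eta> \<delta> S
  proof -
    define q \<tau> where "q = regularised_sq \<eta> x" and "\<tau> = sqrt q / 4"
    have q: "0 < q" unfolding q_def by (rule regularised_sq_pos[OF \<eta>])
    have \<tau>: "0 < \<tau>" "\<delta> \<le> \<tau>" using q \<delta> by (auto simp: \<tau>_def q_def)
    have \<tau>2: "\<tau>\<^sup>2 = q / 16" using q by (simp add: \<tau>_def power_divide)
    define W where "W z = indicator S (x + z) * (barrier p \<eta> (x + z) - barrier p \<eta> x)" for z
    have W_meas [measurable]: "W \<in> borel_measurable borel" unfolding W_def by measurable
    obtain B where B: "\<And>z. \<bar>W z\<bar> \<le> B"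
    proof -
      have "compact (barrier p \<eta> ` closure S)"
        using bS by (intro compact_continuous_image barrier_continuous[OF \<eta>]) (simp add: compact_closure)
      then obtain b where b: "\<And>y. y \<in> closure S \<Longrightarrow> \<bar>barrier p \<eta> y\<bar> \<le> b"
        using compact_imp_bounded by (fastforce simp: bounded_iff)
      show ?thesis
      proof (rule that)
        fix z
        show "\<bar>W z\<bar> \<le> \<bar>b\<bar> + \<bar>barrier p \<eta> x\<bar>"
        proof (cases "x + z \<in> S")
          case True
          with b[of "x + z"] closure_subset[of S] have "\<bar>barrier p \<eta> (x + z)\<bar> \<le> b" by blast
          with True show ?thesis by (simp add: W_def)
        qed (simp add: W_def)
      qed
    qed
    have W_int: "integrable lborel (\<lambda>z. W z * cut_kern s \<rho> z)" if "0 < \<rho>" for \<rho>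
      by (rule integrable_bounded_times[OF cut_kern_integrable W_meas B]) (use s that in auto)
    define k where "k z = cut_kern s \<delta> z - cut_kern s \<tau> z" for z :: 'a
    have k_meas [measurable]: "k \<in> borel_measurable borel" unfolding k_def by measurable
    have Wk_int: "integrable lborel (\<lambda>z. W z * k z)"
      using W_int[OF \<delta>(1)] W_int[OF \<tau>(1)] by (simp add: k_def right_diff_distrib)

    \<comment> \<open>Inside radius \<open>\<tau>\<close> both \<open>x + z\<close> and \<open>x - z\<close> lie in \<open>S\<close>, so that the indicator does not destroy the symmetry.\<close>
    have "(LINT z|lborel. W z * k z) = (LINT z|lborel. (W z + W (- z)) * k z) / 2"
      by (rule integral_even_kernel(2)[OF Wk_int]) (auto simp: k_def)
    also have "(LINT z|lborel. (W z + W (- z)) * k z)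
        \<le> (LINT z::'a|lborel. (4 + 2 * q powr p) / q * (indicator (ball 0 \<tau>) z * ((norm z)\<^sup>2 * kern s z)))"
    proof (rule integral_mono)
      show "integrable lborel (\<lambda>z. (W z + W (- z)) * k z)"
        by (rule integral_even_kernel(1)[OF Wk_int]) (auto simp: k_def)
      show "integrable lborel (\<lambda>z::'a. (4 + 2 * q powr p) / q * (indicator (ball 0 \<tau>) z * ((norm z)\<^sup>2 * kern s z)))"
        using C2(2)[OF \<tau>(1)] by simp
      fix z :: 'a
      show "(W z + W (- z)) * k z \<le> (4 + 2 * q powr p) / q * (indicator (ball 0 \<tau>) z * ((norm z)\<^sup>2 * kern s z))"
      proof (cases "norm z < \<tau>")
        case True
        have zq: "(norm z)\<^sup>2 \<le> regularised_sq \<eta> x / 16"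
          using True \<tau> unfolding q_def[symmetric] \<tau>2[symmetric] by (intro power_mono) auto
        have "x + z \<in> S" "x - z \<in> S"
          using sub True by (auto simp: \<tau>_def q_def dist_norm)
        then have "W z + W (- z) = barrier p \<eta> (x + z) + barrier p \<eta> (x - z) - 2 * barrier p \<eta> x"
          by (simp add: W_def)
        also have "\<dots> \<le> (4 + 2 * q powr p) / q * (norm z)\<^sup>2"
          unfolding q_def by (rule barrier_second_difference_le[OF \<eta> p zq])
        finally have "(W z + W (- z)) * k z \<le> (4 + 2 * q powr p) / q * (norm z)\<^sup>2 * k z"
          using True by (intro mult_right_mono) (auto simp: k_def cut_kern_def)
        also have "\<dots> \<le> (4 + 2 * q powr p) / q * (norm z)\<^sup>2 * kern s z"
          using True q by (intro mult_left_mono) (auto simp: k_def cut_kern_def)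
        finally show ?thesis using True by (simp add: mult.assoc)
      qed (use \<tau> in \<open>auto simp: k_def cut_kern_def\<close>)
    qed
    also have "\<dots> \<le> (4 + 2 * q powr p) / q * (C2 * \<tau> powr (2 - 2 * s))"
      using C2(2)[OF \<tau>(1)] q by (subst integral_mult_right_zero) (intro mult_left_mono, auto)
    also have "\<tau> powr (2 - 2 * s) \<le> q powr (1 - s)"
    proof -
      have "\<tau> powr (2 - 2 * s) = (\<tau>\<^sup>2) powr (1 - s)"
        using \<tau> by (simp add: powr_realpow[symmetric] powr_powr algebra_simps del: powr_numeral)
      also have "\<dots> \<le> q powr (1 - s)"
        unfolding \<tau>2 using q s by (intro powr_mono2) auto
      finally show ?thesis .
    qed
    finally have near: "(LINT z|lborel. W z * k z) \<le> ((4 + 2 * q powr p) / q * (C2 * q powr (1 - s))) / 2"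
      using C2(1) q by (simp add: mult_left_mono divide_right_mono)
    have "((4 + 2 * q powr p) / q * (C2 * q powr (1 - s))) / 2 = C2 * (2 + q powr p) * q powr - s"
      using q by (simp add: powr_diff powr_minus field_simps)
    also have "\<dots> \<le> 2 * C2 * (1 + q powr p) * q powr - s"
      using C2(1) by (intro mult_right_mono) (auto simp: algebra_simps)
    finally have near: "(LINT z|lborel. W z * k z) \<le> 2 * C2 * (1 + q powr p) * q powr - s"
      using near by linarith

    \<comment> \<open>Dropping the negative part of the increment leaves the function \<open>G\<close> supported near the singularity.\<close>
    define G where "G y = indicator (ball (0::'a) (sqrt q)) y * (4 * sqrt q powr (1/2) * norm y powr - (1/2) + q powr p)" for y
    have [measurable]: "ball (0::'a) (sqrt q) \<in> sets borel" by simp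
    have G_meas [measurable]: "G \<in> borel_measurable borel" unfolding G_def by measurable
    have G_nonneg: "0 \<le> G y" for y by (simp add: G_def)
    have G1: "integrable lborel (\<lambda>y::'a. indicator (ball 0 (sqrt q)) y * norm y powr - (1/2))"
      "(LINT y::'a|lborel. indicator (ball 0 (sqrt q)) y * norm y powr - (1/2)) \<le> C3 * sqrt q powr (?n - 1/2)"
      using C3(2)[of "sqrt q"] q by (auto simp: set_integrable_def set_lebesgue_integral_def)
    have G2: "integrable lborel (\<lambda>y::'a. indicator (ball 0 (sqrt q)) y :: real)"
      "(LINT y::'a|lborel. indicator (ball 0 (sqrt q)) y :: real) = ?\<omega> * sqrt q powr ?n"
      using emeasure_lborel_ball_finite[of "0::'a" "sqrt q"] q content_ball[of "sqrt q" "0::'a"]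
      by (auto intro!: integrable_real_indicator simp: powr_realpow)
    have Geq: "G y = 4 * sqrt q powr (1/2) * (indicator (ball 0 (sqrt q)) y * norm y powr - (1/2))
        + q powr p * indicator (ball 0 (sqrt q)) y" for y
      by (simp add: G_def algebra_simps)
    have G_int: "integrable lborel G"
      unfolding Geq[abs_def] using G1(1) G2(1) by (intro Bochner_Integration.integrable_add integrable_mult_right)
    have "(LINT y|lborel. G y) \<le> 4 * sqrt q powr (1/2) * (C3 * sqrt q powr (?n - 1/2)) + q powr p * (?\<omega> * sqrt q powr ?n)"
      unfolding Geq using G1 G2 by (simp add: mult_left_mono)
    also have "\<dots> = sqrt q powr ?n * (4 * C3 + ?\<omega> * q powr p)"
    proof -
      have "sqrt q powr (1/2) * sqrt q powr (?n - 1/2) = sqrt q powr ?n" by (simp add: powr_add[symmetric])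
      then show ?thesis by (simp add: algebra_simps)
    qed
    also have "\<dots> \<le> sqrt q powr ?n * ((4 * C3 + ?\<omega>) * (1 + q powr p))"
      using C3(1) by (intro mult_left_mono) (auto simp: algebra_simps)
    finally have G_le: "(LINT y|lborel. G y) \<le> sqrt q powr ?n * ((4 * C3 + ?\<omega>) * (1 + q powr p))" .
    have "(LINT z|lborel. W z * cut_kern s \<tau> z) \<le> (LINT z|lborel. \<tau> powr - ?N * G (x + z))"
    proof (rule integral_mono_AE[OF W_int[OF \<tau>(1)]])
      show "integrable lborel (\<lambda>z. \<tau> powr - ?N * G (x + z))"
        using G_int lborel_integrable_translation[of G x] by simp
      have "AE z::'a in lborel. z \<noteq> - x" by (rule AE_lborel_singleton)
      then show "AE z in lborel. W z * cut_kern s \<tau> z \<le> \<tau> powr - ?N * G (x + z)"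
      proof eventually_elim
        case (elim z)
        then have "x + z \<noteq> 0" by (metis add.commute add_eq_0_iff minus_minus)
        have "W z \<le> G (x + z)"
          using barrier_diff_le[OF \<eta> p(1) \<open>x + z \<noteq> 0\<close>, of x] G_nonneg[of "x + z"]
          by (cases "x + z \<in> S") (auto simp: W_def G_def q_def)
        then have "W z * cut_kern s \<tau> z \<le> G (x + z) * cut_kern s \<tau> z" by (rule mult_right_mono) simp
        also have "\<dots> \<le> G (x + z) * \<tau> powr - ?N"
          using \<tau> s G_nonneg[of "x + z"] by (intro mult_left_mono) (auto simp: cut_kern_def kern_def intro!: powr_mono2')
        finally show ?case by (simp add: mult.commute)
      qed
    qed
    also have "\<dots> = \<tau> powr - ?N * (LINT y|lborel. G y)"
      using lborel_integral_translation[of G x] by simp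
    also have "\<dots> \<le> \<tau> powr - ?N * (sqrt q powr ?n * ((4 * C3 + ?\<omega>) * (1 + q powr p)))"
      using G_le by (intro mult_left_mono) auto
    also have "\<dots> = 4 powr ?N * (4 * C3 + ?\<omega>) * (1 + q powr p) * q powr - s"
    proof -
      have "\<tau> powr - ?N * sqrt q powr ?n = 4 powr ?N * (sqrt q powr - ?N * sqrt q powr ?n)"
        using q by (simp only: \<tau>_def powr_divide powr_minus) (simp add: field_simps)
      also have "sqrt q powr - ?N * sqrt q powr ?n = q powr - s"
      proof -
        have "(- ?n - 2 * s) / 2 + ?n / 2 = - s" by (simp add: field_simps)
        then show ?thesis
          using q by (simp add: powr_add[symmetric] powr_half_sqrt[symmetric] powr_powr)
      qed
      finally show ?thesis by (simp add: mult_ac)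
    qed
    finally have far: "(LINT z|lborel. W z * cut_kern s \<tau> z) \<le> 4 powr ?N * (4 * C3 + ?\<omega>) * (1 + q powr p) * q powr - s" .

    have "(LINT y|lborel. indicator S y * (barrier p \<eta> y - barrier p \<eta> x) * cut_kern s \<delta> (y - x)) = (LINT z|lborel. W z * cut_kern s \<delta> z)"
      using lborel_integral_translation[of "\<lambda>y. indicator S y * (barrier p \<eta> y - barrier p \<eta> x) * cut_kern s \<delta> (y - x)" x]
      by (simp add: W_def)
    also have "\<dots> = (LINT z|lborel. W z * k z) + (LINT z|lborel. W z * cut_kern s \<tau> z)"
      using Wk_int W_int[OF \<tau>(1)] by (subst Bochner_Integration.integral_add[symmetric]) (auto simp: k_def algebra_simps)
    also have "\<dots> \<le> C * (1 + q powr p) * q powr - s"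
      using near far by (simp add: C_def algebra_simps)
    finally show ?thesis by (simp add: q_def)
  qed
  ultimately show ?thesis by (rule that)
qed

section \<open>Reflection in the hyperplane\<close>

lemma fst_reflect [simp]: "fst (reflect x) = - fst x" and snd_reflect [simp]: "snd (reflect x) = snd x"
  and reflect_reflect [simp]: "reflect (reflect x) = x"
  by (simp_all add: reflect_def)

lemma reflect_diff: "reflect (x - y) = reflect x - reflect y"
  by (simp add: reflect_def prod_eq_iff)

lemma norm_prod_sq: "(norm x)\<^sup>2 = (fst x)\<^sup>2 + (norm (snd x))\<^sup>2" for x :: "real \<times> (real ^ 'm)"
  by (simp add: norm_prod_def)

lemma norm_reflect [simp]: "norm (reflect x) = norm x" for x :: "real \<times> (real ^ 'm)"
  by (simp add: norm_prod_def)

text \<open>For two points of the half space reflection of one of them increases the distance; this identity measures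
by how much.\<close>

lemma norm_reflect_diff_sq: "(norm (reflect y - x))\<^sup>2 = (norm (y - x))\<^sup>2 + 4 * fst x * fst y"
  for x y :: "real \<times> (real ^ 'm)"
  unfolding norm_prod_sq by (simp add: power2_eq_square algebra_simps)

lemma reflect_measurable [measurable]: "reflect \<in> borel_measurable borel"
  unfolding reflect_def[abs_def] by (intro borel_measurable_continuous_onI continuous_intros)

lemma half_space_borel [measurable]: "(half_space :: (real \<times> (real ^ 'm)) set) \<in> sets borel"
proof -
  have "open (half_space :: (real \<times> (real ^ 'm)) set)"
    unfolding half_space_def by (intro open_Collect_less continuous_intros)
  then show ?thesis by simp
qed

lemma lborel_distr_reflect: "distr lborel borel reflect = (lborel :: (real \<times> (real ^ 'm)) measure)"
proof -
  let ?e = "(1, 0) :: real \<times> (real ^ 'm)"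
  let ?c = "\<lambda>j. if j = ?e then - 1 else 1 :: real"
  have e: "?e \<in> Basis" by (simp add: Basis_prod_def)
  have T: "0 + (\<Sum>j\<in>Basis. (?c j * (x \<bullet> j)) *\<^sub>R j) = reflect x" for x :: "real \<times> (real ^ 'm)"
  proof -
    have "(\<Sum>j\<in>Basis. (?c j * (x \<bullet> j)) *\<^sub>R j)
        = (\<Sum>j\<in>Basis. (x \<bullet> j) *\<^sub>R j + (if j = ?e then (- (2 * (x \<bullet> ?e))) *\<^sub>R ?e else 0))"
    proof (intro sum.cong refl)
      fix j :: "real \<times> (real ^ 'm)"
      have "(- 1 * c) *\<^sub>R v = c *\<^sub>R v + (- (2 * c)) *\<^sub>R v" for c and v :: "real \<times> (real ^ 'm)"
        unfolding scaleR_left_distrib[symmetric] by simp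
      from this[of "x \<bullet> ?e" ?e]
      show "(?c j * (x \<bullet> j)) *\<^sub>R j = (x \<bullet> j) *\<^sub>R j + (if j = ?e then (- (2 * (x \<bullet> ?e))) *\<^sub>R ?e else 0)"
        by (cases "j = ?e") (simp_all only: if_True if_False mult_1_left add_0_right simp_thms)
    qed
    also have "\<dots> = x - (2 * (x \<bullet> ?e)) *\<^sub>R ?e"
    proof -
      have "(\<Sum>j\<in>Basis. if j = ?e then (- (2 * (x \<bullet> ?e))) *\<^sub>R ?e else 0) = (- (2 * (x \<bullet> ?e))) *\<^sub>R ?e"
        using e by (subst sum.delta) simp_all
      then show ?thesis
        unfolding sum.distrib euclidean_representation by (simp only: scaleR_minus_left diff_conv_add_uminus)
    qed
    also have "\<dots> = reflect x"
      by (simp add: reflect_def prod_eq_iff inner_prod_def)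
    finally show ?thesis by simp
  qed
  have "lborel = density (distr lborel borel (\<lambda>x. 0 + (\<Sum>j\<in>Basis. (?c j * (x \<bullet> j)) *\<^sub>R j))) (\<lambda>_. (\<Prod>j\<in>Basis. \<bar>?c j\<bar>))"
    by (rule lborel_affine_euclidean) auto
  also have "(\<Prod>j\<in>Basis. \<bar>?c j\<bar>) = 1" by (intro prod.neutral) auto
  finally show ?thesis unfolding T by (simp add: density_1)
qed

lemma
  fixes f :: "real \<times> (real ^ 'm) \<Rightarrow> real"
  assumes [measurable]: "f \<in> borel_measurable borel"
  shows lborel_integrable_reflect: "integrable lborel (\<lambda>x. f (reflect x)) \<longleftrightarrow> integrable lborel f"
    and lborel_integral_reflect: "(LINT x|lborel. f (reflect x)) = (LINT x|lborel. f x)"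
  by (subst (2) lborel_distr_reflect[symmetric], simp add: integrable_distr_eq integral_distr)+

lemma AE_reflect:
  fixes P :: "real \<times> (real ^ 'm) \<Rightarrow> bool"
  assumes "AE x in lborel. P x"
  shows "AE x in lborel. P (reflect x)"
proof -
  have "AE x in distr lborel borel reflect. P x"
    unfolding lborel_distr_reflect by (rule assms)
  then show ?thesis by (rule AE_distrD[rotated]) simp
qed

lemma AE_fst_nonzero: "AE x in (lborel :: (real \<times> (real ^ 'm)) measure). fst x \<noteq> 0"
proof -
  let ?S = "{x :: real \<times> (real ^ 'm). (1, 0) \<bullet> x = 0}"
  have "negligible ?S" by (rule negligible_hyperplane) (simp add: zero_prod_def)
  then have "?S \<in> null_sets lebesgue" by (simp add: negligible_iff_null_sets)
  moreover have "?S \<in> sets lborel" using closed_hyperplane[of "(1, 0) :: real \<times> (real ^ 'm)" 0] by simp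
  ultimately have "?S \<in> null_sets lborel" by (simp add: null_sets_completion_iff)
  then have "AE x in lborel. x \<notin> ?S" by (rule AE_not_in)
  then show ?thesis by eventually_elim (simp add: inner_prod_def)
qed

lemma integral_fold_half_space:
  fixes f :: "real \<times> (real ^ 'm) \<Rightarrow> real"
  assumes i: "integrable lborel f" and [measurable]: "f \<in> borel_measurable borel"
  shows "integrable lborel (\<lambda>x. indicator half_space x * (f x + f (reflect x)))"
    "(LINT x|lborel. f x) = (LINT x|lborel. indicator half_space x * (f x + f (reflect x)))"
proof -
  have i1: "integrable lborel (\<lambda>x. indicator half_space x * f x)"
    using integrable_bounded_times[OF i, of "indicator half_space" 1] by (simp add: indicator_def)
  have i': "integrable lborel (\<lambda>x. f (reflect x))" using i by (simp add: lborel_integrable_reflect)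
  have i2: "integrable lborel (\<lambda>x. indicator half_space x * f (reflect x))"
    using integrable_bounded_times[OF i', of "indicator half_space" 1] by (simp add: indicator_def)
  have i3: "integrable lborel (\<lambda>x. indicator half_space (reflect x) * f x)"
    using lborel_integrable_reflect[of "\<lambda>x. indicator half_space x * f (reflect x)"] i2 by simp
  show "integrable lborel (\<lambda>x. indicator half_space x * (f x + f (reflect x)))"
    using i1 i2 by (simp add: distrib_left)
  have "(LINT x|lborel. f x) = (LINT x|lborel. indicator half_space x * f x + indicator half_space (reflect x) * f x)"
  proof (rule integral_cong_AE)
    show "AE x in lborel. f x = indicator half_space x * f x + indicator half_space (reflect x) * f x"
      using AE_fst_nonzero by eventually_elim (auto simp: half_space_def indicator_def)
  qed auto
  also have "\<dots> = (LINT x|lborel. indicator half_space x * f x) + (LINT x|lborel. indicator half_space (reflect x) * f x)"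
    using i1 i3 by (rule Bochner_Integration.integral_add)
  also have "(LINT x|lborel. indicator half_space (reflect x) * f x) = (LINT x|lborel. indicator half_space x * f (reflect x))"
    using lborel_integral_reflect[of "\<lambda>x. indicator half_space x * f (reflect x)"] by simp
  also have "(LINT x|lborel. indicator half_space x * f x) + (LINT x|lborel. indicator half_space x * f (reflect x))
      = (LINT x|lborel. indicator half_space x * (f x + f (reflect x)))"
    using i1 i2 by (simp add: distrib_left)
  finally show "(LINT x|lborel. f x) = (LINT x|lborel. indicator half_space x * (f x + f (reflect x)))" .
qed

lemma ball_in_half_space:
  fixes x0 :: "real \<times> (real ^ 'm)"
  assumes sub: "ball x0 r \<subseteq> half_space" and r: "0 < r"
  shows "r \<le> fst x0" and "dist x0 x \<le> d \<Longrightarrow> r - d \<le> fst x"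
proof -
  show r0: "r \<le> fst x0"
  proof (rule ccontr)
    assume "\<not> r \<le> fst x0"
    moreover have "x0 \<in> half_space" using sub r by (intro subsetD[OF sub]) simp
    then have "0 < fst x0" by (simp add: half_space_def)
    ultimately have "x0 - (fst x0, 0) \<in> ball x0 r" by (simp add: dist_norm norm_prod_def)
    from subsetD[OF sub this] show False by (simp add: half_space_def)
  qed
  assume "dist x0 x \<le> d"
  moreover have "\<bar>fst x0 - fst x\<bar> \<le> dist x0 x"
    using dist_fst_le[of x0 x] by (simp add: dist_real_def)
  ultimately show "r - d \<le> fst x" using r0 by linarith
qed

text \<open>Let \<open>a\<close> and \<open>b\<close> be the squared distances of the points before and after reflection. Then \<open>a \<le> 4 * r^2\<close> and
\<open>b - a \<ge> r^2 / 8\<close>, hence \<open>b \<ge> 33 / 32 * a\<close>, and the kernel drops by a fixed factor.\<close>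

lemma kern_reflect_gap:
  fixes x y :: "real \<times> (real ^ 'm)"
  assumes s: "0 < s" and r: "0 < r" and d: "norm (y - x) \<le> 2 * r" "0 < norm (y - x)" and xy: "r\<^sup>2 / 32 \<le> fst x * fst y"
  shows "(2 * r) powr - (real DIM(real \<times> (real ^ 'm)) + 2 * s) * (1 - (32 / 33) powr ((real DIM(real \<times> (real ^ 'm)) + 2 * s) / 2))
    \<le> kern s (y - x) - kern s (reflect y - x)"
proof -
  let ?N = "real DIM(real \<times> (real ^ 'm)) + 2 * s"
  define a b where "a = (norm (y - x))\<^sup>2" and "b = (norm (reflect y - x))\<^sup>2"
  have a: "0 < a" "a \<le> 4 * r\<^sup>2"
    using d power_mono[of "norm (y - x)" "2 * r" 2] by (auto simp: a_def power_mult_distrib)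
  have "b = a + 4 * (fst x * fst y)" by (simp add: a_def b_def norm_reflect_diff_sq)
  with xy a have b: "33 / 32 * a \<le> b" by simp
  have sq: "(c\<^sup>2) powr - (M / 2) = c powr - M" if "0 < c" for c M :: real
    using that by (simp add: powr_realpow[symmetric] powr_powr del: powr_numeral)
  have k: "kern s z = ((norm z)\<^sup>2) powr - (?N / 2)" for z :: "real \<times> (real ^ 'm)"
    unfolding kern_def using sq[of "norm z" ?N] by (cases "z = 0") simp_all
  have "b powr - (?N / 2) \<le> (33 / 32 * a) powr - (?N / 2)"
    using b a s by (intro powr_mono2') auto
  also have "\<dots> = (32 / 33) powr (?N / 2) * a powr - (?N / 2)"
    using a by (simp only: powr_mult powr_minus powr_divide) (simp add: field_simps)
  finally have 1: "a powr - (?N / 2) * (1 - (32 / 33) powr (?N / 2)) \<le> a powr - (?N / 2) - b powr - (?N / 2)"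
    by (simp add: algebra_simps)
  have "(2 * r) powr - ?N = (4 * r\<^sup>2) powr - (?N / 2)"
    using sq[of "2 * r" ?N] r by (simp add: power_mult_distrib)
  also have "\<dots> \<le> a powr - (?N / 2)" using a s by (intro powr_mono2') auto
  finally have "(2 * r) powr - ?N * (1 - (32 / 33) powr (?N / 2)) \<le> a powr - (?N / 2) * (1 - (32 / 33) powr (?N / 2))"
    using s by (intro mult_right_mono) (auto intro!: powr_le1)
  with 1 show ?thesis by (simp add: k a_def b_def)
qed

section \<open>The fractional Laplacian of an antisymmetric function\<close>

text \<open>The lower bound of \<open>kern_reflect_gap\<close> with \<open>N = n + 2 * s\<close>.\<close>

definition reflection_gap :: "real \<Rightarrow> real \<Rightarrow> real"
  where "reflection_gap N r = (2 * r) powr - N * (1 - (32 / 33) powr (N / 2))"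

text \<open>After folding, the integrand on the half space is \<open>U x * (c y + c' y) - U y * (c y - c' y)\<close> with
\<open>c\<close>, \<open>c'\<close> the kernel seen from \<open>y\<close> and from its mirror image. It is estimated in three regions. Within
\<open>\<delta>\<close> of \<open>x\<close> the kernel \<open>c\<close> is cut off and only the bounded \<open>c'\<close> remains, an error that vanishes with \<open>\<delta>\<close>. In the
rest of the smaller ball minimality of \<open>U + \<psi>\<close> bounds \<open>U y\<close> from below. Outside that ball
\<open>U y \<ge> 0\<close>, and on the annulus \<open>U y \<ge> m\<close> produces the gain. The constant \<open>3 * t\<close> collects the kernel seen
from outside once and its reflected copy twice.\<close>

lemma antisymmetric_trunc_le:
  fixes U \<psi> :: "real \<times> (real ^ 'm) \<Rightarrow> real" and x0 x :: "real \<times> (real ^ 'm)" and s :: real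
  defines "N \<equiv> real DIM(real \<times> (real ^ 'm)) + 2 * s"
  assumes s: "0 < s" and r: "0 < r" and sub: "ball x0 r \<subseteq> half_space"
    and U [measurable]: "U \<in> borel_measurable borel" and anti: "\<And>y. U (reflect y) = - U y"
    and U_nonneg: "\<And>y. y \<in> half_space \<Longrightarrow> 0 \<le> U y"
    and U_int: "integrable lborel (\<lambda>y. U y * cut_kern s \<delta> (y - x))"
    and x: "dist x0 x \<le> 5 / 8 * r" and \<delta>: "0 < \<delta>" "\<delta> \<le> r / 8"
    and m: "0 \<le> m" "\<And>y. y \<in> ball x0 (7 / 8 * r) - ball x0 (3 / 4 * r) \<Longrightarrow> m \<le> U y"
    and \<psi> [measurable]: "\<psi> \<in> borel_measurable borel"
    and \<psi>_nonneg: "\<And>y. y \<in> ball x0 (3 / 4 * r) \<Longrightarrow> 0 \<le> \<psi> y"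
    and bounds: "\<And>y. y \<in> ball x0 (3 / 4 * r) \<Longrightarrow> U y \<le> b" "\<And>y. y \<in> ball x0 (3 / 4 * r) \<Longrightarrow> \<psi> y \<le> b'"
    and min: "\<And>y. y \<in> ball x0 (3 / 4 * r) \<Longrightarrow> U x + \<psi> x \<le> U y + \<psi> y" and t: "U x + \<psi> x \<le> t"
    and C1: "integrable lborel (cut_kern s (r / 8) :: real \<times> (real ^ 'm) \<Rightarrow> real)"
      "(LINT z::real \<times> (real ^ 'm)|lborel. cut_kern s (r / 8) z) \<le> C1"
  shows "(LINT z::real \<times> (real ^ 'm)|lborel. cut_kern s \<delta> z) * U x - (LINT y|lborel. U y * cut_kern s \<delta> (y - x))
    \<le> 3 * t * C1 + (LINT y|lborel. indicator (ball x0 (3 / 4 * r)) y * (\<psi> y - \<psi> x) * cut_kern s \<delta> (y - x))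
      + b * (r / 4) powr - N * measure lborel (ball x \<delta>)
      - m * reflection_gap N r * measure lborel (ball x0 (7 / 8 * r) - ball x0 (3 / 4 * r))"
proof -
  let ?A = "ball x0 (7 / 8 * r) - ball x0 (3 / 4 * r)" and ?B = "ball x0 (3 / 4 * r)"
  let ?g = "reflection_gap N r"
  define c where "c y = cut_kern s \<delta> (y - x)" for y
  define c' where "c' y = cut_kern s \<delta> (reflect y - x)" for y
  have c_meas [measurable]: "c \<in> borel_measurable borel" unfolding c_def by measurable
  have N: "0 < N" using s by (simp add: N_def add_nonneg_pos)
  have xB: "x \<in> ?B" using x r by simp
  have x1: "3 / 8 * r \<le> fst x"
    using ball_in_half_space(2)[OF sub r x] by simp
  then have xH: "x \<in> half_space" using r by (simp add: half_space_def)
  have BA: "y \<in> half_space" "r / 8 \<le> fst y" if "dist x0 y < 7 / 8 * r" for y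
    using ball_in_half_space(2)[OF sub r, of y "7 / 8 * r"] that r by (auto simp: half_space_def)
  have t0: "0 \<le> \<psi> x" "U x \<le> t" "0 \<le> U x" "0 \<le> t"
    using \<psi>_nonneg[OF xB] t U_nonneg[OF xH] by auto
  have b0: "0 \<le> b" using bounds(1)[OF xB] t0 by linarith
  have k_int: "integrable lborel (\<lambda>y. cut_kern s \<rho> (y - x))"
    "(LINT y|lborel. cut_kern s \<rho> (y - x)) = (LINT y::real \<times> (real ^ 'm)|lborel. cut_kern s \<rho> y)" if "0 < \<rho>" for \<rho>
    using cut_kern_integrable[OF s that, where 'a="real \<times> (real ^ 'm)"]
      lborel_integrable_translation[of "cut_kern s \<rho> :: real \<times> (real ^ 'm) \<Rightarrow> real" "-x"]
      lborel_integral_translation[of "cut_kern s \<rho> :: real \<times> (real ^ 'm) \<Rightarrow> real" "-x"] by simp_all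

  define f where "f y = U x * c y - U y * c y" for y
  have f_meas [measurable]: "f \<in> borel_measurable borel" unfolding f_def by measurable
  have f_int: "integrable lborel f"
    unfolding f_def c_def using k_int(1)[OF \<delta>(1)] U_int by simp
  have "\<bar>indicator ?B y * (\<psi> y - \<psi> x)\<bar> \<le> 2 * \<bar>b'\<bar>" for y
    using bounds(2)[of y] bounds(2)[OF xB] \<psi>_nonneg[of y] \<psi>_nonneg[OF xB] by (cases "y \<in> ?B") auto
  moreover have "(\<lambda>y. indicator ?B y * (\<psi> y - \<psi> x)) \<in> borel_measurable borel"
    by (intro borel_measurable_times borel_measurable_indicator borel_measurable_diff \<psi> borel_measurable_const) simp
  ultimately have P: "integrable lborel (\<lambda>y. indicator ?B y * (\<psi> y - \<psi> x) * cut_kern s \<delta> (y - x))"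
    by (intro integrable_bounded_times[OF k_int(1)[OF \<delta>(1)]])
  have Q1: "integrable lborel (\<lambda>y. cut_kern s (r / 8) (reflect y - x))"
    using lborel_integrable_reflect[of "\<lambda>y. cut_kern s (r / 8) (y - x)"] k_int(1)[of "r / 8"] r by simp
  have Q2: "integrable lborel (indicator (ball x \<delta>) :: _ \<Rightarrow> real)" "integrable lborel (indicator ?A :: _ \<Rightarrow> real)"
    using emeasure_lborel_ball_finite[of x \<delta>] emeasure_lborel_ball_finite[of x0 "7 / 8 * r"]
    by (auto intro!: integrable_real_indicator intro: le_less_trans[OF emeasure_mono])
  have "(LINT z::real \<times> (real ^ 'm)|lborel. cut_kern s \<delta> z) * U x - (LINT y|lborel. U y * cut_kern s \<delta> (y - x)) = (LINT y|lborel. f y)"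
    unfolding f_def c_def using k_int[OF \<delta>(1)] U_int by simp
  also have "\<dots> = (LINT y|lborel. indicator half_space y * (f y + f (reflect y)))"
    by (rule integral_fold_half_space(2)[OF f_int f_meas])
  also have "\<dots> \<le> (LINT y|lborel. indicator ?B y * (\<psi> y - \<psi> x) * cut_kern s \<delta> (y - x)
      + (2 * t * cut_kern s (r / 8) (reflect y - x) + t * cut_kern s (r / 8) (y - x)
      + b * (r / 4) powr - N * indicator (ball x \<delta>) y - m * ?g * indicator ?A y))"
    (is "_ \<le> (LINT y|lborel. ?P y + ?Q y)")
  proof (rule integral_mono)
    show "integrable lborel (\<lambda>y. indicator half_space y * (f y + f (reflect y)))"
      by (rule integral_fold_half_space(1)[OF f_int f_meas])
    have Q: "integrable lborel ?Q"
      using Q1 Q2 k_int(1)[of "r / 8"] r by simp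
    show "integrable lborel (\<lambda>y. ?P y + ?Q y)" using P Q by (rule Bochner_Integration.integrable_add)
    fix y :: "real \<times> (real ^ 'm)"
    have g0: "0 \<le> ?g" unfolding reflection_gap_def using N by (auto intro!: mult_nonneg_nonneg powr_le1)
    show "indicator half_space y * (f y + f (reflect y)) \<le> ?P y + ?Q y"
    proof (cases "y \<in> half_space")
      case False
      then have "y \<notin> ?B" "y \<notin> ?A" using BA(1)[of y] r by auto
      then show ?thesis using False t0 b0 by (simp add: add_nonneg_nonneg)
    next
      case yH: True
      then have y1: "0 < fst y" by (simp add: half_space_def)
      have refl_norm: "norm (y - x) \<le> norm (reflect y - x)"
      proof (rule power2_le_imp_le)
        have "0 \<le> fst x * fst y" using x1 y1 r by (intro mult_nonneg_nonneg) auto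
        then show "(norm (y - x))\<^sup>2 \<le> (norm (reflect y - x))\<^sup>2"
          by (simp add: norm_reflect_diff_sq)
      qed simp
      have far: "3 / 8 * r \<le> norm (reflect y - x)"
      proof -
        have "\<bar>fst (reflect y - x)\<bar> \<le> norm (reflect y - x)"
          using norm_fst_le[of "fst (reflect y - x)" "snd (reflect y - x)"] by (simp only: prod.collapse real_norm_def)
        then show ?thesis using x1 y1 by simp
      qed
      have c'_eq: "c' y = kern s (reflect y - x)" using far \<delta> r by (simp add: c'_def cut_kern_def)
      have c'_le: "c' y \<le> (r / 4) powr - N"
        unfolding c'_eq kern_def N_def[symmetric] using far r N by (intro powr_mono2') auto
      have c'_le2: "c' y = cut_kern s (r / 8) (reflect y - x)"
        unfolding c'_eq using far r by (simp add: cut_kern_def)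
      have c0: "0 \<le> c y" "0 \<le> c' y" by (simp_all add: c_def c'_def)
      have cc': "c' y \<le> c y" if "\<delta> \<le> norm (y - x)"
      proof -
        have "norm (reflect y - x) powr - N \<le> norm (y - x) powr - N"
          using refl_norm that \<delta> N by (intro powr_mono2') auto
        then show ?thesis using that by (simp add: c_def cut_kern_def c'_eq kern_def N_def)
      qed
      have "f (reflect y) = U x * c' y + U y * c' y"
        by (simp add: f_def c_def c'_def anti)
      then have fy: "f y + f (reflect y) = U x * (c y + c' y) - U y * (c y - c' y)"
        by (simp add: f_def algebra_simps)
      consider "norm (y - x) < \<delta>" | "\<delta> \<le> norm (y - x)" "y \<in> ?B" | "\<delta> \<le> norm (y - x)" "y \<notin> ?B" by linarith
      then show ?thesis
      proof cases
        case 1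
        have "dist x0 y \<le> dist x0 x + norm (y - x)"
          using dist_triangle[of x0 y x] by (simp add: dist_norm norm_minus_commute)
        then have yB: "y \<in> ?B" using 1 x \<delta> r by simp
        have "c y = 0" using 1 by (simp add: c_def cut_kern_def)
        then have "f y + f (reflect y) = U x * c' y + U y * c' y" using fy by simp
        also have "\<dots> \<le> t * c' y + b * c' y"
          using c0 t0 bounds(1)[OF yB] by (intro add_mono mult_right_mono) auto
        also have "\<dots> \<le> t * c' y + b * (r / 4) powr - N"
          using b0 c'_le by (simp add: mult_left_mono)
        finally have "f y + f (reflect y) \<le> t * c' y + b * (r / 4) powr - N" .
        moreover have "0 \<le> t * c' y" "0 \<le> t * cut_kern s (r / 8) (y - x)" using t0 c0 by simp_all
        ultimately show ?thesis
          using yH yB 1 \<open>c y = 0\<close>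
          by (simp add: c_def[symmetric] c'_le2[symmetric] dist_norm norm_minus_commute)
      next
        case 2
        have "(U x + \<psi> x - \<psi> y) * (c y - c' y) \<le> U y * (c y - c' y)"
          using min[OF 2(2)] cc'[OF 2(1)] by (intro mult_right_mono) auto
        then have "f y + f (reflect y) \<le> (\<psi> y - \<psi> x) * c y + (2 * U x + \<psi> x - \<psi> y) * c' y"
          unfolding fy by (simp add: algebra_simps)
        also have "(2 * U x + \<psi> x - \<psi> y) * c' y \<le> 2 * t * c' y"
          using t t0 \<psi>_nonneg[OF 2(2)] c0 by (intro mult_right_mono) auto
        finally have "f y + f (reflect y) \<le> (\<psi> y - \<psi> x) * c y + 2 * t * c' y" by simp
        moreover have "0 \<le> t * cut_kern s (r / 8) (y - x)" using t0 by simp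
        ultimately show ?thesis
          using yH 2 b0 by (simp add: c_def[symmetric] c'_le2[symmetric] dist_norm norm_minus_commute)
      next
        case 3
        have "r / 8 \<le> norm (y - x)"
          using 3(2) x dist_triangle[of x0 y x] by (simp add: dist_norm norm_minus_commute)
        then have c_eq: "c y = cut_kern s (r / 8) (y - x)" using 3 by (simp add: c_def cut_kern_def)
        have "m * ?g * indicator ?A y \<le> U y * (c y - c' y)"
        proof (cases "y \<in> ?A")
          case True
          have "norm (y - x) \<le> 2 * r"
            using True x dist_triangle[of y x x0] r by (auto simp: dist_norm norm_minus_commute)
          moreover have "r\<^sup>2 / 32 \<le> fst x * fst y"
          proof -
            have "(3 / 8 * r) * (r / 8) \<le> fst x * fst y"
              using x1 BA(2)[of y] True r by (intro mult_mono) auto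
            moreover have "r\<^sup>2 / 32 \<le> (3 / 8 * r) * (r / 8)" by (simp add: power2_eq_square)
            ultimately show ?thesis by linarith
          qed
          ultimately have "?g \<le> kern s (y - x) - kern s (reflect y - x)"
            unfolding reflection_gap_def N_def using s r 3(1) \<delta>(1) by (intro kern_reflect_gap) auto
          also have "\<dots> = c y - c' y" using 3(1) by (simp add: c_def cut_kern_def c'_eq)
          finally have "?g \<le> c y - c' y" .
          then have "m * ?g \<le> U y * (c y - c' y)"
            using m(1) m(2)[OF True] g0 by (intro mult_mono) auto
          then show ?thesis using True by simp
        qed (use U_nonneg[OF yH] cc'[OF 3(1)] in \<open>auto intro!: mult_nonneg_nonneg\<close>)
        moreover have "U x * (c y + c' y) \<le> t * (c y + c' y)" using t0 c0 by (intro mult_right_mono) auto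
        ultimately have "f y + f (reflect y) \<le> t * c y + t * c' y - m * ?g * indicator ?A y"
          unfolding fy by (simp add: algebra_simps)
        moreover have "0 \<le> t * c' y" using t0 c0 by simp
        ultimately show ?thesis
          using yH 3 b0 by (simp add: c_eq[symmetric] c'_le2[symmetric] dist_norm norm_minus_commute)
      qed
    qed
  qed
  also have "\<dots> = (LINT y|lborel. ?P y) + (2 * t * (LINT y|lborel. cut_kern s (r / 8) (reflect y - x)) + t * (LINT y|lborel. cut_kern s (r / 8) (y - x))
      + b * (r / 4) powr - N * measure lborel (ball x \<delta>) - m * ?g * measure lborel ?A)"
    using P Q1 Q2 k_int(1)[of "r / 8"] r by simp
  also have "(LINT y|lborel. cut_kern s (r / 8) (reflect y - x)) = (LINT y|lborel. cut_kern s (r / 8) (y - x))"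
    using lborel_integral_reflect[of "\<lambda>y. cut_kern s (r / 8) (y - x)"] by simp
  also have "(LINT y|lborel. cut_kern s (r / 8) (y - x)) = (LINT y::real \<times> (real ^ 'm)|lborel. cut_kern s (r / 8) y)"
    using k_int(2)[of "r / 8"] r by simp
  finally show ?thesis
    using mult_left_mono[OF C1(2), of t] t0(4) by (simp add: algebra_simps)
qed

section \<open>The mollified minimum principle\<close>

lemma frac_const_pos: "0 < s \<Longrightarrow> s < 1 \<Longrightarrow> 0 < frac_const n s"
proof -
  assume s: "0 < s" "s < 1"
  have "- s \<notin> \<int>\<^sub>\<le>\<^sub>0"
  proof
    assume "- s \<in> \<int>\<^sub>\<le>\<^sub>0"
    then obtain k :: int where "- s = of_int k" by (auto simp: nonpos_Ints_def)
    with s have "-1 < k" "k < 0" by linarith+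
    then show False by linarith
  qed
  then have "Gamma (- s) \<noteq> 0" by (simp add: Gamma_eq_zero_iff)
  moreover have "0 < Gamma (s + real n / 2)" using s by (intro Gamma_real_pos) auto
  ultimately show ?thesis by (simp add: frac_const_def)
qed

lemma AE_antisymmetric:
  fixes u :: "real \<times> (real ^ 'm) \<Rightarrow> real"
  assumes "AE x in lborel. x \<in> half_space \<longrightarrow> u (reflect x) = - u x"
  shows "AE x in lborel. u (reflect x) = - u x"
  using assms AE_reflect[OF assms] AE_fst_nonzero
  by eventually_elim (auto simp: half_space_def linorder_neq_iff)

context
  fixes u :: "real \<times> (real ^ 'm) \<Rightarrow> real" and s \<epsilon> :: real
  assumes s: "0 < s" and u_meas [measurable]: "u \<in> borel_measurable borel"
    and u: "integrable lborel (\<lambda>y. u y * tail_weight s y)"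
    and anti: "AE x in lborel. x \<in> half_space \<longrightarrow> u (reflect x) = - u x" and \<epsilon>: "0 < \<epsilon>"
begin

lemma mollify_reflect: "mollify u \<epsilon> (reflect x) = - mollify u \<epsilon> x"
proof -
  have m: "mollifier \<epsilon> (reflect y - reflect x) = mollifier \<epsilon> (y - x)" for y
    by (rule mollifier_cong[OF \<epsilon>]) (simp add: reflect_diff[symmetric])
  have "mollify u \<epsilon> (reflect x) = (LINT y|lborel. u (reflect y) * mollifier \<epsilon> (reflect y - reflect x))"
    unfolding mollify_def
    using lborel_integral_reflect[of "\<lambda>y. u y * mollifier \<epsilon> (y - reflect x)"] by simp
  also have "\<dots> = (LINT y|lborel. - (u y * mollifier \<epsilon> (y - x)))"
    unfolding m
  proof (rule integral_cong_AE)
    show "AE y in lborel. u (reflect y) * mollifier \<epsilon> (y - x) = - (u y * mollifier \<epsilon> (y - x))"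
      using AE_antisymmetric[OF anti] by eventually_elim simp
  qed measurable
  finally show ?thesis by (simp add: mollify_def)
qed

text \<open>This is where the bump has to be radially decreasing: a point of the half space carries at least as much
weight as its mirror image.\<close>

lemma mollify_nonneg_half_space:
  assumes nonneg: "AE x in lborel. x \<in> half_space \<longrightarrow> 0 \<le> u x" and x: "x \<in> half_space"
  shows "0 \<le> mollify u \<epsilon> x"
proof -
  have "mollify u \<epsilon> x = (LINT y|lborel. indicator half_space y * (u y * mollifier \<epsilon> (y - x) + u (reflect y) * mollifier \<epsilon> (reflect y - x)))"
    unfolding mollify_def
    by (rule integral_fold_half_space(2)[OF mollify_integrable[OF s u_meas u \<epsilon>]]) measurable
  also have "0 \<le> \<dots>"
  proof (rule integral_nonneg_AE)
    show "AE y in lborel. 0 \<le> indicator half_space y * (u y * mollifier \<epsilon> (y - x) + u (reflect y) * mollifier \<epsilon> (reflect y - x))"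
      using anti nonneg
    proof eventually_elim
      case (elim y)
      show ?case
      proof (cases "y \<in> half_space")
        case True
        have "norm (y - x) \<le> norm (reflect y - x)"
        proof (rule power2_le_imp_le)
          have "0 \<le> fst x * fst y" using x True by (intro mult_nonneg_nonneg) (auto simp: half_space_def)
          then show "(norm (y - x))\<^sup>2 \<le> (norm (reflect y - x))\<^sup>2"
            by (simp add: norm_reflect_diff_sq)
        qed simp
        then have "mollifier \<epsilon> (reflect y - x) \<le> mollifier \<epsilon> (y - x)" by (rule mollifier_mono[OF \<epsilon>])
        then have "u y * mollifier \<epsilon> (reflect y - x) \<le> u y * mollifier \<epsilon> (y - x)"
          using elim True by (intro mult_left_mono) auto
        then show ?thesis using elim True by simp
      qed simp
    qed
  qed
  finally show ?thesis .
qed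

end

text \<open>The constant is chosen such that the barrier is nonnegative on the closed ball of radius \<open>r\<close>, as long as
the regularisation parameter is at most \<open>r\<close>.\<close>

definition shifted_barrier :: "real \<Rightarrow> real \<Rightarrow> real \<Rightarrow> 'a::euclidean_space \<Rightarrow> 'a \<Rightarrow> real"
  where "shifted_barrier p r \<epsilon> x0 y = ln (2 * r\<^sup>2) + (2 * r\<^sup>2) powr p + barrier p \<epsilon> (y - x0)"

lemma regularised_sq_le:
  assumes "0 < \<epsilon>" "\<epsilon> \<le> r" "dist x0 y \<le> r"
  shows "regularised_sq \<epsilon> (y - x0) \<le> 2 * r\<^sup>2"
proof -
  have "(norm (y - x0))\<^sup>2 \<le> r\<^sup>2" "\<epsilon>\<^sup>2 \<le> r\<^sup>2"
    using assms by (auto intro!: power_mono simp: dist_norm norm_minus_commute)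
  then show ?thesis by (simp add: regularised_sq_def)
qed

lemma shifted_barrier_nonneg:
  assumes "0 < \<epsilon>" "\<epsilon> \<le> r" "dist x0 y \<le> r" "0 < p"
  shows "0 \<le> shifted_barrier p r \<epsilon> x0 y"
proof -
  note q = regularised_sq_pos[OF assms(1), of "y - x0"] regularised_sq_le[OF assms(1-3)]
  have "ln (regularised_sq \<epsilon> (y - x0)) \<le> ln (2 * r\<^sup>2)" using q by (intro ln_mono) auto
  moreover have "regularised_sq \<epsilon> (y - x0) powr p \<le> (2 * r\<^sup>2) powr p" using q assms(4) by (intro powr_mono2) auto
  ultimately show ?thesis by (simp add: shifted_barrier_def barrier_def)
qed

lemma shifted_barrier_le:
  assumes "0 < \<epsilon>" "0 < \<tau>" "\<tau> \<le> dist x0 y"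
  shows "shifted_barrier p r \<epsilon> x0 y \<le> ln (2 * r\<^sup>2) + (2 * r\<^sup>2) powr p - ln (\<tau>\<^sup>2)"
proof -
  have "\<tau>\<^sup>2 \<le> (norm (y - x0))\<^sup>2" using assms by (intro power_mono) (auto simp: dist_norm norm_minus_commute)
  then have "\<tau>\<^sup>2 \<le> regularised_sq \<epsilon> (y - x0)" by (simp add: regularised_sq_def add_increasing2)
  then have "ln (\<tau>\<^sup>2) \<le> ln (regularised_sq \<epsilon> (y - x0))" using assms by (intro ln_mono) auto
  then show ?thesis using powr_ge_zero[of "regularised_sq \<epsilon> (y - x0)" p]
    unfolding shifted_barrier_def barrier_def by linarith
qed

lemma shifted_barrier_ge:
  assumes "0 < \<epsilon>" "\<epsilon> \<le> r" "dist x0 y \<le> \<epsilon>" "0 < p"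
  shows "ln (2 * r\<^sup>2) - ln (2 * \<epsilon>\<^sup>2) \<le> shifted_barrier p r \<epsilon> x0 y"
proof -
  note q = regularised_sq_pos[OF assms(1), of "y - x0"]
  have "regularised_sq \<epsilon> (y - x0) \<le> 2 * \<epsilon>\<^sup>2" by (rule regularised_sq_le) (use assms in auto)
  then have "ln (regularised_sq \<epsilon> (y - x0)) \<le> ln (2 * \<epsilon>\<^sup>2)" using q by (intro ln_mono) auto
  moreover have "regularised_sq \<epsilon> (y - x0) powr p \<le> (2 * r\<^sup>2) powr p"
    using q regularised_sq_le[OF assms(1,2), of x0 y] assms by (intro powr_mono2) auto
  ultimately show ?thesis unfolding shifted_barrier_def barrier_def by linarith
qed

lemma shifted_barrier_continuous: "0 < \<epsilon> \<Longrightarrow> continuous_on A (shifted_barrier p r \<epsilon> x0)"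
  unfolding shifted_barrier_def
  by (intro continuous_intros continuous_on_compose2[OF barrier_continuous[of \<epsilon> UNIV p]]) auto

lemma shifted_barrier_measurable [measurable]: "shifted_barrier p r \<epsilon> x0 \<in> borel_measurable borel"
  unfolding shifted_barrier_def[abs_def] by measurable

text \<open>At distance at most \<open>r / 2 + \<epsilon>\<close> from \<open>x0\<close> the ball of radius \<open>sqrt q / 4\<close> around the point stays inside the
ball of radius \<open>3 r / 4\<close>; the bound \<open>\<epsilon> \<le> r / 16\<close> leaves the room for this.\<close>

lemma shifted_barrier_integral_le:
  fixes x0 x :: "'a::euclidean_space"
  assumes \<epsilon>: "0 < \<epsilon>" "\<epsilon> \<le> r / 16" and r: "0 < r" and x: "dist x0 x \<le> r / 2 + \<epsilon>"
    and \<delta>: "0 < \<delta>" "\<delta> \<le> \<epsilon> / 4"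
    and C: "\<And>(x::'a) \<eta> \<delta> S. 0 < \<eta> \<Longrightarrow> 0 < \<delta> \<Longrightarrow> \<delta> \<le> sqrt (regularised_sq \<eta> x) / 4 \<Longrightarrow>
      S \<in> sets borel \<Longrightarrow> bounded S \<Longrightarrow> ball x (sqrt (regularised_sq \<eta> x) / 4) \<subseteq> S \<Longrightarrow>
      (LINT y|lborel. indicator S y * (barrier p \<eta> y - barrier p \<eta> x) * cut_kern s \<delta> (y - x))
        \<le> C * (1 + regularised_sq \<eta> x powr p) * regularised_sq \<eta> x powr - s"
  shows "(LINT y|lborel. indicator (ball x0 (3 / 4 * r)) y * (shifted_barrier p r \<epsilon> x0 y - shifted_barrier p r \<epsilon> x0 x) * cut_kern s \<delta> (y - x))
    \<le> C * (1 + regularised_sq \<epsilon> (x - x0) powr p) * regularised_sq \<epsilon> (x - x0) powr - s"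
proof -
  let ?q = "regularised_sq \<epsilon> (x - x0)"
  have "\<epsilon> = sqrt (\<epsilon>\<^sup>2)" using \<epsilon> by simp
  also have "\<dots> \<le> sqrt ?q" by (intro real_sqrt_le_mono) (simp add: regularised_sq_def)
  finally have q1: "\<epsilon> \<le> sqrt ?q" .
  have "sqrt ?q \<le> sqrt ((norm (x - x0) + \<epsilon>)\<^sup>2)"
    using \<epsilon> by (intro real_sqrt_le_mono) (simp add: regularised_sq_def power2_eq_square algebra_simps)
  also have "\<dots> = norm (x - x0) + \<epsilon>" using \<epsilon> by simp
  finally have q2: "sqrt ?q \<le> norm (x - x0) + \<epsilon>" .
  have sub: "ball (x - x0) (sqrt ?q / 4) \<subseteq> ball 0 (3 / 4 * r)"
  proof
    fix z assume "z \<in> ball (x - x0) (sqrt ?q / 4)"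
    then have "norm z < norm (x - x0) + sqrt ?q / 4"
      using norm_triangle_sub[of z "x - x0"] by (simp add: dist_norm norm_minus_commute)
    then show "z \<in> ball 0 (3 / 4 * r)" using q2 x \<epsilon> by (simp add: dist_norm norm_minus_commute)
  qed
  have "(LINT y|lborel. indicator (ball x0 (3 / 4 * r)) y * (shifted_barrier p r \<epsilon> x0 y - shifted_barrier p r \<epsilon> x0 x) * cut_kern s \<delta> (y - x))
     = (LINT z|lborel. indicator (ball x0 (3 / 4 * r)) (x0 + z) * (shifted_barrier p r \<epsilon> x0 (x0 + z) - shifted_barrier p r \<epsilon> x0 x) * cut_kern s \<delta> (x0 + z - x))"
  proof -
    have [measurable]: "ball x0 (3 / 4 * r) \<in> sets borel" by simp
    have "(\<lambda>y. indicator (ball x0 (3 / 4 * r)) y * (shifted_barrier p r \<epsilon> x0 y - shifted_barrier p r \<epsilon> x0 x) * cut_kern s \<delta> (y - x)) \<in> borel_measurable borel"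
      by measurable
    then show ?thesis by (rule lborel_integral_translation[symmetric])
  qed
  also have "\<dots> = (LINT z|lborel. indicator (ball 0 (3 / 4 * r)) z * (barrier p \<epsilon> z - barrier p \<epsilon> (x - x0)) * cut_kern s \<delta> (z - (x - x0)))"
    by (intro Bochner_Integration.integral_cong refl)
       (auto simp: indicator_def shifted_barrier_def dist_norm algebra_simps)
  also have "\<dots> \<le> C * (1 + ?q powr p) * ?q powr - s"
    using \<delta> q1 by (intro C \<epsilon>(1) sub) auto
  finally show ?thesis .
qed

lemma measure_ball_tendsto_0: "((\<lambda>\<delta>. measure lborel (ball (x::'a::euclidean_space) \<delta>)) \<longlongrightarrow> 0) (at_right 0)"
proof (rule Lim_transform_eventually)
  show "((\<lambda>\<delta>. unit_ball_vol (real DIM('a)) * \<delta> powr real DIM('a)) \<longlongrightarrow> 0) (at_right 0)"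
    by (intro powr_at_right_0) auto
  show "\<forall>\<^sub>F \<delta> in at_right 0. unit_ball_vol (real DIM('a)) * \<delta> powr real DIM('a) = measure lborel (ball x \<delta>)"
    using eventually_at_right_less[of "0::real"]
    by eventually_elim (simp add: content_ball powr_realpow)
qed

lemma continuous_bounded_on_cball:
  fixes f :: "'a::euclidean_space \<Rightarrow> real"
  assumes "continuous_on UNIV f"
  obtains b where "\<And>y::'a. y \<in> cball x0 R \<Longrightarrow> f y \<le> b"
proof -
  have "compact (f ` cball x0 R)"
    by (intro compact_continuous_image continuous_on_subset[OF assms]) auto
  then have "bdd_above (f ` cball x0 R)" by (simp add: compact_imp_bounded bounded_imp_bdd_above)
  then show ?thesis using that unfolding bdd_above_def by blast
qed

text \<open>A lower bound for the amount by which a unit value of \<open>u\<close> on the annulus, seen together with its negative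
mirror image, decreases the singular integral at points of the inner ball.\<close>

definition annulus_gain :: "real \<Rightarrow> real \<Rightarrow> real \<times> (real ^ 'm) \<Rightarrow> real"
  where "annulus_gain s r x0 = reflection_gap (real DIM(real \<times> (real ^ 'm)) + 2 * s) r
    * measure lborel (ball x0 (7 / 8 * r) - ball x0 (3 / 4 * r))"

text \<open>Below, \<open>C1\<close> and \<open>CB\<close> stand for the bounds supplied by \<open>cut_kern_integral_bound\<close> at radius \<open>r / 8\<close> and by
\<open>barrier_integral_le\<close>. The last condition on \<open>\<alpha>\<close> says that the terms proportional to the value at the
minimum use up at most half of the gain from the annulus; the other half is left for the barrier.\<close>

context
  fixes u :: "real \<times> (real ^ 'm) \<Rightarrow> real" and x0 :: "real \<times> (real ^ 'm)"
    and s r K m \<alpha> C1 CB p cs :: real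
  assumes s: "0 < s" "s < 1" and p_def: "p = (1 - s) / 2"
    and cs_def: "cs = frac_const DIM(real \<times> (real ^ 'm)) s"
    and u_meas [measurable]: "u \<in> borel_measurable borel"
    and u: "integrable lborel (\<lambda>y. u y * tail_weight s y)"
    and r: "0 < r" and sub: "ball x0 r \<subseteq> half_space"
    and anti: "AE x in lborel. x \<in> half_space \<longrightarrow> u (reflect x) = - u x"
    and nonneg: "AE x in lborel. x \<in> half_space \<longrightarrow> 0 \<le> u x"
    and K: "0 \<le> K" and eqn: "\<And>\<phi>. \<phi> \<in> test_functions (ball x0 r - {x0}) \<Longrightarrow> \<forall>x. 0 \<le> \<phi> x \<Longrightarrow>
      0 \<le> mixed_op_distr s u \<phi> + K * (LINT y|lborel. u y * \<phi> y)"
    and m: "0 < m" "AE y in lborel. y \<in> ball x0 r - ball x0 (r / 2) \<longrightarrow> m \<le> u y"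
    and \<alpha>: "0 < \<alpha>" "\<alpha> \<le> 1" "\<alpha> * (3 * cs * C1 + K) \<le> cs * annulus_gain s r x0 / 2"
    and C1: "integrable lborel (cut_kern s (r / 8) :: real \<times> (real ^ 'm) \<Rightarrow> real)"
      "(LINT z::real \<times> (real ^ 'm)|lborel. cut_kern s (r / 8) z) \<le> C1"
    and CB: "0 < CB" "\<And>(x::real \<times> (real ^ 'm)) \<eta> \<delta> S. 0 < \<eta> \<Longrightarrow> 0 < \<delta> \<Longrightarrow> \<delta> \<le> sqrt (regularised_sq \<eta> x) / 4 \<Longrightarrow>
      S \<in> sets borel \<Longrightarrow> bounded S \<Longrightarrow> ball x (sqrt (regularised_sq \<eta> x) / 4) \<subseteq> S \<Longrightarrow>
      (LINT y|lborel. indicator S y * (barrier p \<eta> y - barrier p \<eta> x) * cut_kern s \<delta> (y - x))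
        \<le> CB * (1 + regularised_sq \<eta> x powr p) * regularised_sq \<eta> x powr - s"
begin

text \<open>The minimum principle. If the minimum of mollification plus barrier were below \<open>\<alpha> * m\<close>, it would be attained
outside the ball of radius \<open>\<epsilon>\<close> around \<open>x0\<close>, by \<open>blowup\<close>, and inside the ball of radius \<open>r / 2 + \<epsilon>\<close>, since on the
annulus the mollification is at least \<open>m\<close>. Hence the mollifier centred there is an admissible test function,
and the tested inequality contradicts the signs of the local and nonlocal terms.\<close>

lemma mollify_lower_bound:
  assumes M: "\<And>q. 0 < q \<Longrightarrow> cs * CB * (1 + (2 * r\<^sup>2) powr p) * q powr - s \<le> 4 * p\<^sup>2 * q powr - (1 - p) + M"
    and \<theta>: "0 < \<theta>" "\<theta> * M < m * (cs * annulus_gain s r x0 / 2)"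
    and \<epsilon>: "0 < \<epsilon>" "\<epsilon> \<le> r / 16"
    and blowup: "\<And>y. dist x0 y \<le> \<epsilon> \<Longrightarrow> \<alpha> * m \<le> \<theta> * shifted_barrier p r \<epsilon> x0 y"
    and y: "y \<in> ball x0 (3 / 4 * r)"
  shows "\<alpha> * m \<le> mollify u \<epsilon> y + \<theta> * shifted_barrier p r \<epsilon> x0 y"
proof -
  let ?B = "ball x0 (3 / 4 * r)"
  define U where "U = mollify u \<epsilon>"
  define \<psi> where "\<psi> y = \<theta> * shifted_barrier p r \<epsilon> x0 y" for y
  define N where "N = real DIM(real \<times> (real ^ 'm)) + 2 * s"
  define gap where "gap = annulus_gain s r x0"
  have p: "0 < p" "p \<le> 1" using s by (auto simp: p_def)
  have dim: "2 \<le> DIM(real \<times> (real ^ 'm))" using zero_less_card_finite[where 'a='m] by simp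
  have cs: "0 < cs" unfolding cs_def using s by (rule frac_const_pos)
  have U_cont: "continuous_on UNIV U"
    unfolding U_def by (rule mollify_continuous[OF s(1) u_meas u \<epsilon>(1)])
  have U_meas [measurable]: "U \<in> borel_measurable borel"
    unfolding U_def by (rule mollify_measurable[OF s(1) u_meas u])
  have \<psi>_cont: "continuous_on UNIV \<psi>"
    unfolding \<psi>_def by (intro continuous_intros shifted_barrier_continuous \<epsilon>)
  have \<psi>_meas [measurable]: "\<psi> \<in> borel_measurable borel" unfolding \<psi>_def by measurable
  have \<psi>_nonneg: "0 \<le> \<psi> y" if "dist x0 y \<le> r" for y
    unfolding \<psi>_def using \<theta> \<epsilon> p that by (intro mult_nonneg_nonneg shifted_barrier_nonneg) auto
  have U_anti: "U (reflect y) = - U y" for y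
    unfolding U_def by (rule mollify_reflect[OF s(1) u_meas u anti \<epsilon>(1)])
  have U_nonneg: "0 \<le> U y" if "y \<in> half_space" for y
    unfolding U_def by (rule mollify_nonneg_half_space[OF s(1) u_meas u anti \<epsilon>(1) nonneg that])
  have U_ge: "m \<le> U y" if "r / 2 + \<epsilon> \<le> dist x0 y" "dist x0 y \<le> r - \<epsilon>" for y
    unfolding U_def
  proof (rule mollify_ge[OF s(1) u_meas u \<epsilon>(1)])
    show "AE z in lborel. z \<in> ball y \<epsilon> \<longrightarrow> m \<le> u z"
      using m(2)
    proof eventually_elim
      case (elim z)
      show ?case
      proof
        assume "z \<in> ball y \<epsilon>"
        then have "dist x0 z < r" "r / 2 < dist x0 z"
          using that dist_triangle[of x0 z y] dist_triangle[of x0 y z] by (auto simp: dist_commute)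
        with elim show "m \<le> u z" by auto
      qed
    qed
  qed
  obtain b where b: "\<And>y. y \<in> cball x0 r \<Longrightarrow> U y \<le> b" using continuous_bounded_on_cball[OF U_cont] by blast
  obtain b' where b': "\<And>y. y \<in> cball x0 r \<Longrightarrow> \<psi> y \<le> b'" using continuous_bounded_on_cball[OF \<psi>_cont] by blast

  obtain x where x: "x \<in> cball x0 (3 / 4 * r)" "\<And>y. y \<in> cball x0 (3 / 4 * r) \<Longrightarrow> U x + \<psi> x \<le> U y + \<psi> y"
  proof -
    have "\<exists>x\<in>cball x0 (3 / 4 * r). \<forall>y\<in>cball x0 (3 / 4 * r). U x + \<psi> x \<le> U y + \<psi> y"
      using r by (intro continuous_attains_inf continuous_on_add continuous_on_subset[OF U_cont] continuous_on_subset[OF \<psi>_cont]) auto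
    then show ?thesis using that by blast
  qed
  have "\<alpha> * m \<le> U x + \<psi> x"
  proof (rule ccontr)
    assume "\<not> \<alpha> * m \<le> U x + \<psi> x"
    then have w: "U x + \<psi> x \<le> \<alpha> * m" "U x + \<psi> x < \<alpha> * m" by auto
    have \<alpha>m: "\<alpha> * m \<le> m" using \<alpha> m by simp
    have xr: "dist x0 x \<le> r" using x(1) r by simp
    then have x_ball: "x \<in> half_space"
      using x(1) r by (intro subsetD[OF sub]) simp
    have far: "\<epsilon> < dist x0 x"
    proof (rule ccontr)
      assume "\<not> \<epsilon> < dist x0 x"
      then have "\<alpha> * m \<le> \<psi> x" unfolding \<psi>_def by (intro blowup) simp
      with w U_nonneg[OF x_ball] show False by linarith
    qed
    have near: "dist x0 x < r / 2 + \<epsilon>"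
    proof (rule ccontr)
      assume "\<not> dist x0 x < r / 2 + \<epsilon>"
      then have "m \<le> U x" using x(1) \<epsilon> r by (intro U_ge) auto
      with w \<psi>_nonneg[OF xr] \<alpha>m show False by linarith
    qed
    have near': "dist x0 x \<le> 5 / 8 * r" using near \<epsilon> by simp
    define \<phi> where "\<phi> y = mollifier \<epsilon> (y - x)" for y
    have \<phi>: "\<phi> \<in> test_functions (ball x0 r - {x0})"
      unfolding \<phi>_def
    proof (rule mollifier_test_function[OF \<epsilon>(1)])
      show "cball x \<epsilon> \<subseteq> ball x0 r - {x0}"
      proof
        fix z assume "z \<in> cball x \<epsilon>"
        then have "dist x0 z < r" "z \<noteq> x0"
          using near' far \<epsilon> r dist_triangle[of x0 z x] by (auto simp: dist_commute)
        then show "z \<in> ball x0 r - {x0}" by simp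
      qed
    qed
    define V where "V z = (LINT y|lborel. u y * \<phi> (y + z))" for z
    have V: "V z = U (x - z)" for z
      unfolding V_def U_def \<phi>_def by (rule mollify_correlation[OF s(1) u_meas u, symmetric])
    obtain L F where LF: "mixed_op_distr s u \<phi> = - (\<Sum>e\<in>Basis. L e) + cs * F"
      "\<And>e. e \<in> Basis \<Longrightarrow> (\<lambda>n. (V (inverse (real (Suc n)) *\<^sub>R e) + V (- (inverse (real (Suc n)) *\<^sub>R e)) - 2 * V 0)
         / (inverse (real (Suc n)))\<^sup>2) \<longlonglongrightarrow> L e"
      "((\<lambda>\<delta>. (LINT z::real \<times> (real ^ 'm)|lborel. cut_kern s \<delta> z) * V 0 - (LINT z|lborel. cut_kern s \<delta> z * V z)) \<longlongrightarrow> F) (at_right 0)"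
      unfolding V_def cs_def using mixed_op_distr_limit[OF s dim u_meas u \<phi>] by blast
    have "(LINT y|lborel. u y * \<phi> y) = U x" using V[of 0] by (simp add: V_def)
    then have test: "0 \<le> - (\<Sum>e\<in>Basis. L e) + cs * F + K * U x"
    proof -
      have "\<forall>y. 0 \<le> \<phi> y" unfolding \<phi>_def using mollifier_nonneg[OF \<epsilon>(1)] by blast
      from eqn[OF \<phi> this] \<open>(LINT y|lborel. u y * \<phi> y) = U x\<close> show ?thesis by (simp add: LF(1))
    qed

    \<comment> \<open>At a minimum of \<open>U + \<psi>\<close> the second differences of \<open>U\<close> are at least those of \<open>- \<psi>\<close>.\<close>
    define q where "q = regularised_sq \<epsilon> (x - x0)"
    have q: "0 < q" "q \<le> 2 * r\<^sup>2"
      unfolding q_def using \<epsilon> xr by (auto intro!: regularised_sq_pos regularised_sq_le)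
    define \<Lambda> where "\<Lambda> e = 4 * ((x - x0) \<bullet> e)\<^sup>2 * (1 / q\<^sup>2 + p * (1 - p) * q powr (p - 2)) + 2 * (- 1 / q - p * q powr (p - 1))" for e
    have L_ge: "- \<theta> * \<Lambda> e \<le> L e" if e: "e \<in> Basis" for e
    proof (rule LIMSEQ_le)
      let ?h = "\<lambda>n. inverse (real (Suc n))"
      have "filterlim ?h (at 0) sequentially"
        using inverse_Suc_at_right_0 by (rule filterlim_mono) (auto simp: at_within_le_at)
      from filterlim_compose[OF barrier_second_difference_lim[OF \<epsilon>(1) e, of p "x - x0"] this]
      have "(\<lambda>n. (barrier p \<epsilon> (x - x0 + ?h n *\<^sub>R e) + barrier p \<epsilon> (x - x0 - ?h n *\<^sub>R e) - 2 * barrier p \<epsilon> (x - x0)) / (?h n)\<^sup>2) \<longlonglongrightarrow> \<Lambda> e"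
        by (simp add: \<Lambda>_def q_def)
      then show "(\<lambda>n. - \<theta> * ((barrier p \<epsilon> (x - x0 + ?h n *\<^sub>R e) + barrier p \<epsilon> (x - x0 - ?h n *\<^sub>R e) - 2 * barrier p \<epsilon> (x - x0)) / (?h n)\<^sup>2)) \<longlonglongrightarrow> - \<theta> * \<Lambda> e"
        by (rule tendsto_mult_left)
      show "(\<lambda>n. (V (?h n *\<^sub>R e) + V (- (?h n *\<^sub>R e)) - 2 * V 0) / (?h n)\<^sup>2) \<longlonglongrightarrow> L e"
        by (rule LF(2)[OF e])
      have "\<forall>\<^sub>F n in sequentially. ?h n < r / 8"
        using LIMSEQ_inverse_real_of_nat r by (intro order_tendstoD(2)) auto
      then obtain n0 where n0: "\<And>n. n0 \<le> n \<Longrightarrow> ?h n < r / 8" by (auto simp: eventually_sequentially)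
      have "- \<theta> * ((barrier p \<epsilon> (x - x0 + ?h n *\<^sub>R e) + barrier p \<epsilon> (x - x0 - ?h n *\<^sub>R e) - 2 * barrier p \<epsilon> (x - x0)) / (?h n)\<^sup>2)
          \<le> (V (?h n *\<^sub>R e) + V (- (?h n *\<^sub>R e)) - 2 * V 0) / (?h n)\<^sup>2" if "n0 \<le> n" for n
      proof -
        have "norm (?h n *\<^sub>R e) < r / 8" using n0[OF that] e by simp
        then have "x + ?h n *\<^sub>R e \<in> cball x0 (3 / 4 * r)" "x - ?h n *\<^sub>R e \<in> cball x0 (3 / 4 * r)"
          using near' norm_triangle_ineq4[of "x0 - x" "?h n *\<^sub>R e"] norm_triangle_ineq[of "x0 - x" "?h n *\<^sub>R e"]
          by (auto simp: dist_norm algebra_simps)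
        from x(2)[OF this(1)] x(2)[OF this(2)]
        have "- \<theta> * (barrier p \<epsilon> (x - x0 + ?h n *\<^sub>R e) + barrier p \<epsilon> (x - x0 - ?h n *\<^sub>R e) - 2 * barrier p \<epsilon> (x - x0))
            \<le> U (x - ?h n *\<^sub>R e) + U (x + ?h n *\<^sub>R e) - 2 * U x"
          by (simp add: \<psi>_def shifted_barrier_def algebra_simps)
        then have "- \<theta> * (barrier p \<epsilon> (x - x0 + ?h n *\<^sub>R e) + barrier p \<epsilon> (x - x0 - ?h n *\<^sub>R e) - 2 * barrier p \<epsilon> (x - x0)) / (?h n)\<^sup>2
            \<le> (U (x - ?h n *\<^sub>R e) + U (x + ?h n *\<^sub>R e) - 2 * U x) / (?h n)\<^sup>2"
          by (rule divide_right_mono) simp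
        then show ?thesis by (simp add: V)
      qed
      then show "\<exists>n0. \<forall>n\<ge>n0. - \<theta> * ((barrier p \<epsilon> (x - x0 + ?h n *\<^sub>R e) + barrier p \<epsilon> (x - x0 - ?h n *\<^sub>R e) - 2 * barrier p \<epsilon> (x - x0)) / (?h n)\<^sup>2)
          \<le> (V (?h n *\<^sub>R e) + V (- (?h n *\<^sub>R e)) - 2 * V 0) / (?h n)\<^sup>2" by blast
    qed
    have "- (\<Sum>e\<in>Basis. L e) \<le> \<theta> * (\<Sum>e\<in>Basis. \<Lambda> e)"
      using sum_mono[of Basis "\<lambda>e. - \<theta> * \<Lambda> e" L] L_ge by (simp add: sum_distrib_left[symmetric] sum_negf)
    also have "\<dots> \<le> \<theta> * (- 4 * p\<^sup>2 * q powr (p - 1))"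
      using barrier_laplacian_le[OF \<epsilon>(1) p dim, of "x - x0"] \<theta>(1)
      unfolding \<Lambda>_def q_def by (intro mult_left_mono) auto
    finally have Lap: "- (\<Sum>e\<in>Basis. L e) \<le> \<theta> * (- 4 * p\<^sup>2 * q powr (p - 1))" .

    \<comment> \<open>The factor \<open>0\<close> is the limit of the volume of the ball of radius \<open>\<delta>\<close>.\<close>
    have F: "F \<le> 3 * (\<alpha> * m) * C1 + \<theta> * (CB * (1 + q powr p) * q powr - s) + b * (r / 4) powr - N * 0 - m * gap"
    proof (rule tendsto_le[OF _ _ LF(3)])
      show "((\<lambda>\<delta>. 3 * (\<alpha> * m) * C1 + \<theta> * (CB * (1 + q powr p) * q powr - s) + b * (r / 4) powr - N * measure lborel (ball x \<delta>) - m * gap)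
          \<longlongrightarrow> 3 * (\<alpha> * m) * C1 + \<theta> * (CB * (1 + q powr p) * q powr - s) + b * (r / 4) powr - N * 0 - m * gap) (at_right 0)"
        by (intro tendsto_intros measure_ball_tendsto_0)
      have "(LINT z::real \<times> (real ^ 'm)|lborel. cut_kern s \<delta> z) * V 0 - (LINT z|lborel. cut_kern s \<delta> z * V z)
         \<le> 3 * (\<alpha> * m) * C1 + \<theta> * (CB * (1 + q powr p) * q powr - s) + b * (r / 4) powr - N * measure lborel (ball x \<delta>) - m * gap"
        if \<delta>: "0 < \<delta>" "\<delta> < \<epsilon> / 4" for \<delta>
      proof -
        have Vint: "integrable lborel (\<lambda>z. cut_kern s \<delta> z * V z)"
          unfolding V_def
        proof (rule correlation_Fubini(1)[OF s(1) u_meas _ u])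
          show "\<phi> \<in> borel_measurable borel" unfolding \<phi>_def by measurable
          show "\<bar>\<phi> y\<bar> \<le> 1 / (LINT y::real \<times> (real ^ 'm)|lborel. bump \<epsilon> y)" for y
            unfolding \<phi>_def by (rule mollifier_bounded[OF \<epsilon>(1)])
          show "\<phi> y = 0" if "norm x + \<epsilon> \<le> norm y" for y
            unfolding \<phi>_def using that norm_triangle_ineq2[of y x] by (intro mollifier_eq_0[OF \<epsilon>(1)]) auto
          show "0 < norm x + \<epsilon>" using \<epsilon> by (simp add: add_nonneg_pos)
        qed (use \<delta> in auto)
        let ?G = "\<lambda>y. U y * cut_kern s \<delta> (y - x)"
        have Gm: "?G \<in> borel_measurable borel" by measurable
        have e: "cut_kern s \<delta> z * V z = ?G (x + - z)" for z by (simp add: V)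
        have Gm': "(\<lambda>z. ?G (x + z)) \<in> borel_measurable borel" by measurable
        have Uint: "integrable lborel ?G"
          using Vint unfolding e lborel_integrable_minus[OF Gm'] lborel_integrable_translation[OF Gm] .
        have eq: "(LINT z|lborel. cut_kern s \<delta> z * V z) = (LINT y|lborel. ?G y)"
          unfolding e lborel_integral_minus[OF Gm'] lborel_integral_translation[OF Gm] ..
        have "(LINT z::real \<times> (real ^ 'm)|lborel. cut_kern s \<delta> z) * U x - (LINT y|lborel. ?G y)
          \<le> 3 * (\<alpha> * m) * C1 + (LINT y|lborel. indicator ?B y * (\<psi> y - \<psi> x) * cut_kern s \<delta> (y - x))
            + b * (r / 4) powr - N * measure lborel (ball x \<delta>)
            - m * reflection_gap N r * measure lborel (ball x0 (7 / 8 * r) - ?B)"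
          unfolding N_def
        proof (rule antisymmetric_trunc_le[OF s(1) r sub U_meas U_anti U_nonneg Uint near' \<delta>(1) _ _ _ \<psi>_meas _ _ _ _ w(1) C1])
          show "\<delta> \<le> r / 8" using \<delta> \<epsilon> r by linarith
          show "0 \<le> m" using m by simp
          show "m \<le> U y" if "y \<in> ball x0 (7 / 8 * r) - ?B" for y
            using that \<epsilon> r by (intro U_ge) auto
          show "0 \<le> \<psi> y" if "y \<in> ?B" for y using that r by (intro \<psi>_nonneg) auto
          show "U y \<le> b" if "y \<in> ?B" for y using that r by (intro b) auto
          show "\<psi> y \<le> b'" if "y \<in> ?B" for y using that r by (intro b') auto
          show "U x + \<psi> x \<le> U y + \<psi> y" if "y \<in> ?B" for y using that by (intro x(2)) auto
        qed
        moreover have "(LINT y|lborel. indicator ?B y * (\<psi> y - \<psi> x) * cut_kern s \<delta> (y - x)) \<le> \<theta> * (CB * (1 + q powr p) * q powr - s)"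
        proof -
          have "(LINT y|lborel. indicator ?B y * (\<psi> y - \<psi> x) * cut_kern s \<delta> (y - x))
            = (LINT y|lborel. \<theta> * (indicator ?B y * (shifted_barrier p r \<epsilon> x0 y - shifted_barrier p r \<epsilon> x0 x) * cut_kern s \<delta> (y - x)))"
            by (intro Bochner_Integration.integral_cong refl) (simp add: \<psi>_def algebra_simps)
          also have "\<dots> = \<theta> * (LINT y|lborel. indicator ?B y * (shifted_barrier p r \<epsilon> x0 y - shifted_barrier p r \<epsilon> x0 x) * cut_kern s \<delta> (y - x))"
            by (rule integral_mult_right_zero)
          also have "\<dots> \<le> \<theta> * (CB * (1 + q powr p) * q powr - s)"
            unfolding q_def using near \<delta> \<theta>(1)
            by (intro mult_left_mono shifted_barrier_integral_le[OF \<epsilon> r _ \<delta>(1) _ CB(2)]) auto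
          finally show ?thesis .
        qed
        moreover have "V 0 = U x" by (simp add: V)
        ultimately show ?thesis unfolding eq gap_def annulus_gain_def N_def by (simp add: mult.assoc)
      qed
      then show "\<forall>\<^sub>F \<delta> in at_right 0. (LINT z::real \<times> (real ^ 'm)|lborel. cut_kern s \<delta> z) * V 0 - (LINT z|lborel. cut_kern s \<delta> z * V z)
         \<le> 3 * (\<alpha> * m) * C1 + \<theta> * (CB * (1 + q powr p) * q powr - s) + b * (r / 4) powr - N * measure lborel (ball x \<delta>) - m * gap"
        using \<epsilon>(1) unfolding eventually_at_right_field by (intro exI[of _ "\<epsilon> / 4"]) auto
    qed simp

    have "U x \<le> \<alpha> * m" using w \<psi>_nonneg[OF xr] by linarith
    then have KU: "K * U x \<le> K * (\<alpha> * m)" using K by (rule mult_left_mono)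
    have csF: "cs * F \<le> cs * (3 * (\<alpha> * m) * C1 + \<theta> * (CB * (1 + q powr p) * q powr - s) - m * gap)"
      using F cs by (intro mult_left_mono) auto
    have "cs * (CB * (1 + q powr p) * q powr - s) \<le> cs * CB * (1 + (2 * r\<^sup>2) powr p) * q powr - s"
    proof -
      have "q powr p \<le> (2 * r\<^sup>2) powr p" using q p by (intro powr_mono2) auto
      then have "CB * (1 + q powr p) * q powr - s \<le> CB * (1 + (2 * r\<^sup>2) powr p) * q powr - s"
        using CB(1) by (intro mult_right_mono mult_left_mono) auto
      then show ?thesis using cs by (simp add: mult.assoc)
    qed
    also have "\<dots> \<le> 4 * p\<^sup>2 * q powr - (1 - p) + M" by (rule M[OF q(1)])
    finally have "\<theta> * (cs * (CB * (1 + q powr p) * q powr - s)) \<le> \<theta> * (4 * p\<^sup>2 * q powr - (1 - p) + M)"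
      using \<theta>(1) by (intro mult_left_mono) auto
    moreover have "m * (\<alpha> * (3 * cs * C1 + K)) \<le> m * (cs * gap / 2)"
      using \<alpha>(3) m(1) unfolding gap_def by (intro mult_left_mono) auto
    moreover have "\<theta> * M < m * (cs * gap / 2)" using \<theta>(2) by (simp add: gap_def)
    ultimately have "- (\<Sum>e\<in>Basis. L e) + cs * F + K * U x < 0"
      using KU csF Lap by (simp add: algebra_simps)
    with test show False by simp
  qed
  also have "\<dots> \<le> U y + \<psi> y" using y by (intro x(2)) auto
  finally show ?thesis by (simp add: U_def \<psi>_def)
qed

text \<open>Away from \<open>x0\<close> the barrier is bounded by a number \<open>T\<close> that depends neither on \<open>\<epsilon>\<close> nor on \<open>\<theta>\<close>; choosing \<open>\<theta>\<close> with
\<open>\<theta> * T \<le> \<kappa>\<close> and then \<open>\<epsilon>\<close> small leaves an error \<open>\<kappa>\<close> only.\<close>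

lemma AE_lower_bound:
  assumes gap: "0 < annulus_gain s r x0"
  shows "AE x in lborel. x \<in> ball x0 r - {x0} \<longrightarrow> \<alpha> * m \<le> u x"
proof -
  define G where "G = m * (cs * annulus_gain s r x0 / 2)"
  have p: "0 < p" "p \<le> 1" using s by (auto simp: p_def)
  have cs: "0 < cs" unfolding cs_def using s by (rule frac_const_pos)
  have G: "0 < G" using gap cs m by (simp add: G_def)
  obtain M where M: "\<And>q. 0 < q \<Longrightarrow> cs * CB * (1 + (2 * r\<^sup>2) powr p) * q powr - s \<le> 4 * p\<^sup>2 * q powr - (1 - p) + M"
    by (rule absorb_weaker_power[of "cs * CB * (1 + (2 * r\<^sup>2) powr p)" "4 * p\<^sup>2" s "1 - p"])
       (use s cs CB(1) p in \<open>auto simp: p_def field_simps intro!: add_pos_nonneg\<close>)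
  have inner: "AE x in lborel. x \<in> ball x0 (3 / 4 * r) - ball x0 \<tau> \<longrightarrow> \<alpha> * m \<le> u x" if \<tau>: "0 < \<tau>" for \<tau>
  proof (rule AE_ge_of_mollify[OF s(1) u_meas u])
    fix \<kappa> :: real assume \<kappa>: "0 < \<kappa>"
    define T where "T = ln (2 * r\<^sup>2) + (2 * r\<^sup>2) powr p - ln (\<tau>\<^sup>2)"
    define \<theta> where "\<theta> = min (\<kappa> / (\<bar>T\<bar> + 1)) (G / (2 * (\<bar>M\<bar> + 1)))"
    have \<theta>: "0 < \<theta>" using \<kappa> G by (simp add: \<theta>_def)
    have \<theta>T: "\<theta> * T \<le> \<kappa>"
    proof -
      have "\<theta> * T \<le> \<theta> * (\<bar>T\<bar> + 1)" using \<theta> by (intro mult_left_mono) auto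
      also have "\<dots> \<le> \<kappa> / (\<bar>T\<bar> + 1) * (\<bar>T\<bar> + 1)" by (intro mult_right_mono) (auto simp: \<theta>_def)
      also have "\<dots> = \<kappa>" by simp
      finally show ?thesis .
    qed
    have \<theta>M: "\<theta> * M < G"
    proof -
      have "\<theta> * M \<le> \<theta> * (\<bar>M\<bar> + 1)" using \<theta> by (intro mult_left_mono) auto
      also have "\<dots> \<le> G / (2 * (\<bar>M\<bar> + 1)) * (\<bar>M\<bar> + 1)" by (intro mult_right_mono) (auto simp: \<theta>_def)
      also have "\<dots> = G / 2" by (simp add: field_simps)
      finally show ?thesis using G by simp
    qed
    \<comment> \<open>Below this radius \<open>ln (r\<^sup>2) - ln (\<epsilon>\<^sup>2) \<ge> \<alpha> * m / \<theta>\<close>, the height the barrier must reach near \<open>x0\<close>.\<close>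
    define \<epsilon>0 where "\<epsilon>0 = min (r / 16) (r * exp (- (\<alpha> * m / (2 * \<theta>))))"
    have "0 < \<epsilon>0" using r by (simp add: \<epsilon>0_def)
    moreover have "\<alpha> * m - \<kappa> \<le> mollify u \<epsilon> x" if \<epsilon>: "0 < \<epsilon>" "\<epsilon> < \<epsilon>0" and x: "x \<in> ball x0 (3 / 4 * r) - ball x0 \<tau>" for \<epsilon> x
    proof -
      have \<epsilon>r: "\<epsilon> \<le> r / 16" using \<epsilon> by (simp add: \<epsilon>0_def)
      have blowup: "\<alpha> * m \<le> \<theta> * shifted_barrier p r \<epsilon> x0 y" if "dist x0 y \<le> \<epsilon>" for y
      proof -
        have "ln \<epsilon> \<le> ln (r * exp (- (\<alpha> * m / (2 * \<theta>))))"
          using \<epsilon> r by (intro ln_mono) (auto simp: \<epsilon>0_def)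
        also have "\<dots> = ln r - \<alpha> * m / (2 * \<theta>)" using r by (simp add: ln_mult)
        finally have "\<alpha> * m / \<theta> \<le> ln (2 * r\<^sup>2) - ln (2 * \<epsilon>\<^sup>2)"
          using \<epsilon> r \<theta> by (simp add: ln_mult ln_realpow field_simps)
        also have "\<dots> \<le> shifted_barrier p r \<epsilon> x0 y"
          using \<epsilon> \<epsilon>r r that p by (intro shifted_barrier_ge) auto
        finally have "\<theta> * (\<alpha> * m / \<theta>) \<le> \<theta> * shifted_barrier p r \<epsilon> x0 y" using \<theta> by (intro mult_left_mono) auto
        then show ?thesis using \<theta> by simp
      qed
      have "\<alpha> * m \<le> mollify u \<epsilon> x + \<theta> * shifted_barrier p r \<epsilon> x0 x"
        by (rule mollify_lower_bound[OF M \<theta> _ \<epsilon>(1) \<epsilon>r blowup]) (use \<theta>M x in \<open>auto simp: G_def\<close>)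
      moreover have "\<theta> * shifted_barrier p r \<epsilon> x0 x \<le> \<theta> * T"
        unfolding T_def using \<theta> x \<tau> \<epsilon>(1) by (intro mult_left_mono shifted_barrier_le) auto
      ultimately show ?thesis using \<theta>T by linarith
    qed
    ultimately show "\<exists>\<epsilon>0>0. \<forall>\<epsilon>. 0 < \<epsilon> \<and> \<epsilon> < \<epsilon>0 \<longrightarrow> (\<forall>x\<in>ball x0 (3 / 4 * r) - ball x0 \<tau>. \<alpha> * m - \<kappa> \<le> mollify u \<epsilon> x)"
      by blast
  qed simp
  have "AE x in lborel. \<forall>n. x \<in> ball x0 (3 / 4 * r) - ball x0 (inverse (real (Suc n))) \<longrightarrow> \<alpha> * m \<le> u x"
    unfolding AE_all_countable using inner by simp
  with m(2) show ?thesis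
  proof eventually_elim
    case (elim x)
    show ?case
    proof
      assume x: "x \<in> ball x0 r - {x0}"
      show "\<alpha> * m \<le> u x"
      proof (cases "dist x0 x < 3 / 4 * r")
        case True
        have "0 < dist x0 x" using x by auto
        then obtain n where "inverse (real (Suc n)) < dist x0 x" using reals_Archimedean by blast
        with True have "x \<in> ball x0 (3 / 4 * r) - ball x0 (inverse (real (Suc n)))" by auto
        with elim(2) show ?thesis by blast
      next
        case False
        then have "x \<in> ball x0 r - ball x0 (r / 2)" using x r by auto
        with elim(1) have "m \<le> u x" by blast
        moreover have "\<alpha> * m \<le> m" using \<alpha> m by simp
        ultimately show ?thesis by linarith
      qed
    qed
  qed
qed

end

section \<open>A constant independent of ball and function\<close>

text \<open>All constants scale: the annulus gain and the tail of the kernel are multiples of \<open>r powr - (2 * s)\<close>. The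
condition on \<open>\<alpha>\<close> thus involves \<open>K\<close> and \<open>r\<close> only through \<open>r powr (2 * s) * K\<close>.\<close>

theorem uniform_lower_bound:
  fixes s :: real
  assumes s: "0 < s" "s < 1"
  obtains \<alpha> :: "real \<Rightarrow> real" where "\<And>K. 0 \<le> K \<Longrightarrow> 0 < \<alpha> K"
    and "\<And>K K'. 0 \<le> K \<Longrightarrow> K \<le> K' \<Longrightarrow> \<alpha> K' \<le> \<alpha> K"
    and "\<And>(x0 :: real \<times> (real ^ 'm)) r u m K. 0 < r \<Longrightarrow> ball x0 r \<subseteq> half_space \<Longrightarrow>
      u \<in> borel_measurable borel \<Longrightarrow> integrable lborel (\<lambda>y. u y * tail_weight s y) \<Longrightarrow>
      AE x in lborel. x \<in> half_space \<longrightarrow> u (reflect x) = - u x \<Longrightarrow>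
      AE x in lborel. x \<in> half_space \<longrightarrow> 0 \<le> u x \<Longrightarrow> 0 \<le> K \<Longrightarrow>
      (\<And>\<phi>. \<phi> \<in> test_functions (ball x0 r - {x0}) \<Longrightarrow> \<forall>x. 0 \<le> \<phi> x \<Longrightarrow>
        0 \<le> mixed_op_distr s u \<phi> + K * (LINT y|lborel. u y * \<phi> y)) \<Longrightarrow> 0 < m \<Longrightarrow>
      AE y in lborel. y \<in> ball x0 r - ball x0 (r / 2) \<longrightarrow> m \<le> u y \<Longrightarrow>
      AE x in lborel. x \<in> ball x0 r - {x0} \<longrightarrow> \<alpha> (r powr (2 * s) * K) * m \<le> u x"
proof -
  let ?D = "DIM(real \<times> (real ^ 'm))"
  define N where "N = real ?D + 2 * s"
  define cs where "cs = frac_const ?D s"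
  define \<omega> where "\<omega> = unit_ball_vol (real ?D)"
  define a0 where "a0 = 2 powr - N * (1 - (32 / 33) powr (N / 2)) * (\<omega> * ((7 / 8) ^ ?D - (3 / 4) ^ ?D))"
  have cs: "0 < cs" unfolding cs_def using s by (rule frac_const_pos)
  have N: "0 < N" using s by (simp add: N_def add_nonneg_pos)
  have dim: "2 \<le> ?D" using zero_less_card_finite[where 'a='m] by simp
  have a0: "0 < a0"
  proof -
    have "(32 / 33 :: real) powr (N / 2) < 1" using powr_less_mono2[of "N / 2" "32 / 33" 1] N by simp
    moreover have "(3 / 4 :: real) ^ ?D < (7 / 8) ^ ?D" by (intro power_strict_mono) auto
    moreover have "0 < \<omega>" unfolding \<omega>_def by (intro unit_ball_vol_pos) simp
    ultimately show ?thesis unfolding a0_def by (intro mult_pos_pos) auto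
  qed
  obtain C1 where C1: "0 < C1" "\<And>\<rho>. 0 < \<rho> \<Longrightarrow> integrable lborel (cut_kern s \<rho> :: real \<times> (real ^ 'm) \<Rightarrow> real) \<and>
    (LINT z::real \<times> (real ^ 'm)|lborel. cut_kern s \<rho> z) \<le> C1 * \<rho> powr - (2 * s)"
    using cut_kern_integral_bound[OF s(1), where 'a="real \<times> (real ^ 'm)"] by blast
  have p: "0 < (1 - s) / 2" "(1 - s) / 2 \<le> 1" using s by auto
  obtain CB where CB: "0 < CB" "\<And>(x::real \<times> (real ^ 'm)) \<eta> \<delta> S. 0 < \<eta> \<Longrightarrow> 0 < \<delta> \<Longrightarrow> \<delta> \<le> sqrt (regularised_sq \<eta> x) / 4 \<Longrightarrow>
      S \<in> sets borel \<Longrightarrow> bounded S \<Longrightarrow> ball x (sqrt (regularised_sq \<eta> x) / 4) \<subseteq> S \<Longrightarrow>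
      (LINT y|lborel. indicator S y * (barrier ((1 - s) / 2) \<eta> y - barrier ((1 - s) / 2) \<eta> x) * cut_kern s \<delta> (y - x))
        \<le> CB * (1 + regularised_sq \<eta> x powr ((1 - s) / 2)) * regularised_sq \<eta> x powr - s"
    using barrier_integral_le[OF s dim p] by blast
  define D where "D K = 3 * cs * (C1 * 8 powr (2 * s)) + K" for K
  define \<alpha> where "\<alpha> K = min 1 (cs * a0 / 2 / D K)" for K
  have D: "0 < D K" if "0 \<le> K" for K using cs C1 that by (simp add: D_def add_pos_nonneg)
  have pos: "0 < \<alpha> K" if "0 \<le> K" for K using D[OF that] cs a0 by (simp add: \<alpha>_def)
  have mono: "\<alpha> K' \<le> \<alpha> K" if "0 \<le> K" "K \<le> K'" for K K'
    unfolding \<alpha>_def using that D[of K] D[of K'] cs a0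
    by (intro min.mono divide_left_mono) (auto simp: D_def)
  have "AE x in lborel. x \<in> ball x0 r - {x0} \<longrightarrow> \<alpha> (r powr (2 * s) * K) * m \<le> u x"
    if r: "0 < r" and sub: "ball x0 r \<subseteq> half_space"
      and u: "u \<in> borel_measurable borel" "integrable lborel (\<lambda>y. u y * tail_weight s y)"
      and anti: "AE x in lborel. x \<in> half_space \<longrightarrow> u (reflect x) = - u x"
      and nonneg: "AE x in lborel. x \<in> half_space \<longrightarrow> 0 \<le> u x" and K: "0 \<le> K"
      and eqn: "\<And>\<phi>. \<phi> \<in> test_functions (ball x0 r - {x0}) \<Longrightarrow> \<forall>x. 0 \<le> \<phi> x \<Longrightarrow>
        0 \<le> mixed_op_distr s u \<phi> + K * (LINT y|lborel. u y * \<phi> y)"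
      and m: "0 < m" "AE y in lborel. y \<in> ball x0 r - ball x0 (r / 2) \<longrightarrow> m \<le> u y"
    for x0 :: "real \<times> (real ^ 'm)" and r u m K
  proof -
    define K' where "K' = r powr (2 * s) * K"
    have K': "0 \<le> K'" using K by (simp add: K'_def)
    let ?gap = "annulus_gain s r x0"
    have "measure lborel (ball x0 (7 / 8 * r) - ball x0 (3 / 4 * r)) = measure lborel (ball x0 (7 / 8 * r)) - measure lborel (ball x0 (3 / 4 * r))"
      using r emeasure_lborel_ball_finite[of x0 "7 / 8 * r"] by (intro measure_Diff) (auto simp: subset_ball)
    also have "\<dots> = \<omega> * ((7 / 8) ^ ?D - (3 / 4) ^ ?D) * r ^ ?D"
      using r by (simp only: content_ball \<omega>_def power_mult_distrib algebra_simps)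
    finally have "?gap = a0 * (r powr - N * r ^ ?D)"
      using r by (simp add: annulus_gain_def N_def[symmetric] reflection_gap_def a0_def powr_mult del: DIM_prod)
    also have "r powr - N * r ^ ?D = r powr - (2 * s)"
    proof -
      have "r powr - (real d + 2 * s) * r ^ d = r powr - (2 * s)" for d
        using r by (simp add: powr_realpow[symmetric] powr_add[symmetric])
      then show ?thesis unfolding N_def .
    qed
    finally have gap: "?gap = a0 * r powr - (2 * s)" .
    have c: "C1 * (r / 8) powr - (2 * s) = C1 * 8 powr (2 * s) * r powr - (2 * s)"
      using r by (simp add: powr_divide powr_minus field_simps)
    have KK: "K = K' * r powr - (2 * s)"
      using r by (simp add: K'_def powr_minus field_simps)
    have "\<alpha> K' * D K' \<le> cs * a0 / 2"
    proof -
      have "\<alpha> K' * D K' \<le> cs * a0 / 2 / D K' * D K'"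
        using D[OF K'] by (intro mult_right_mono) (auto simp: \<alpha>_def)
      then show ?thesis using D[OF K'] by simp
    qed
    then have "\<alpha> K' * D K' * r powr - (2 * s) \<le> cs * a0 / 2 * r powr - (2 * s)" by (rule mult_right_mono) simp
    moreover have "D K' * r powr - (2 * s) = 3 * cs * (C1 * (r / 8) powr - (2 * s)) + K"
      unfolding c by (subst KK) (simp add: D_def algebra_simps)
    ultimately have \<alpha>3: "\<alpha> K' * (3 * cs * (C1 * (r / 8) powr - (2 * s)) + K) \<le> cs * ?gap / 2"
      unfolding gap by (simp add: mult.assoc)
    show ?thesis
      unfolding K'_def[symmetric]
    proof (rule AE_lower_bound[OF s refl refl u r sub anti nonneg K eqn m pos[OF K'] _ _ _ _ CB])
      show "0 < ?gap" using gap a0 r by simp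
    qed (use \<alpha>3 C1(2)[of "r / 8"] r in \<open>auto simp: \<alpha>_def cs_def\<close>)
  qed
  from that[OF pos mono this] show ?thesis .
qed

text \<open>Everything in the statement depends on \<open>u\<close> only up to null sets, so a Borel representative
and Borel-Lebesgue measure suffice; this keeps product measures and Fubini simple.\<close>

lemma L2s_space_borel:
  fixes u :: "'a::euclidean_space \<Rightarrow> real"
  assumes "u \<in> L2s_space s"
  obtains u' where "u \<in> borel_measurable lebesgue" "u' \<in> borel_measurable borel" "AE x in lborel. u x = u' x"
    "integrable lborel (\<lambda>y. u' y * tail_weight s y)"
proof -
  from assms have K: "\<And>K. compact K \<Longrightarrow> u absolutely_integrable_on K"
    and w: "integrable lebesgue (\<lambda>x. \<bar>u x\<bar> / (1 + norm x powr (real DIM('a) + 2 * s)))"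
    by (auto simp: L2s_space_def)
  have u: "u \<in> borel_measurable lebesgue"
  proof (rule borel_measurable_LIMSEQ_real)
    fix x :: 'a
    obtain N where "norm x \<le> real N" using real_arch_simple by blast
    then have "\<forall>\<^sub>F n in sequentially. indicator (cball 0 (real n)) x *\<^sub>R u x = u x"
      by (intro eventually_sequentiallyI[of N]) (auto simp: indicator_def)
    then show "(\<lambda>n. indicator (cball 0 (real n)) x *\<^sub>R u x) \<longlonglongrightarrow> u x" by (rule tendsto_eventually)
  next
    fix n :: nat
    show "(\<lambda>x. indicator (cball 0 (real n)) x *\<^sub>R u x) \<in> borel_measurable lebesgue"
      using K[of "cball 0 (real n)"] unfolding set_integrable_def by (intro borel_measurable_integrable) auto
  qed
  then obtain u' where u' [measurable]: "u' \<in> borel_measurable lborel" and ae: "AE x in lborel. u x = u' x"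
    using completion_ex_borel_measurable_real by blast
  have "integrable lebesgue (\<lambda>x. \<bar>u' x * tail_weight s x\<bar>)"
  proof (rule integrable_cong_AE_imp[OF w])
    show "(\<lambda>x. \<bar>u' x * tail_weight s x\<bar>) \<in> borel_measurable lebesgue"
      by (rule measurable_completion) measurable
    show "AE x in lebesgue. \<bar>u x\<bar> / (1 + norm x powr (real DIM('a) + 2 * s)) = \<bar>u' x * tail_weight s x\<bar>"
    proof (rule AE_completion)
      show "AE x in lborel. \<bar>u x\<bar> / (1 + norm x powr (real DIM('a) + 2 * s)) = \<bar>u' x * tail_weight s x\<bar>"
        using ae
      proof eventually_elim
        case (elim x)
        have "0 < tail_weight s x" by (rule tail_weight_pos)
        then have "\<bar>tail_weight s x\<bar> = tail_weight s x" by simp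
        then show ?case using elim by (simp add: abs_mult) (simp add: tail_weight_def)
      qed
    qed
  qed
  then have "integrable lborel (\<lambda>x. \<bar>u' x * tail_weight s x\<bar>)"
    by (subst (asm) integrable_completion) measurable
  then have "integrable lborel (\<lambda>x. u' x * tail_weight s x)"
    by (rule integrable_abs_cancel) measurable
  with u u' ae show ?thesis by (intro that[of u']) auto
qed

text \<open>As the set has positive measure, the essential supremum is nonnegative and finite, and its conversion to a
real number loses nothing.\<close>

lemma Linf_norm_bound:
  fixes S :: "'a::euclidean_space set"
  assumes S: "S \<in> sets borel" "emeasure lborel S \<noteq> 0" and c: "c \<in> Linf_space S"
  shows "0 \<le> Linf_norm S (\<lambda>x. max (c x) 0)"
    and "AE x in lborel. x \<in> S \<longrightarrow> c x \<le> Linf_norm S (\<lambda>x. max (c x) 0)"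
proof -
  define e where "e = esssup (lebesgue_on S) (\<lambda>x. ereal \<bar>max (c x) 0\<bar>)"
  have cm [measurable]: "c \<in> borel_measurable (lebesgue_on S)" and fin: "esssup (lebesgue_on S) (\<lambda>x. ereal \<bar>c x\<bar>) < \<infinity>"
    using c by (auto simp: Linf_space_def)
  have "e \<le> esssup (lebesgue_on S) (\<lambda>x. ereal \<bar>c x\<bar>)"
    unfolding e_def by (rule esssup_AE_mono) auto
  then have e_fin: "e < \<infinity>" using fin by (rule le_less_trans)
  have ae: "AE x in lebesgue_on S. ereal \<bar>max (c x) 0\<bar> \<le> e"
    unfolding e_def by (rule esssup_AE)
  have "emeasure (lebesgue_on S) (space (lebesgue_on S)) \<noteq> 0"
    using S by (simp add: emeasure_restrict_space)
  then have "ae_filter (lebesgue_on S) \<noteq> bot" by (simp add: ae_filter_eq_bot_iff)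
  from eventually_happens'[OF this ae] obtain x where "ereal \<bar>max (c x) 0\<bar> \<le> e" by blast
  moreover have "0 \<le> ereal \<bar>max (c x) 0\<bar>" by (simp only: ereal_less_eq(5) abs_ge_zero)
  ultimately have e0: "0 \<le> e" by (rule order.trans[rotated])
  have e: "ereal (Linf_norm S (\<lambda>x. max (c x) 0)) = e"
    unfolding Linf_norm_def e_def[symmetric] using e0 e_fin by (intro ereal_real') auto
  with e0 show "0 \<le> Linf_norm S (\<lambda>x. max (c x) 0)"
    by (metis ereal_less_eq(5))
  have "AE x in lebesgue_on S. c x \<le> Linf_norm S (\<lambda>x. max (c x) 0)"
    using ae unfolding e[symmetric] by eventually_elim auto
  then have "AE x in lebesgue. x \<in> S \<longrightarrow> c x \<le> Linf_norm S (\<lambda>x. max (c x) 0)"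
    using S by (subst (asm) AE_restrict_space_iff) auto
  then show "AE x in lborel. x \<in> S \<longrightarrow> c x \<le> Linf_norm S (\<lambda>x. max (c x) 0)"
    by (simp add: AE_completion_iff)
qed

text \<open>The coefficient is replaced by its upper bound, which is legitimate because \<open>u\<close> and the test function are
nonnegative on the ball. The comparison of integrals holds whether or not the smaller integrand is
integrable, for otherwise its integral is zero.\<close>

lemma weak_inequality_borel:
  fixes u u' c :: "real \<times> (real ^ 'm) \<Rightarrow> real"
  assumes s: "0 < s" "s < 1" and u: "u \<in> borel_measurable lebesgue" and u' [measurable]: "u' \<in> borel_measurable borel"
    and ae: "AE x in lborel. u x = u' x" and int: "integrable lborel (\<lambda>y. u' y * tail_weight s y)"
    and sub: "ball x0 r \<subseteq> half_space"
    and nonneg: "AE x in lborel. x \<in> half_space \<longrightarrow> 0 \<le> u' x"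
    and c: "AE x in lborel. x \<in> ball x0 r \<longrightarrow> c x \<le> K" and K: "0 \<le> K"
    and eqn: "distr_nonneg (ball x0 r - {x0})
        (\<lambda>\<phi>. mixed_op_distr s u \<phi> + regular_distr (ball x0 r - {x0}) (\<lambda>x. c x * u x) \<phi>)"
    and \<phi>: "\<phi> \<in> test_functions (ball x0 r - {x0})" "\<forall>x. 0 \<le> \<phi> x"
  shows "0 \<le> mixed_op_distr s u' \<phi> + K * (LINT y|lborel. u' y * \<phi> y)"
proof -
  let ?\<Omega> = "ball x0 r - {x0}"
  have dim: "2 \<le> DIM(real \<times> (real ^ 'm))" using zero_less_card_finite[where 'a='m] by simp
  have ae': "AE x in lebesgue. u x = u' x" using ae by (rule AE_completion)
  obtain L :: "real \<times> (real ^ 'm) \<Rightarrow> real" and F where [measurable]: "mixed_op s \<phi> \<in> borel_measurable borel"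
    using mixed_op_distr_limit[OF s dim u' int \<phi>(1)] by blast
  have mix: "mixed_op_distr s u \<phi> = mixed_op_distr s u' \<phi>"
    unfolding mixed_op_distr_def
  proof (rule integral_cong_AE)
    have "mixed_op s \<phi> \<in> borel_measurable lebesgue" "u' \<in> borel_measurable lebesgue"
      by (rule measurable_completion, measurable)+
    then show "(\<lambda>x. u x * mixed_op s \<phi> x) \<in> borel_measurable lebesgue" "(\<lambda>x. u' x * mixed_op s \<phi> x) \<in> borel_measurable lebesgue"
      using u by auto
    show "AE x in lebesgue. u x * mixed_op s \<phi> x = u' x * mixed_op s \<phi> x"
      using ae' by eventually_elim simp
  qed
  note c\<phi> = test_functions_continuous[OF \<phi>(1)] and k\<phi> = test_functions_compact[OF \<phi>(1)]
  have [measurable]: "\<phi> \<in> borel_measurable borel" using c\<phi> by (rule borel_measurable_continuous_onI)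
  have supp: "\<phi> x = 0" if "x \<notin> ?\<Omega>" for x
    using \<phi>(1) that closure_subset[of "{x. \<phi> x \<noteq> 0}"] unfolding test_functions_def by blast
  have u\<phi>_int: "integrable lborel (\<lambda>y. u' y * \<phi> y)"
  proof -
    obtain B where B: "\<And>z. \<bar>\<phi> z\<bar> \<le> B" using bounded_of_compact_support[OF c\<phi> k\<phi>] by auto
    show ?thesis
    proof (rule integrable_locally[OF s(1) u' _ int B])
      show "\<phi> y = 0" if "norm x0 + r \<le> norm y" for y
      proof (rule supp)
        have "norm y \<le> norm x0 + dist x0 y" using norm_triangle_sub[of y x0] by (simp add: dist_norm norm_minus_commute)
        then show "y \<notin> ?\<Omega>" using that by auto
      qed
    qed measurable
  qed
  have "regular_distr ?\<Omega> (\<lambda>x. c x * u x) \<phi> = (LINT x|lebesgue. indicator ?\<Omega> x *\<^sub>R (c x * u x * \<phi> x))"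
    by (simp add: regular_distr_def set_lebesgue_integral_def)
  also have "\<dots> \<le> (LINT x|lebesgue. K * (u' x * \<phi> x))"
  proof (rule integral_mono_AE')
    show "integrable lebesgue (\<lambda>x. K * (u' x * \<phi> x))"
      using u\<phi>_int by (subst integrable_completion) auto
    have "AE x in lborel. 0 \<le> K * (u' x * \<phi> x) \<and> indicator ?\<Omega> x *\<^sub>R (c x * u x * \<phi> x) \<le> K * (u' x * \<phi> x)"
      using ae nonneg c
    proof eventually_elim
      case (elim x)
      show ?case
      proof (cases "x \<in> ?\<Omega>")
        case True
        have "0 \<le> \<phi> x" using \<phi>(2) by blast
        then have "0 \<le> u' x * \<phi> x" using True elim sub by (intro mult_nonneg_nonneg) auto
        moreover have "c x \<le> K" using True elim by auto
        ultimately show ?thesis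
          using True elim K by (simp add: mult.assoc mult_right_mono)
      qed (simp add: supp)
    qed
    then have *: "AE x in lebesgue. 0 \<le> K * (u' x * \<phi> x) \<and> indicator ?\<Omega> x *\<^sub>R (c x * u x * \<phi> x) \<le> K * (u' x * \<phi> x)"
      by (rule AE_completion)
    show "AE x in lebesgue. indicator ?\<Omega> x *\<^sub>R (c x * u x * \<phi> x) \<le> K * (u' x * \<phi> x)"
      using * by eventually_elim simp
    show "AE x in lebesgue. 0 \<le> K * (u' x * \<phi> x)"
      using * by eventually_elim simp
  qed
  also have "\<dots> = (LINT x|lborel. K * (u' x * \<phi> x))" by (rule integral_completion) measurable
  finally have "regular_distr ?\<Omega> (\<lambda>x. c x * u x) \<phi> \<le> K * (LINT y|lborel. u' y * \<phi> y)" by simp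
  moreover have "0 \<le> mixed_op_distr s u \<phi> + regular_distr ?\<Omega> (\<lambda>x. c x * u x) \<phi>"
    using eqn \<phi> unfolding distr_nonneg_def by blast
  ultimately show ?thesis using mix by simp
qed

theorem theorem1p4:
  fixes s :: real
  assumes "0 < s" and "s < 1"
  shows "\<exists>(\<alpha> :: real \<Rightarrow> real) (\<alpha>1 :: real \<Rightarrow> real) (\<alpha>0 :: real).
    (\<forall>K\<ge>0. 0 < \<alpha> K) \<and> (\<forall>K\<ge>0. 0 < \<alpha>1 K) \<and> 0 < \<alpha>0 \<and>
    (\<forall>(x0 :: real \<times> (real ^ 'm)) (r :: real)
      (c :: real \<times> (real ^ 'm) \<Rightarrow> real) (u :: real \<times> (real ^ 'm) \<Rightarrow> real) (m :: real).
      0 < r \<longrightarrow>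
      ball x0 r \<subseteq> half_space \<longrightarrow>
      c \<in> Linf_space (ball x0 r) \<longrightarrow>
      u \<in> L2s_space s \<longrightarrow>
      (AE x in lebesgue. x \<in> half_space \<longrightarrow> u (reflect x) = - u x) \<longrightarrow>
      (AE x in lebesgue. x \<in> half_space \<longrightarrow> 0 \<le> u x) \<longrightarrow>
      distr_nonneg (ball x0 r - {x0})
        (\<lambda>\<phi>. mixed_op_distr s u \<phi> + regular_distr (ball x0 r - {x0}) (\<lambda>x. c x * u x) \<phi>) \<longrightarrow>
      0 < m \<longrightarrow>
      (AE x in lebesgue. x \<in> ball x0 r - ball x0 (r / 2) \<longrightarrow> m \<le> u x) \<longrightarrow>
        (AE x in lebesgue. x \<in> ball x0 r - {x0} \<longrightarrow>
          \<alpha> (r powr (2 * s) * Linf_norm (ball x0 r) (\<lambda>x. max (c x) 0)) * m \<le> u x) \<and>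
        (r \<le> 1 \<longrightarrow>
          (AE x in lebesgue. x \<in> ball x0 r - {x0} \<longrightarrow>
            \<alpha>1 (Linf_norm (ball x0 r) (\<lambda>x. max (c x) 0)) * m \<le> u x)) \<and>
        ((AE x in lebesgue. x \<in> ball x0 r \<longrightarrow> c x \<le> 0) \<longrightarrow>
          (AE x in lebesgue. x \<in> ball x0 r - {x0} \<longrightarrow> \<alpha>0 * m \<le> u x)))"
proof (rule uniform_lower_bound[OF assms, where 'm='m])
  note s = assms
  fix \<alpha> :: "real \<Rightarrow> real"
  assume pos: "\<And>K. 0 \<le> K \<Longrightarrow> 0 < \<alpha> K"
    and mono: "\<And>K K'. 0 \<le> K \<Longrightarrow> K \<le> K' \<Longrightarrow> \<alpha> K' \<le> \<alpha> K"
    and bound: "\<And>(x0 :: real \<times> (real ^ 'm)) r u m K. 0 < r \<Longrightarrow> ball x0 r \<subseteq> half_space \<Longrightarrow>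
      u \<in> borel_measurable borel \<Longrightarrow> integrable lborel (\<lambda>y. u y * tail_weight s y) \<Longrightarrow>
      AE x in lborel. x \<in> half_space \<longrightarrow> u (reflect x) = - u x \<Longrightarrow>
      AE x in lborel. x \<in> half_space \<longrightarrow> 0 \<le> u x \<Longrightarrow> 0 \<le> K \<Longrightarrow>
      (\<And>\<phi>. \<phi> \<in> test_functions (ball x0 r - {x0}) \<Longrightarrow> \<forall>x. 0 \<le> \<phi> x \<Longrightarrow>
        0 \<le> mixed_op_distr s u \<phi> + K * (LINT y|lborel. u y * \<phi> y)) \<Longrightarrow> 0 < m \<Longrightarrow>
      AE y in lborel. y \<in> ball x0 r - ball x0 (r / 2) \<longrightarrow> m \<le> u y \<Longrightarrow>
      AE x in lborel. x \<in> ball x0 r - {x0} \<longrightarrow> \<alpha> (r powr (2 * s) * K) * m \<le> u x"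
  show ?thesis
  proof (rule exI[of _ \<alpha>], rule exI[of _ \<alpha>], rule exI[of _ "\<alpha> 0"], intro conjI allI impI)
    show "0 < \<alpha> K" "0 < \<alpha> K" if "0 \<le> K" for K by (rule pos[OF that])+
    show "0 < \<alpha> 0" by (rule pos) simp
    fix x0 :: "real \<times> (real ^ 'm)" and r m :: real and c u :: "real \<times> (real ^ 'm) \<Rightarrow> real"
    assume r: "0 < r" and sub: "ball x0 r \<subseteq> half_space" and c: "c \<in> Linf_space (ball x0 r)"
      and u: "u \<in> L2s_space s"
      and anti: "AE x in lebesgue. x \<in> half_space \<longrightarrow> u (reflect x) = - u x"
      and nonneg: "AE x in lebesgue. x \<in> half_space \<longrightarrow> 0 \<le> u x"
      and eqn: "distr_nonneg (ball x0 r - {x0})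
        (\<lambda>\<phi>. mixed_op_distr s u \<phi> + regular_distr (ball x0 r - {x0}) (\<lambda>x. c x * u x) \<phi>)"
      and m: "0 < m" and ge: "AE x in lebesgue. x \<in> ball x0 r - ball x0 (r / 2) \<longrightarrow> m \<le> u x"
    obtain u' where u': "u \<in> borel_measurable lebesgue" "u' \<in> borel_measurable borel" "AE x in lborel. u x = u' x"
      "integrable lborel (\<lambda>y. u' y * tail_weight s y)"
      using L2s_space_borel[OF u] by blast
    have anti': "AE x in lborel. x \<in> half_space \<longrightarrow> u' (reflect x) = - u' x"
      using anti[unfolded AE_completion_iff] u'(3) AE_reflect[OF u'(3)] by eventually_elim auto
    have nonneg': "AE x in lborel. x \<in> half_space \<longrightarrow> 0 \<le> u' x"
      using nonneg[unfolded AE_completion_iff] u'(3) by eventually_elim auto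
    have ge': "AE x in lborel. x \<in> ball x0 r - ball x0 (r / 2) \<longrightarrow> m \<le> u' x"
      using ge[unfolded AE_completion_iff] u'(3) by eventually_elim auto
    have main: "AE x in lebesgue. x \<in> ball x0 r - {x0} \<longrightarrow> \<alpha> (r powr (2 * s) * K) * m \<le> u x"
      if K: "0 \<le> K" "AE x in lborel. x \<in> ball x0 r \<longrightarrow> c x \<le> K" for K
    proof -
      have "AE x in lborel. x \<in> ball x0 r - {x0} \<longrightarrow> \<alpha> (r powr (2 * s) * K) * m \<le> u' x"
        by (rule bound[OF r sub u'(2,4) anti' nonneg' K(1) weak_inequality_borel[OF s u' sub nonneg' K(2,1) eqn] m ge'])
      with u'(3) have "AE x in lborel. x \<in> ball x0 r - {x0} \<longrightarrow> \<alpha> (r powr (2 * s) * K) * m \<le> u x"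
        by eventually_elim auto
      then show ?thesis by (rule AE_completion)
    qed
    let ?K = "Linf_norm (ball x0 r) (\<lambda>x. max (c x) 0)"
    have "emeasure lborel (ball x0 r) \<noteq> 0"
    proof -
      have "unit_ball_vol (1 + real CARD('m)) \<noteq> 0"
        using unit_ball_vol_pos[of "1 + real CARD('m)"] by linarith
      then show ?thesis using r by (simp add: emeasure_ball)
    qed
    note K = Linf_norm_bound[OF _ this c, simplified]
    show *: "AE x in lebesgue. x \<in> ball x0 r - {x0} \<longrightarrow> \<alpha> (r powr (2 * s) * ?K) * m \<le> u x"
      by (rule main) (use K in auto)
    show "AE x in lebesgue. x \<in> ball x0 r - {x0} \<longrightarrow> \<alpha> ?K * m \<le> u x" if "r \<le> 1"
    proof -
      have "r powr (2 * s) \<le> 1" using r that s by (intro powr_le1) auto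
      then have "r powr (2 * s) * ?K \<le> ?K" using K(1) by (simp add: mult_left_le_one_le)
      then have "\<alpha> ?K \<le> \<alpha> (r powr (2 * s) * ?K)" using K(1) by (intro mono) auto
      then have "\<alpha> ?K * m \<le> \<alpha> (r powr (2 * s) * ?K) * m" using m by (intro mult_right_mono) auto
      with * show ?thesis by (auto elim!: eventually_mono)
    qed
    show "AE x in lebesgue. x \<in> ball x0 r - {x0} \<longrightarrow> \<alpha> 0 * m \<le> u x"
      if "AE x in lebesgue. x \<in> ball x0 r \<longrightarrow> c x \<le> 0"
      using main[of 0] that by (simp add: AE_completion_iff)
  qed
qed

end
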